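(* Let $\mathcal{H}$ be a real Hilbert space, $T>0$, $I=[0,T]$, and $D:=\{(t,s)\in I\times I: s\le t\}$. Assume: (C) $C\colon I\rightrightarrows\mathcal{H}$ is a set-valued map with nonempty, closed and $\rho$-uniformly prox-regular values, for some $\rho>0$, and there is an absolutely continuous function $v\colon I\to\mathbb{R}$ such that $\operatorname{Haus}(C(t),C(s))\le |v(t)-v(s)|$ for all $t,s\in I$. (f) $f\colon I\times\mathcal{H}\to\mathcal{H}$ satisfies: (i) for each $x\in\mathcal{H}$ the map $t\mapsto f(t,x)$ is measurable; (ii) there are nonnegative integrable functions $\alpha,\beta\colon I\to\mathbb{R}$ with $\|f(t,x)\|\le \alpha(t)\|x\|+\beta(t)$ for all $(t,x)\in I\times\mathcal{H}$; (iii) for each $r>0$ there is a constant $\kappa_f^r\ge 0$ such that $\|f(t,x)-f(t,y)\|\le\kappa_f^r\|x-y\|$ for all $x,y\in r\mathbb{B}$ and $t\in I$. (g) $g\colon I\times I\times\mathcal{H}\to\mathcal{H}$ satisfies: (a) for each $x\in\mathcal{H}$ the map $(t,s)\mapsto g(t,s,x)$ is measurable; (b) for all $r>0$ there is an integrable function $\mu_r\colon I\to\mathbb{R}_+$ such that for all $(t,s)\in D$, $\|g(t,s,x)-g(t,s,y)\|\le\mu_r(t)\|x-y\|$ for all $x,y\in r\mathbb{B}$; (c) there is a nonnegative integrable function $\sigma\colon D\to\mathbb{R}$ such that $\|g(t,s,x)\|\le\sigma(t,s)(1+\|x\|)$ for all $(t,s)\in D$ and $x\in\mathcal{H}$. Then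 for any $x_0\in C(0)$ there exists a unique absolutely continuous solution $x\colon I\to\mathcal{H}$ of $$\dot{x}(t)\in -N_{C(t)}(x(t))+f(t,x(t))+\int_0^t g(t,s,x(s))\,ds\ \text{ for a.e. } t\in I,\qquad x(0)=x_0.$$
   Context: $\mathbb{B}$ is the closed unit ball of $\mathcal{H}$. A function $x\colon[0,T]\to\mathcal{H}$ is absolutely continuous if there are $x_0\in\mathcal{H}$ and $h\in L^1([0,T];\mathcal{H})$ with $x(t)=x_0+\int_0^t h(s)\,ds$ for all $t\in[0,T]$ (then $\dot{x}=h$ a.e.). For a nonempty closed set $S\subset\mathcal{H}$, $d_S(x)=\inf_{y\in S}\|x-y\|$, and $\operatorname{Proj}_S(x)$ is the set of points of $S$ at which this infimum is attained. For closed sets $A,B$, $\operatorname{Haus}(A,B)=\max\{\sup_{x\in A}d_B(x),\sup_{x\in B}d_A(x)\}$. $N_S(x)$ denotes the proximal normal cone: for $x\in S$, $v\in N_S(x)$ iff there is $\sigma\ge 0$ such that $\langle v,y-x\rangle\le\sigma\|y-x\|^2$ for all $y\in S$; for $x\notin S$, $N_S(x)=\emptyset$. A closed set $S$ is $\rho$-uniformly prox-regular ($\rho\in\,]0,+\infty]$) if for all $x\in S$ and all $v\in N_S(x)\cap\mathbb{B}$ one has $x\in\operatorname{Proj}_S(x+tv)$ for every real $t$ with $0\le t\le\rho$. *)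

theory Defs
  imports "HOL-Analysis.Analysis"
begin

text \<open>
  The Bochner integral of \<open>HOL-Analysis\<close> is only available for second countable target spaces,
  while the Hilbert space considered here is arbitrary. The integral is therefore defined
  for functions into a real normed vector space, from the library's simple functions.
  Measurability is strong (Bochner) measurability; for separable targets and complete
  measures it is the same as Borel measurability.
\<close>

definition strongly_measurable ::
    "'b measure \<Rightarrow> ('b \<Rightarrow> 'a::topological_space) \<Rightarrow> bool" where
  "strongly_measurable M f \<longleftrightarrow>
    (\<exists>s. (\<forall>i::nat. simple_function M (s i)) \<and> (AE x in M. (\<lambda>i. s i x) \<longlonglongrightarrow> f x))"

definition has_strong_integral ::
    "'b measure \<Rightarrow> ('b \<Rightarrow> 'a::real_normed_vector) \<Rightarrow> 'a \<Rightarrow> bool" where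
  "has_strong_integral M f J \<longleftrightarrow>
    strongly_measurable M f \<and>
    (\<exists>s. (\<forall>i::nat. Bochner_Integration.simple_bochner_integrable M (s i)) \<and>
         (\<lambda>i. \<integral>\<^sup>+x. ennreal (norm (f x - s i x)) \<partial>M) \<longlonglongrightarrow> 0 \<and>
         (\<lambda>i. Bochner_Integration.simple_bochner_integral M (s i)) \<longlonglongrightarrow> J)"

definition strongly_integrable ::
    "'b measure \<Rightarrow> ('b \<Rightarrow> 'a::real_normed_vector) \<Rightarrow> bool" where
  "strongly_integrable M f \<longleftrightarrow> (\<exists>J. has_strong_integral M f J)"

definition strong_integral ::
    "'b measure \<Rightarrow> ('b \<Rightarrow> 'a::real_normed_vector) \<Rightarrow> 'a" where
  "strong_integral M f =
    (if strongly_integrable M f then (THE J. has_strong_integral M f J) else 0)"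

definition absolutely_continuous_upto :: "real \<Rightarrow> (real \<Rightarrow> 'a::real_normed_vector) \<Rightarrow> bool" where
  "absolutely_continuous_upto T x \<longleftrightarrow>
    (\<exists>x\<^sub>0 h. strongly_integrable (lebesgue_on {0..T}) h \<and>
      (\<forall>t\<in>{0..T}. x t = x\<^sub>0 + strong_integral (lebesgue_on {0..t}) h))"

text \<open>The Hausdorff distance may be infinite, hence the extended values.\<close>

definition Haus :: "'a::metric_space set \<Rightarrow> 'a set \<Rightarrow> ennreal" where
  "Haus A B = max (SUP x\<in>A. ennreal (infdist x B)) (SUP x\<in>B. ennreal (infdist x A))"

definition Proj :: "'a::metric_space set \<Rightarrow> 'a \<Rightarrow> 'a set" where
  "Proj S x = {y \<in> S. dist x y = infdist x S}"

definition prox_normal_cone :: "'a::real_inner set \<Rightarrow> 'a \<Rightarrow> 'a set" where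
  "prox_normal_cone S x =
    (if x \<in> S then {v. \<exists>\<sigma>\<ge>0. \<forall>y\<in>S. v \<bullet> (y - x) \<le> \<sigma> * (norm (y - x))\<^sup>2} else {})"

definition uniformly_prox_regular :: "ereal \<Rightarrow> 'a::real_inner set \<Rightarrow> bool" where
  "uniformly_prox_regular \<rho> S \<longleftrightarrow>
    closed S \<and>
    (\<forall>x\<in>S. \<forall>v \<in> prox_normal_cone S x \<inter> cball 0 1.
      \<forall>t::real. 0 \<le> t \<and> ereal t \<le> \<rho> \<longrightarrow> x \<in> Proj S (x + t *\<^sub>R v))"

text \<open>
  In the inclusion, the derivative and the integral are required to exist
  for almost every time, so that no default value enters.
\<close>

definition sweeping_solution ::
    "real \<Rightarrow> (real \<Rightarrow> 'a set) \<Rightarrow> (real \<Rightarrow> 'a \<Rightarrow> 'a) \<Rightarrow> (real \<Rightarrow> real \<Rightarrow> 'a \<Rightarrow> 'a) \<Rightarrow>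
      'a \<Rightarrow> (real \<Rightarrow> 'a::{real_inner,complete_space}) \<Rightarrow> bool" where
  "sweeping_solution T C f g x\<^sub>0 x \<longleftrightarrow>
    absolutely_continuous_upto T x \<and> x 0 = x\<^sub>0 \<and>
    (AE t in lebesgue_on {0..T}.
      \<exists>w. (x has_vector_derivative w) (at t within {0..T}) \<and>
        strongly_integrable (lebesgue_on {0..t}) (\<lambda>s. g t s (x s)) \<and>
        w \<in> {- n + f t (x t) + strong_integral (lebesgue_on {0..t}) (\<lambda>s. g t s (x s)) | n.
               n \<in> prox_normal_cone (C t) (x t)})"

end

theory Submission
  imports Defs
begin

text \<open>For a given integrable forcing \<open>F\<close>, the curve \<open>z = x - \<integral>F\<close> is swept by the translated sets
  \<open>C(t) - \<integral>F\<close>, without forcing, and these sets move at speed at most \<open>V' = \<bar>v'\<bar> + \<bar>F\<bar>\<close>. The catching-up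
  approximations along dyadic grids satisfy, between grid points \<open>s \<le> t\<close> and for all \<open>y\<close> in the set at
  time \<open>t\<close>, the inequality \<open>(z s - z t) \<bullet> (y - z t) \<le> \<Delta> (\<bar>y - z t\<bar> + 2\<Delta>)\<^sup>2 / (2r) + 2\<Delta>\<^sup>2\<close>
  with \<open>\<Delta> = V t - V s\<close>. Two curves with this property stay close, so the approximations converge
  uniformly and the limit inherits the inequality; dividing it by \<open>t - s\<close> gives the differential inclusion
  wherever \<open>z\<close> and \<open>V\<close> are differentiable, that is almost everywhere, because Hilbert spaces have the
  Radon-Nikodym property. No weak compactness is needed.

  Since the normal cones of prox-regular sets are hypomonotone, the map from \<open>x\<close> to the solution with
  forcing \<open>f(t, x t) + \<integral>g(t, s, x s) ds\<close> is a contraction for an exponentially weighted supremum norm on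
  a set of curves bounded a priori by linear growth. This gives existence by Picard iteration, and
  uniqueness.\<close>

section \<open>Strong measurability and the strong integral\<close>

text \<open>Closed balls of H are not compact, and prox-regularity speaks only of normals at points
  already in the set, so projections have to be constructed: base points with a nearest point are
  dense, and within distance less than \<open>r\<close> of the set nearest points depend Lipschitz
  continuously on the base point. The term \<open>2\<Delta>\<close> beside the distance arises
  because all projections of a stretch are tested against one point of the last set. The inequality
  serves two ends. Per step it costs two approximations a factor \<open>exp (8\<Delta> / r)\<close>
  and an error of order \<Delta> squared; such errors sum up to a multiple of the largest increment
  of V, whence the Cauchy property. And after division by \<open>t - s\<close> only
  \<open>V'(t) / (2r)\<close> times the squared distance survives, a proximal normal inequality. The
  Lipschitz constants of f and g depend on a ball, so the Picard map must preserve a bound; it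
  solves a linear integral equation. Squared distances carry the weight \<open>exp (5A)\<close>:
  integrating it gains 1/5, and absorbing the output on the left turns this into the factor
  1/4.\<close>

lemma simple_function_compose2:
  assumes "simple_function M f" "simple_function M g"
  shows "simple_function M (\<lambda>x. p (f x) (g x))"
proof -
  have "simple_function M (\<lambda>x. (f x, g x))"
    using assms by (rule simple_function_Pair)
  then have "simple_function M ((\<lambda>(a, b). p a b) \<circ> (\<lambda>x. (f x, g x)))"
    by (rule simple_function_compose)
  then show ?thesis by (simp add: comp_def)
qed

text \<open>Outside a null set \<open>N\<close> the preimages under \<open>f\<close> and
  \<open>g\<close> coincide, and the part of a preimage inside \<open>N\<close> is measurable by
  completeness.\<close>

lemma borel_measurable_AE_complete:
  fixes f g :: "'b \<Rightarrow> 'a::topological_space"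
  assumes M: "complete_measure M" and f: "f \<in> borel_measurable M"
    and ae: "AE x in M. f x = g x"
  shows "g \<in> borel_measurable M"
proof -
  obtain N where N: "{x \<in> space M. f x \<noteq> g x} \<subseteq> N" "N \<in> null_sets M"
    using ae unfolding eventually_ae_filter by blast
  show ?thesis
  proof (rule measurableI)
    fix A :: "'a set" assume A: "A \<in> sets borel"
    have *: "g -` A \<inter> space M = ((f -` A \<inter> space M) - N) \<union> ((g -` A \<inter> space M) \<inter> N)"
      using N(1) by auto
    have "(g -` A \<inter> space M) \<inter> N \<in> sets M"
      by (rule complete_measure.complete[OF M _ N(2)]) auto
    moreover have "(f -` A \<inter> space M) \<in> sets M" using f A by (rule measurable_sets)
    ultimately show "g -` A \<inter> space M \<in> sets M"
      by (subst *) (intro sets.Un sets.Diff null_setsD2[OF N(2)])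
  qed simp
qed

lemma complete_measure_lebesgue_on:
  assumes S: "S \<in> sets lebesgue"
  shows "complete_measure (lebesgue_on S)"
proof (rule complete_measure.intro)
  fix A B :: "'a set" assume B: "B \<subseteq> A" and A: "A \<in> null_sets (lebesgue_on S)"
  have A1: "A \<subseteq> S \<and> A \<in> null_sets lebesgue"
    by (rule null_sets_restrict_space[OF S, THEN iffD1, OF A])
  have "B \<in> sets lebesgue"
    by (rule completion.complete[OF B conjunct2[OF A1]])
  moreover have "B \<subseteq> S" by (rule subset_trans[OF B conjunct1[OF A1]])
  ultimately have "B \<subseteq> S \<and> B \<in> sets lebesgue" by blast
  moreover have "S \<inter> space lebesgue \<in> sets lebesgue" by (rule sets.Int[OF S sets.top])
  ultimately show "B \<in> sets (lebesgue_on S)"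
    by (rule sets_restrict_space_iff[THEN iffD2, rotated])
qed

lemma strongly_measurable_simple: "simple_function M s \<Longrightarrow> strongly_measurable M s"
  unfolding strongly_measurable_def by (intro exI[of _ "\<lambda>_. s"]) auto

lemma strongly_measurable_const: "strongly_measurable M (\<lambda>_. c)"
  by (rule strongly_measurable_simple) simp

lemma strongly_measurable_AE:
  assumes "strongly_measurable M f" "AE x in M. f x = g x"
  shows "strongly_measurable M g"
proof -
  obtain s where s: "\<And>i. simple_function M (s i)" "AE x in M. (\<lambda>i. s i x) \<longlonglongrightarrow> f x"
    using assms(1) by (auto simp: strongly_measurable_def)
  have "AE x in M. (\<lambda>i. s i x) \<longlonglongrightarrow> g x"
    using s(2) assms(2) by eventually_elim simp
  then show ?thesis using s(1) by (auto simp: strongly_measurable_def)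
qed

text \<open>A pair of simple functions is simple, and continuity of \<open>p\<close> carries the two
  limits along. Sums, differences and products with scalars are instances.\<close>

lemma strongly_measurable_compose2:
  fixes f :: "'b \<Rightarrow> 'a::topological_space" and g :: "'b \<Rightarrow> 'c::topological_space"
    and p :: "'a \<Rightarrow> 'c \<Rightarrow> 'd::topological_space"
  assumes "strongly_measurable M f" "strongly_measurable M g"
    and p: "continuous_on UNIV (\<lambda>(a, b). p a b)"
  shows "strongly_measurable M (\<lambda>x. p (f x) (g x))"
proof -
  obtain s where s: "\<And>i. simple_function M (s i)" "AE x in M. (\<lambda>i. s i x) \<longlonglongrightarrow> f x"
    using assms(1) by (auto simp: strongly_measurable_def)
  obtain t where t: "\<And>i. simple_function M (t i)" "AE x in M. (\<lambda>i. t i x) \<longlonglongrightarrow> g x"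
    using assms(2) by (auto simp: strongly_measurable_def)
  have "AE x in M. (\<lambda>i. p (s i x) (t i x)) \<longlonglongrightarrow> p (f x) (g x)"
    using s(2) t(2)
  proof eventually_elim
    fix x assume "(\<lambda>i. s i x) \<longlonglongrightarrow> f x" "(\<lambda>i. t i x) \<longlonglongrightarrow> g x"
    then have "(\<lambda>i. (s i x, t i x)) \<longlonglongrightarrow> (f x, g x)" by (rule tendsto_Pair)
    then have "(\<lambda>i. (\<lambda>(a, b). p a b) (s i x, t i x)) \<longlonglongrightarrow> (\<lambda>(a, b). p a b) (f x, g x)"
      by (rule continuous_on_tendsto_compose[OF p]) auto
    then show "(\<lambda>i. p (s i x) (t i x)) \<longlonglongrightarrow> p (f x) (g x)" by simp
  qed
  then show ?thesis
    using simple_function_compose2[OF s(1) t(1), of p]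
    unfolding strongly_measurable_def by (intro exI[of _ "\<lambda>i x. p (s i x) (t i x)"]) simp
qed

lemma strongly_measurable_compose:
  fixes f :: "'b \<Rightarrow> 'a::topological_space"
  assumes "strongly_measurable M f" and p: "continuous_on UNIV p"
  shows "strongly_measurable M (\<lambda>x. p (f x))"
proof (rule strongly_measurable_compose2[OF assms(1) strongly_measurable_const[of M "0::real"], of "\<lambda>a b. p a"])
  show "continuous_on UNIV (\<lambda>(a, b::real). p a)"
    unfolding case_prod_unfold by (rule continuous_on_compose2[OF p]) (auto intro: continuous_on_fst)
qed

lemma strongly_measurable_add:
  fixes f g :: "'b \<Rightarrow> 'a::real_normed_vector"
  assumes "strongly_measurable M f" "strongly_measurable M g"
  shows "strongly_measurable M (\<lambda>x. f x + g x)"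
  by (rule strongly_measurable_compose2[OF assms]) (simp add: case_prod_unfold, intro continuous_intros)

lemma strongly_measurable_diff:
  fixes f g :: "'b \<Rightarrow> 'a::real_normed_vector"
  assumes "strongly_measurable M f" "strongly_measurable M g"
  shows "strongly_measurable M (\<lambda>x. f x - g x)"
  by (rule strongly_measurable_compose2[OF assms]) (simp add: case_prod_unfold, intro continuous_intros)

lemma strongly_measurable_scaleR:
  fixes g :: "'b \<Rightarrow> 'a::real_normed_vector"
  assumes "strongly_measurable M f" "strongly_measurable M g"
  shows "strongly_measurable M (\<lambda>x. f x *\<^sub>R g x)"
  by (rule strongly_measurable_compose2[OF assms]) (simp add: case_prod_unfold, intro continuous_intros)

lemma strongly_measurable_sum:
  fixes f :: "'i \<Rightarrow> 'b \<Rightarrow> 'a::real_normed_vector"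
  assumes "\<And>i. i \<in> I \<Longrightarrow> strongly_measurable M (f i)"
  shows "strongly_measurable M (\<lambda>x. \<Sum>i\<in>I. f i x)"
  using assms
proof (induction I rule: infinite_finite_induct)
  case (insert i I)
  then show ?case by (simp add: strongly_measurable_add)
qed (simp_all add: strongly_measurable_const)

lemma borel_measurable_imp_strongly_measurable:
  fixes f :: "'b \<Rightarrow> 'a::{metric_space, second_countable_topology}"
  assumes "f \<in> borel_measurable M"
  shows "strongly_measurable M f"
proof -
  obtain F where "\<And>i::nat. simple_function M (F i)" "\<And>x. x \<in> space M \<Longrightarrow> (\<lambda>i. F i x) \<longlonglongrightarrow> f x"
    using borel_measurable_implies_sequence_metric[OF assms, of undefined] by blast
  then show ?thesis unfolding strongly_measurable_def by (intro exI[of _ F]) auto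
qed

text \<open>This direction gives access to measurability of real functions, such as norms and inner
  products, for targets that need not be separable.\<close>

lemma strongly_measurable_imp_borel_measurable:
  fixes f :: "'b \<Rightarrow> 'a::metric_space"
  assumes M: "complete_measure M" and "strongly_measurable M f"
  shows "f \<in> borel_measurable M"
proof -
  obtain s where s: "\<And>i. simple_function M (s i)" "AE x in M. (\<lambda>i. s i x) \<longlonglongrightarrow> f x"
    using assms(2) by (auto simp: strongly_measurable_def)
  obtain N where N: "{x \<in> space M. \<not> (\<lambda>i. s i x) \<longlonglongrightarrow> f x} \<subseteq> N" "N \<in> null_sets M"
    using s(2) unfolding eventually_ae_filter by blast
  \<comment> \<open>Freezing all functions at one fixed value on \<open>N\<close> turns convergence
    almost everywhere into convergence everywhere.\<close>
  define g where "g x = (if x \<in> N then undefined else f x)" for x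
  have "g \<in> borel_measurable M"
  proof (rule borel_measurable_LIMSEQ_metric)
    show "(\<lambda>x. if x \<in> N then undefined else s i x) \<in> borel_measurable M" for i
    proof (rule measurable_If_set)
      show "N \<inter> space M \<in> sets M" using N(2) by blast
    qed (simp_all add: borel_measurable_simple_function s(1))
    show "(\<lambda>i. if x \<in> N then undefined else s i x) \<longlonglongrightarrow> g x" if "x \<in> space M" for x
      using N(1) that by (auto simp: g_def)
  qed
  moreover have "AE x in M. g x = f x"
    using AE_not_in[OF N(2)] by eventually_elim (simp add: g_def)
  ultimately show ?thesis
    by (rule borel_measurable_AE_complete[OF M, of g f])
qed

lemma strongly_measurable_real_iff:
  fixes f :: "'b \<Rightarrow> real"
  assumes "complete_measure M"
  shows "strongly_measurable M f \<longleftrightarrow> f \<in> borel_measurable M"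
proof
  assume "strongly_measurable M f"
  with assms show "f \<in> borel_measurable M" by (rule strongly_measurable_imp_borel_measurable)
qed (rule borel_measurable_imp_strongly_measurable)

lemma strongly_measurable_norm:
  fixes f :: "'b \<Rightarrow> 'a::real_normed_vector"
  assumes M: "complete_measure M" and "strongly_measurable M f"
  shows "(\<lambda>x. norm (f x)) \<in> borel_measurable M"
  using strongly_measurable_imp_borel_measurable[OF M
      strongly_measurable_compose[OF assms(2), of norm, OF continuous_on_norm_id]] .

lemma strongly_measurable_inner:
  fixes f :: "'b \<Rightarrow> 'a::real_inner"
  assumes M: "complete_measure M" and "strongly_measurable M f"
  shows "(\<lambda>x. f x \<bullet> y) \<in> borel_measurable M"
proof -
  have "continuous_on UNIV (\<lambda>z::'a. z \<bullet> y)" by (intro continuous_on_inner continuous_on_id continuous_on_const)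
  from strongly_measurable_imp_borel_measurable[OF M strongly_measurable_compose[OF assms(2) this]]
  show ?thesis .
qed

text \<open>The truncation of the approximating simple functions is made against simple
  approximations of the norm, so that it stays simple.\<close>

lemma strongly_measurable_dominated_simple:
  fixes f :: "'b \<Rightarrow> 'a::real_normed_vector"
  assumes M: "complete_measure M" and f: "strongly_measurable M f"
  obtains s where "\<And>i. simple_function M (s i)" "AE x in M. (\<lambda>i. s i x) \<longlonglongrightarrow> f x"
    "\<And>i x. x \<in> space M \<Longrightarrow> norm (s i x) \<le> 4 * norm (f x)"
proof -
  obtain s where s: "\<And>i. simple_function M (s i)" "AE x in M. (\<lambda>i. s i x) \<longlonglongrightarrow> f x"
    using f by (auto simp: strongly_measurable_def)
  obtain q where q: "\<And>i::nat. simple_function M (q i)"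
      "\<And>x. x \<in> space M \<Longrightarrow> (\<lambda>i. q i x) \<longlonglongrightarrow> norm (f x)"
      "\<And>i x. x \<in> space M \<Longrightarrow> dist (q i x) 0 \<le> 2 * dist (norm (f x)) 0"
    using borel_measurable_implies_sequence_metric[OF strongly_measurable_norm[OF M f], of 0] by blast
  \<comment> \<open>Where \<open>f x\<close> is not zero, the threshold \<open>2 * q i x\<close>
    tends to twice \<open>norm (f x)\<close>, so the truncation is eventually inactive; where
    \<open>f x = 0\<close>, all \<open>q i x\<close> vanish. The factor 4 of the claim is this 2
    times the 2 in the bound of \<open>q\<close>.\<close>
  define t where "t i x = (if norm (s i x) \<le> 2 * q i x then s i x else 0)" for i x
  have "simple_function M (t i)" for i
    unfolding t_def using simple_function_compose2[OF s(1)[of i] q(1)[of i],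
        of "\<lambda>a b. if norm a \<le> 2 * b then a else 0"] by simp
  moreover have "AE x in M. (\<lambda>i. t i x) \<longlonglongrightarrow> f x"
    using s(2) AE_space
  proof eventually_elim
    fix x assume x: "(\<lambda>i. s i x) \<longlonglongrightarrow> f x" "x \<in> space M"
    show "(\<lambda>i. t i x) \<longlonglongrightarrow> f x"
    proof (cases "f x = 0")
      case True
      then have "q i x = 0" for i using q(3)[OF x(2), of i] by simp
      then have "t i x = 0" for i by (simp add: t_def)
      then show ?thesis using True by simp
    next
      case False
      have "(\<lambda>i. 2 * q i x - norm (s i x)) \<longlonglongrightarrow> 2 * norm (f x) - norm (f x)"
        by (intro tendsto_intros q x)
      then have "\<forall>\<^sub>F i in sequentially. 0 < 2 * q i x - norm (s i x)"
        by (rule order_tendstoD(1)) (use False in simp)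
      then have "\<forall>\<^sub>F i in sequentially. t i x = s i x"
        by eventually_elim (simp add: t_def)
      then show ?thesis using x(1) by (simp add: tendsto_cong)
    qed
  qed
  moreover have "norm (t i x) \<le> 4 * norm (f x)" if "x \<in> space M" for i x
    using q(3)[OF that, of i] by (auto simp: t_def)
  ultimately show ?thesis using that by blast
qed

text \<open>Convergence in measure replaces a diagonal argument with Egorov's theorem: it is
  metrised by the integral of \<open>min 1 (norm ..)\<close>, finite because the measure is. Each
  \<open>fn n\<close> is within \<open>1 / 2 ^ n\<close> of a simple function in this metric, and a
  subsequence of the errors tends to 0 almost everywhere.\<close>

lemma strongly_measurable_LIMSEQ:
  fixes f :: "'b \<Rightarrow> 'a::real_normed_vector"
  assumes M: "complete_measure M" "finite_measure M"
    and fn: "\<And>n::nat. strongly_measurable M (fn n)"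
    and lim: "AE x in M. (\<lambda>n. fn n x) \<longlonglongrightarrow> f x"
  shows "strongly_measurable M f"
proof -
  interpret finite_measure M by fact
  have "\<exists>s. simple_function M s \<and> (\<integral>x. min 1 (norm (fn n x - s x)) \<partial>M) < 1 / 2 ^ n" for n
  proof -
    obtain s where s: "\<And>i. simple_function M (s i)" "AE x in M. (\<lambda>i. s i x) \<longlonglongrightarrow> fn n x"
      using fn by (auto simp: strongly_measurable_def)
    have "(\<lambda>i. \<integral>x. min 1 (norm (fn n x - s i x)) \<partial>M) \<longlonglongrightarrow> (\<integral>x. 0 \<partial>M)"
    proof (rule integral_dominated_convergence[where w="\<lambda>_. 1"])
      show "(\<lambda>x. min 1 (norm (fn n x - s i x))) \<in> borel_measurable M" for i
        using strongly_measurable_norm[OF M(1) strongly_measurable_diff[OF fn[of n] strongly_measurable_simple[OF s(1)[of i]]]]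
        by auto
      show "AE x in M. (\<lambda>i. min 1 (norm (fn n x - s i x))) \<longlonglongrightarrow> 0"
        using s(2)
      proof eventually_elim
        fix x assume "(\<lambda>i. s i x) \<longlonglongrightarrow> fn n x"
        then have "(\<lambda>i. min 1 (norm (fn n x - s i x))) \<longlonglongrightarrow> min 1 (norm (fn n x - fn n x))"
          by (intro tendsto_intros)
        then show "(\<lambda>i. min 1 (norm (fn n x - s i x))) \<longlonglongrightarrow> 0" by simp
      qed
    qed auto
    then have "\<forall>\<^sub>F i in sequentially. (\<integral>x. min 1 (norm (fn n x - s i x)) \<partial>M) < 1 / 2 ^ n"
      by (intro order_tendstoD(2)) auto
    then show ?thesis using s(1) by (auto simp: eventually_sequentially)
  qed
  then obtain s where s: "\<And>n. simple_function M (s n)"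
      "\<And>n. (\<integral>x. min 1 (norm (fn n x - s n x)) \<partial>M) < 1 / 2 ^ n" by metis
  have meas: "(\<lambda>x. min 1 (norm (fn n x - s n x))) \<in> borel_measurable M" for n
    using strongly_measurable_norm[OF M(1) strongly_measurable_diff[OF fn[of n] strongly_measurable_simple[OF s(1)[of n]]]]
    by auto
  have "\<exists>r. strict_mono r \<and> (AE x in M. (\<lambda>n. min 1 (norm (fn (r n) x - s (r n) x))) \<longlonglongrightarrow> 0)"
  proof (rule tendsto_L1_AE_subseq)
    show "integrable M (\<lambda>x. min 1 (norm (fn n x - s n x)))" for n
      by (rule integrable_const_bound[where B=1]) (use meas in auto)
    show "(\<lambda>n. \<integral>x. norm (min 1 (norm (fn n x - s n x))) \<partial>M) \<longlonglongrightarrow> 0"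
    proof (rule tendsto_sandwich[where f="\<lambda>_. 0" and h="\<lambda>n. (1/2)^n"])
      show "\<forall>\<^sub>F n in sequentially. (\<integral>x. norm (min 1 (norm (fn n x - s n x))) \<partial>M) \<le> (1/2)^n"
        using s(2) by (intro always_eventually) (simp add: power_divide less_imp_le)
    qed (auto intro!: LIMSEQ_realpow_zero)
  qed
  then obtain r where r: "strict_mono r"
    "AE x in M. (\<lambda>n. min 1 (norm (fn (r n) x - s (r n) x))) \<longlonglongrightarrow> 0" by blast
  have "AE x in M. (\<lambda>n. s (r n) x) \<longlonglongrightarrow> f x"
    using r(2) lim
  proof eventually_elim
    fix x assume x: "(\<lambda>n. min 1 (norm (fn (r n) x - s (r n) x))) \<longlonglongrightarrow> 0" "(\<lambda>n. fn n x) \<longlonglongrightarrow> f x"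
    \<comment> \<open>Once the minimum is below 1, it is the norm itself.\<close>
    have "\<forall>\<^sub>F n in sequentially. min 1 (norm (fn (r n) x - s (r n) x)) < 1"
      using x(1) by (rule order_tendstoD(2)) simp
    then have "\<forall>\<^sub>F n in sequentially. min 1 (norm (fn (r n) x - s (r n) x)) = norm (fn (r n) x - s (r n) x)"
      by eventually_elim auto
    then have "(\<lambda>n. norm (fn (r n) x - s (r n) x)) \<longlonglongrightarrow> 0"
      using x(1) by (simp add: tendsto_cong)
    then have "(\<lambda>n. fn (r n) x - s (r n) x) \<longlonglongrightarrow> 0"
      by (simp add: tendsto_norm_zero_iff)
    moreover have "(\<lambda>n. fn (r n) x) \<longlonglongrightarrow> f x"
      using LIMSEQ_subseq_LIMSEQ[OF x(2) r(1)] by (simp add: comp_def)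
    ultimately have "(\<lambda>n. fn (r n) x - (fn (r n) x - s (r n) x)) \<longlonglongrightarrow> f x - 0"
      by (intro tendsto_diff)
    then show "(\<lambda>n. s (r n) x) \<longlonglongrightarrow> f x" by simp
  qed
  then show ?thesis using s(1) unfolding strongly_measurable_def by (intro exI[of _ "\<lambda>n. s (r n)"]) auto
qed

text \<open>Comparing two simple functions through \<open>f\<close> makes the integrals of simple
  approximations in the mean a Cauchy sequence.\<close>

lemma norm_simple_bochner_integral_diff_le:
  fixes f :: "'b \<Rightarrow> 'a::real_normed_vector"
  assumes M: "complete_measure M" and f: "strongly_measurable M f"
    and s: "Bochner_Integration.simple_bochner_integrable M s"
    and t: "Bochner_Integration.simple_bochner_integrable M t"
  shows "ennreal (norm (Bochner_Integration.simple_bochner_integral M s - Bochner_Integration.simple_bochner_integral M t))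
    \<le> (\<integral>\<^sup>+x. ennreal (norm (f x - s x)) \<partial>M) + (\<integral>\<^sup>+x. ennreal (norm (f x - t x)) \<partial>M)"
proof -
  have st: "Bochner_Integration.simple_bochner_integrable M (\<lambda>x. s x - t x)"
    by (rule Bochner_Integration.simple_bochner_integrable_compose2[OF _ s t]) simp
  then have nst: "Bochner_Integration.simple_bochner_integrable M (\<lambda>x. norm (s x - t x))"
    using Bochner_Integration.simple_bochner_integrable_compose2[of "\<lambda>a b. norm a", OF _ st st] by simp
  have meas: "(\<lambda>x. norm (f x - s x)) \<in> borel_measurable M" "(\<lambda>x. norm (f x - t x)) \<in> borel_measurable M"
    using s t by (auto intro: strongly_measurable_norm[OF M strongly_measurable_diff[OF f strongly_measurable_simple]]
        elim: Bochner_Integration.simple_bochner_integrable.cases)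
  have "norm (Bochner_Integration.simple_bochner_integral M s - Bochner_Integration.simple_bochner_integral M t)
      = norm (Bochner_Integration.simple_bochner_integral M (\<lambda>x. s x - t x))"
    by (simp add: Bochner_Integration.simple_bochner_integral_diff[OF s t])
  also have "\<dots> \<le> Bochner_Integration.simple_bochner_integral M (\<lambda>x. norm (s x - t x))"
    by (rule Bochner_Integration.simple_bochner_integral_norm_bound[OF st])
  finally have "ennreal (norm (Bochner_Integration.simple_bochner_integral M s - Bochner_Integration.simple_bochner_integral M t))
    \<le> (\<integral>\<^sup>+x. ennreal (norm (s x - t x)) \<partial>M)"
    using Bochner_Integration.simple_bochner_integral_eq_nn_integral[OF nst] by (metis ennreal_leI norm_ge_zero)
  also have "\<dots> \<le> (\<integral>\<^sup>+x. ennreal (norm (f x - s x)) + ennreal (norm (f x - t x)) \<partial>M)"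
  proof (rule nn_integral_mono)
    fix x
    have "norm (s x - t x) \<le> norm (f x - s x) + norm (f x - t x)"
      using norm_triangle_ineq4[of "f x - t x" "f x - s x"] by (simp add: add.commute)
    then show "ennreal (norm (s x - t x)) \<le> ennreal (norm (f x - s x)) + ennreal (norm (f x - t x))"
      by (metis ennreal_leI ennreal_plus norm_ge_zero)
  qed
  also have "\<dots> = (\<integral>\<^sup>+x. ennreal (norm (f x - s x)) \<partial>M) + (\<integral>\<^sup>+x. ennreal (norm (f x - t x)) \<partial>M)"
    using meas by (intro nn_integral_add) auto
  finally show ?thesis .
qed

text \<open>Dominated simple approximations converge to \<open>f\<close> in the mean by dominated
  convergence, their integrals form a Cauchy sequence, and completeness of the space supplies the
  value.\<close>

lemma has_strong_integral_exists:
  fixes f :: "'b \<Rightarrow> 'a::{real_normed_vector,complete_space}"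
  assumes M: "complete_measure M" and f: "strongly_measurable M f"
    and int: "integrable M (\<lambda>x. norm (f x))"
  shows "\<exists>J. has_strong_integral M f J"
proof -
  obtain s where s: "\<And>i. simple_function M (s i)" "AE x in M. (\<lambda>i. s i x) \<longlonglongrightarrow> f x"
    "\<And>i x. x \<in> space M \<Longrightarrow> norm (s i x) \<le> 4 * norm (f x)"
    using strongly_measurable_dominated_simple[OF M f] by blast
  have fin: "(\<integral>\<^sup>+x. ennreal (norm (f x)) \<partial>M) < \<infinity>"
    using int by (simp add: integrable_iff_bounded)
  have sbi: "Bochner_Integration.simple_bochner_integrable M (s i)" for i
  proof (rule Bochner_Integration.simple_bochner_integrableI_bounded[OF s(1)])
    have "integrable M (\<lambda>x. norm (s i x))"
      by (rule Bochner_Integration.integrable_bound[OF integrable_mult_right[OF int, of 4]])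
        (use s(3) strongly_measurable_norm[OF M strongly_measurable_simple[OF s(1)]] in auto)
    then show "(\<integral>\<^sup>+x. ennreal (norm (s i x)) \<partial>M) < \<infinity>" by (simp add: integrable_iff_bounded)
  qed
  have meas: "(\<lambda>x. norm (f x - s i x)) \<in> borel_measurable M" for i
    by (intro strongly_measurable_norm[OF M] strongly_measurable_diff f strongly_measurable_simple s)
  have lim: "(\<lambda>i. \<integral>\<^sup>+x. ennreal (norm (f x - s i x)) \<partial>M) \<longlonglongrightarrow> 0"
  proof -
    have "(\<lambda>i. \<integral>\<^sup>+x. ennreal (norm (f x - s i x)) \<partial>M) \<longlonglongrightarrow> (\<integral>\<^sup>+x. 0 \<partial>M)"
    \<comment> \<open>The factor 5 is 1 for \<open>f\<close> plus 4 for its simple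
      approximations.\<close>
    proof (rule nn_integral_dominated_convergence[where w="\<lambda>x. ennreal (5 * norm (f x))"])
      show "AE x in M. (\<lambda>i. ennreal (norm (f x - s i x))) \<longlonglongrightarrow> 0"
        using s(2)
      proof eventually_elim
        fix x assume "(\<lambda>i. s i x) \<longlonglongrightarrow> f x"
        then have "(\<lambda>i. ennreal (norm (f x - s i x))) \<longlonglongrightarrow> ennreal (norm (f x - f x))"
          by (intro tendsto_intros tendsto_ennrealI)
        then show "(\<lambda>i. ennreal (norm (f x - s i x))) \<longlonglongrightarrow> 0" by simp
      qed
      show "AE x in M. ennreal (norm (f x - s i x)) \<le> ennreal (5 * norm (f x))" for i
      proof (rule AE_I2)
        fix x assume "x \<in> space M"
        then have "norm (f x - s i x) \<le> 5 * norm (f x)"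
          using norm_triangle_ineq4[of "f x" "s i x"] s(3)[of x i] by simp
        then show "ennreal (norm (f x - s i x)) \<le> ennreal (5 * norm (f x))" by (rule ennreal_leI)
      qed
      show "(\<integral>\<^sup>+x. ennreal (5 * norm (f x)) \<partial>M) < \<infinity>"
        using fin int by (simp add: ennreal_mult nn_integral_cmult ennreal_mult_less_top)
    qed (use meas int in auto)
    then show ?thesis by simp
  qed
  have "Cauchy (\<lambda>i. Bochner_Integration.simple_bochner_integral M (s i))"
  proof (rule metric_CauchyI)
    fix e :: real assume "e > 0"
    then have "\<forall>\<^sub>F i in sequentially. (\<integral>\<^sup>+x. ennreal (norm (f x - s i x)) \<partial>M) < ennreal (e/2)"
      using lim by (intro order_tendstoD(2)) auto
    then obtain N where N: "\<And>i. i \<ge> N \<Longrightarrow> (\<integral>\<^sup>+x. ennreal (norm (f x - s i x)) \<partial>M) < ennreal (e/2)"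
      by (auto simp: eventually_sequentially)
    have "dist (Bochner_Integration.simple_bochner_integral M (s m)) (Bochner_Integration.simple_bochner_integral M (s n)) < e"
      if "m \<ge> N" "n \<ge> N" for m n
    proof -
      have "ennreal (dist (Bochner_Integration.simple_bochner_integral M (s m)) (Bochner_Integration.simple_bochner_integral M (s n)))
        < ennreal (e/2) + ennreal (e/2)"
        unfolding dist_norm
        by (rule le_less_trans[OF norm_simple_bochner_integral_diff_le[OF M f sbi sbi] add_strict_mono])
          (use N that in auto)
      also have "\<dots> = ennreal e" using \<open>e > 0\<close> by (simp flip: ennreal_plus)
      finally show ?thesis using \<open>e > 0\<close> by (simp add: ennreal_less_iff)
    qed
    then show "\<exists>N. \<forall>m\<ge>N. \<forall>n\<ge>N. dist (Bochner_Integration.simple_bochner_integral M (s m)) (Bochner_Integration.simple_bochner_integral M (s n)) < e"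
      by blast
  qed
  then obtain J where "(\<lambda>i. Bochner_Integration.simple_bochner_integral M (s i)) \<longlonglongrightarrow> J"
    using Cauchy_convergent convergent_def by blast
  then show ?thesis unfolding has_strong_integral_def using f sbi lim by blast
qed

text \<open>One simple integrable function at mean distance less than 1 from \<open>f\<close>
  suffices.\<close>

lemma has_strong_integral_imp_integrable_norm:
  fixes f :: "'b \<Rightarrow> 'a::real_normed_vector"
  assumes M: "complete_measure M" and f: "has_strong_integral M f J"
  shows "integrable M (\<lambda>x. norm (f x))"
proof -
  obtain s where sm: "strongly_measurable M f"
    and s: "\<And>i. Bochner_Integration.simple_bochner_integrable M (s i)"
    "(\<lambda>i. \<integral>\<^sup>+x. ennreal (norm (f x - s i x)) \<partial>M) \<longlonglongrightarrow> 0"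
    using f unfolding has_strong_integral_def by blast
  have "\<forall>\<^sub>F i in sequentially. (\<integral>\<^sup>+x. ennreal (norm (f x - s i x)) \<partial>M) < 1"
    using s(2) by (rule order_tendstoD(2)) simp
  then obtain i where i: "(\<integral>\<^sup>+x. ennreal (norm (f x - s i x)) \<partial>M) < 1"
    by (auto simp: eventually_sequentially)
  have ss: "simple_function M (s i)"
    using s(1)[of i] by (auto elim: Bochner_Integration.simple_bochner_integrable.cases)
  have ns: "Bochner_Integration.simple_bochner_integrable M (\<lambda>x. norm (s i x))"
    using Bochner_Integration.simple_bochner_integrable_compose2[of "\<lambda>a b. norm a", OF _ s(1)[of i] s(1)[of i]] by simp
  have "integrable M (\<lambda>x. norm (s i x))"
    using has_bochner_integral_simple_bochner_integrable[OF ns] by (rule integrable.intros)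
  moreover have "integrable M (\<lambda>x. norm (f x - s i x))"
    unfolding integrable_iff_bounded using i strongly_measurable_norm[OF M strongly_measurable_diff[OF sm strongly_measurable_simple[OF ss]]]
    by (auto intro: less_trans[OF i])
  ultimately have "integrable M (\<lambda>x. norm (s i x) + norm (f x - s i x))" by simp
  then show ?thesis
  proof (rule Bochner_Integration.integrable_bound)
    show "(\<lambda>x. norm (f x)) \<in> borel_measurable M" by (rule strongly_measurable_norm[OF M sm])
    show "AE x in M. norm (norm (f x)) \<le> norm (norm (s i x) + norm (f x - s i x))"
      by (rule AE_I2) (simp add: norm_triangle_sub)
  qed
qed

text \<open>Testing with a fixed vector reduces the strong integral to real integrals. Uniqueness,
  the norm bound, additivity over intervals and linearity are all deduced in this way.\<close>

lemma has_strong_integral_inner: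
  fixes f :: "'b \<Rightarrow> 'a::real_inner"
  assumes M: "complete_measure M" and f: "has_strong_integral M f J"
  shows "has_bochner_integral M (\<lambda>x. f x \<bullet> y) (J \<bullet> y)"
proof -
  obtain s where sm: "strongly_measurable M f"
    and s: "\<And>i. Bochner_Integration.simple_bochner_integrable M (s i)"
    "(\<lambda>i. \<integral>\<^sup>+x. ennreal (norm (f x - s i x)) \<partial>M) \<longlonglongrightarrow> 0"
    "(\<lambda>i. Bochner_Integration.simple_bochner_integral M (s i)) \<longlonglongrightarrow> J"
    using f unfolding has_strong_integral_def by blast
  have ss: "simple_function M (s i)" for i
    using s(1)[of i] by (auto elim: Bochner_Integration.simple_bochner_integrable.cases)
  show ?thesis
  proof (rule has_bochner_integral.intros)
    show "(\<lambda>x. f x \<bullet> y) \<in> borel_measurable M" by (rule strongly_measurable_inner[OF M sm])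
    show "Bochner_Integration.simple_bochner_integrable M (\<lambda>x. s i x \<bullet> y)" for i
      using Bochner_Integration.simple_bochner_integrable_compose2[of "\<lambda>a b. a \<bullet> y", OF _ s(1)[of i] s(1)[of i]] by simp
    have "Bochner_Integration.simple_bochner_integral M (\<lambda>x. s i x \<bullet> y) = Bochner_Integration.simple_bochner_integral M (s i) \<bullet> y" for i
      by (rule Bochner_Integration.simple_bochner_integral_linear[OF _ s(1)])
        (intro bounded_linear.linear bounded_linear_inner_left)
    then show "(\<lambda>i. Bochner_Integration.simple_bochner_integral M (\<lambda>x. s i x \<bullet> y)) \<longlonglongrightarrow> J \<bullet> y"
      using s(3) by (simp add: tendsto_inner)
    have "(\<lambda>i. ennreal (norm y) * (\<integral>\<^sup>+x. ennreal (norm (f x - s i x)) \<partial>M)) \<longlonglongrightarrow> ennreal (norm y) * 0"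
      by (intro ennreal_tendsto_cmult s) simp
    then have lim: "(\<lambda>i. ennreal (norm y) * (\<integral>\<^sup>+x. ennreal (norm (f x - s i x)) \<partial>M)) \<longlonglongrightarrow> 0" by simp
    have le: "(\<integral>\<^sup>+x. ennreal (norm (f x \<bullet> y - s i x \<bullet> y)) \<partial>M)
        \<le> ennreal (norm y) * (\<integral>\<^sup>+x. ennreal (norm (f x - s i x)) \<partial>M)" for i
    proof -
      have "(\<integral>\<^sup>+x. ennreal (norm (f x \<bullet> y - s i x \<bullet> y)) \<partial>M)
        \<le> (\<integral>\<^sup>+x. ennreal (norm y) * ennreal (norm (f x - s i x)) \<partial>M)"
        by (rule nn_integral_mono)
          (simp add: mult.commute[of "norm y"] flip: inner_diff_left ennreal_mult, rule Cauchy_Schwarz_ineq2)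
      also have "\<dots> = ennreal (norm y) * (\<integral>\<^sup>+x. ennreal (norm (f x - s i x)) \<partial>M)"
        using strongly_measurable_norm[OF M strongly_measurable_diff[OF sm strongly_measurable_simple[OF ss[of i]]]]
        by (intro nn_integral_cmult) auto
      finally show ?thesis .
    qed
    show "(\<lambda>i. \<integral>\<^sup>+x. ennreal (norm (f x \<bullet> y - s i x \<bullet> y)) \<partial>M) \<longlonglongrightarrow> 0"
      by (rule tendsto_sandwich[OF _ _ tendsto_const lim]) (simp, intro always_eventually allI le)
  qed
qed

text \<open>Bochner's criterion.\<close>

lemma strongly_integrable_iff:
  fixes f :: "'b \<Rightarrow> 'a::{real_normed_vector,complete_space}"
  assumes M: "complete_measure M"
  shows "strongly_integrable M f \<longleftrightarrow> strongly_measurable M f \<and> integrable M (\<lambda>x. norm (f x))"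
proof
  assume "strongly_integrable M f"
  then obtain J where J: "has_strong_integral M f J" by (auto simp: strongly_integrable_def)
  then have "strongly_measurable M f" by (simp add: has_strong_integral_def)
  then show "strongly_measurable M f \<and> integrable M (\<lambda>x. norm (f x))"
    using has_strong_integral_imp_integrable_norm[OF M J] by simp
next
  assume "strongly_measurable M f \<and> integrable M (\<lambda>x. norm (f x))"
  then show "strongly_integrable M f"
    using has_strong_integral_exists[OF M, of f] by (simp add: strongly_integrable_def)
qed

lemma has_strong_integral_unique:
  fixes f :: "'b \<Rightarrow> 'a::real_inner"
  assumes M: "complete_measure M" and "has_strong_integral M f J" "has_strong_integral M f J'"
  shows "J = J'"
proof (rule vector_eq_ldot[THEN iffD1], rule allI)
  fix x
  show "x \<bullet> J = x \<bullet> J'"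
    using has_bochner_integral_eq[OF has_strong_integral_inner[OF M assms(2), of x] has_strong_integral_inner[OF M assms(3), of x]]
    by (simp add: inner_commute)
qed

lemma has_strong_integral_strong_integral:
  fixes f :: "'b \<Rightarrow> 'a::real_inner"
  assumes M: "complete_measure M" and f: "strongly_integrable M f"
  shows "has_strong_integral M f (strong_integral M f)"
proof -
  obtain J where J: "has_strong_integral M f J" using f by (auto simp: strongly_integrable_def)
  then have "(THE J. has_strong_integral M f J) = J"
    using has_strong_integral_unique[OF M] by blast
  then show ?thesis using J f by (simp add: strong_integral_def)
qed

lemma strong_integral_inner:
  fixes f :: "'b \<Rightarrow> 'a::real_inner"
  assumes M: "complete_measure M" and f: "strongly_integrable M f"
  shows "integrable M (\<lambda>x. f x \<bullet> y)" "strong_integral M f \<bullet> y = (\<integral>x. f x \<bullet> y \<partial>M)"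
  using has_strong_integral_inner[OF M has_strong_integral_strong_integral[OF M f], of y]
  by (auto simp: has_bochner_integral_iff)

text \<open>Test with the integral itself, apply the Cauchy-Schwarz inequality under the integral
  and divide by the norm.\<close>

lemma norm_strong_integral_le:
  fixes f :: "'b \<Rightarrow> 'a::{real_inner,complete_space}"
  assumes M: "complete_measure M" and f: "strongly_integrable M f"
  shows "norm (strong_integral M f) \<le> (\<integral>x. norm (f x) \<partial>M)"
proof (cases "strong_integral M f = 0")
  case False
  let ?J = "strong_integral M f"
  have int: "integrable M (\<lambda>x. norm (f x))" using f strongly_integrable_iff[OF M] by blast
  have "norm ?J * norm ?J = (\<integral>x. f x \<bullet> ?J \<partial>M)"
    using strong_integral_inner(2)[OF M f, of ?J] by (simp add: power2_norm_eq_inner flip: power2_eq_square)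
  also have "\<dots> \<le> (\<integral>x. norm (f x) * norm ?J \<partial>M)"
    by (rule integral_mono) (use strong_integral_inner(1)[OF M f] int norm_cauchy_schwarz in auto)
  also have "\<dots> = (\<integral>x. norm (f x) \<partial>M) * norm ?J" by simp
  finally show ?thesis using False by simp
qed (simp add: integral_nonneg)

lemma strong_integral_eqI:
  fixes f :: "'b \<Rightarrow> 'a::real_inner"
  assumes M: "complete_measure M" and f: "strongly_integrable M f"
    and "\<And>y. (\<integral>x. f x \<bullet> y \<partial>M) = J \<bullet> y"
  shows "strong_integral M f = J"
proof (rule vector_eq_ldot[THEN iffD1], rule allI)
  fix x
  show "x \<bullet> strong_integral M f = x \<bullet> J"
    using strong_integral_inner(2)[OF M f, of x] assms(3)[of x] by (simp add: inner_commute)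
qed

lemma strongly_integrable_real_iff:
  fixes f :: "'b \<Rightarrow> real"
  assumes M: "complete_measure M"
  shows "strongly_integrable M f \<longleftrightarrow> integrable M f"
  using strongly_integrable_iff[OF M, of f] strongly_measurable_real_iff[OF M, of f]
  by (metis borel_measurable_integrable integrable_norm integrable_norm_cancel)

lemma strong_integral_real:
  fixes f :: "'b \<Rightarrow> real"
  assumes M: "complete_measure M" and "integrable M f"
  shows "strong_integral M f = (\<integral>x. f x \<partial>M)"
  by (rule strong_integral_eqI[OF M]) (use assms strongly_integrable_real_iff[OF M] in auto)

lemma strongly_integrable_bound:
  fixes f :: "'b \<Rightarrow> 'a::{real_normed_vector,complete_space}"
  assumes M: "complete_measure M" and "strongly_measurable M f"
    and "integrable M w" "AE x in M. norm (f x) \<le> w x"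
  shows "strongly_integrable M f"
  unfolding strongly_integrable_iff[OF M]
proof
  show "integrable M (\<lambda>x. norm (f x))"
    by (rule Bochner_Integration.integrable_bound[OF assms(3)])
      (use assms strongly_measurable_norm[OF M] in auto)
qed fact

lemma strong_integral_diff:
  fixes f g :: "'b \<Rightarrow> 'a::{real_inner,complete_space}"
  assumes M: "complete_measure M" and f: "strongly_integrable M f" and g: "strongly_integrable M g"
  shows "strongly_integrable M (\<lambda>x. f x - g x)"
    "strong_integral M (\<lambda>x. f x - g x) = strong_integral M f - strong_integral M g"
proof -
  have fg: "strongly_measurable M f" "integrable M (\<lambda>x. norm (f x))"
    "strongly_measurable M g" "integrable M (\<lambda>x. norm (g x))"
    using f g strongly_integrable_iff[OF M] by auto
  show *: "strongly_integrable M (\<lambda>x. f x - g x)"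
    by (rule strongly_integrable_bound[OF M strongly_measurable_diff[OF fg(1,3)] Bochner_Integration.integrable_add[OF fg(2,4)]])
      (simp add: norm_triangle_ineq4)
  show "strong_integral M (\<lambda>x. f x - g x) = strong_integral M f - strong_integral M g"
    by (rule strong_integral_eqI[OF M *])
      (simp add: inner_diff_left strong_integral_inner[OF M f] strong_integral_inner[OF M g])
qed

section \<open>Lebesgue differentiation\<close>

lemma set_integrable_of_integrable:
  fixes f :: "'b \<Rightarrow> 'c::{banach, second_countable_topology}"
  shows "integrable M f \<Longrightarrow> A \<in> sets M \<Longrightarrow> set_integrable M A f"
  unfolding set_integrable_def by (rule integrable_mult_indicator)

text \<open>Outer regularity gives open sets \<open>U n\<close> whose excess over \<open>E\<close>
  has measure below \<open>(1/2)^n\<close>. Along a subsequence the indicators of the excess tend to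
  0 almost everywhere, so dominated convergence makes the integral over it small.\<close>

lemma set_integral_small_on_open_superset:
  fixes \<psi> :: "real \<Rightarrow> real"
  assumes \<psi>: "integrable lebesgue \<psi>" and E: "E \<in> sets lebesgue" and "e > 0"
  obtains U where "open U" "E \<subseteq> U" "(LINT x:U - E|lebesgue. \<bar>\<psi> x\<bar>) < e"
proof -
  have "\<exists>U. open U \<and> E \<subseteq> U \<and> U - E \<in> lmeasurable \<and> emeasure lebesgue (U - E) < ennreal ((1/2)^n)" for n
    using sets_lebesgue_outer_open[OF E, of "(1/2)^n"] by force
  then obtain U where U: "\<And>n. open (U n)" "\<And>n. E \<subseteq> U n" "\<And>n. U n - E \<in> lmeasurable"
    "\<And>n. emeasure lebesgue (U n - E) < ennreal ((1/2)^n)" by metis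
  have m: "measure lebesgue (U n - E) \<le> (1/2)^n" for n
    using U(4)[of n] emeasure_eq_measure2[OF U(3)[of n]] by (simp add: ennreal_less_iff)
  have "\<exists>r. strict_mono r \<and> (AE x in lebesgue. (\<lambda>n. indicat_real (U (r n) - E) x) \<longlonglongrightarrow> 0)"
  proof (rule tendsto_L1_AE_subseq)
    show "integrable lebesgue (indicat_real (U n - E))" for n
      using U(3)[of n] by (intro integrable_real_indicator) (auto simp: fmeasurable_def)
    show "(\<lambda>n. \<integral>x. norm (indicat_real (U n - E) x) \<partial>lebesgue) \<longlonglongrightarrow> 0"
    proof (rule tendsto_sandwich[where f="\<lambda>_. 0" and h="\<lambda>n. (1/2)^n"])
      show "\<forall>\<^sub>F n in sequentially. (\<integral>x. norm (indicat_real (U n - E) x) \<partial>lebesgue) \<le> (1/2)^n"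
        using m U(3) by (intro always_eventually) (simp add: fmeasurable_def)
    qed (auto intro!: LIMSEQ_realpow_zero)
  qed
  then obtain r where "strict_mono r"
    and r: "AE x in lebesgue. (\<lambda>n. indicat_real (U (r n) - E) x) \<longlonglongrightarrow> 0" by blast
  have "(\<lambda>n. \<integral>x. indicat_real (U (r n) - E) x *\<^sub>R \<bar>\<psi> x\<bar> \<partial>lebesgue) \<longlonglongrightarrow> integral\<^sup>L lebesgue (\<lambda>x::real. 0)"
  proof (rule integral_dominated_convergence[where w="\<lambda>x. \<bar>\<psi> x\<bar>"])
    show "(\<lambda>x. indicat_real (U (r n) - E) x *\<^sub>R \<bar>\<psi> x\<bar>) \<in> borel_measurable lebesgue" for n
      by (rule borel_measurable_scaleR)
        (use U(3)[of "r n"] \<psi> in \<open>auto simp: fmeasurable_def\<close>)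
    show "AE x in lebesgue. (\<lambda>n. indicat_real (U (r n) - E) x *\<^sub>R \<bar>\<psi> x\<bar>) \<longlonglongrightarrow> 0"
      using r
    proof eventually_elim
      fix x assume "(\<lambda>n. indicat_real (U (r n) - E) x) \<longlonglongrightarrow> 0"
      then have "(\<lambda>n. indicat_real (U (r n) - E) x *\<^sub>R \<bar>\<psi> x\<bar>) \<longlonglongrightarrow> 0 *\<^sub>R \<bar>\<psi> x\<bar>"
        by (intro tendsto_intros)
      then show "(\<lambda>n. indicat_real (U (r n) - E) x *\<^sub>R \<bar>\<psi> x\<bar>) \<longlonglongrightarrow> 0" by simp
    qed
  qed (use \<psi> in \<open>auto intro!: AE_I2 simp: indicator_def\<close>)
  then have "\<forall>\<^sub>F n in sequentially. (\<integral>x. indicat_real (U (r n) - E) x *\<^sub>R \<bar>\<psi> x\<bar> \<partial>lebesgue) < e"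
    by (rule order_tendstoD(2)) (use \<open>e > 0\<close> in simp)
  then obtain n where "(\<integral>x. indicat_real (U (r n) - E) x *\<^sub>R \<bar>\<psi> x\<bar> \<partial>lebesgue) < e"
    by (auto simp: eventually_sequentially)
  with U(1,2) that show ?thesis unfolding set_lebesgue_integral_def by blast
qed

lemma set_integral_nonneg_countable_disjoint_Union:
  fixes \<psi> :: "'b \<Rightarrow> real"
  assumes \<psi>: "integrable M \<psi>" and C: "countable C" "\<And>i. i \<in> C \<Longrightarrow> B i \<in> sets M"
    "pairwise (\<lambda>i j. disjnt (B i) (B j)) C"
    and nonneg: "\<And>i. i \<in> C \<Longrightarrow> 0 \<le> (LINT x:B i|M. \<psi> x)"
  shows "0 \<le> (LINT x:(\<Union>i\<in>C. B i)|M. \<psi> x)"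
proof -
  \<comment> \<open>Enumeration by natural numbers, padded with empty sets, treats finite and
    infinite index sets alike.\<close>
  define A where "A n = (if n \<in> to_nat_on C ` C then B (from_nat_into C n) else {})" for n
  have AB: "\<exists>i\<in>C. A n = B i \<and> to_nat_on C i = n" if "n \<in> to_nat_on C ` C" for n
    using that C(1) by (auto simp: A_def)
  have A0: "A n = {}" if "n \<notin> to_nat_on C ` C" for n
    using that by (simp add: A_def)
  have A1: "A (to_nat_on C i) = B i" if "i \<in> C" for i
    using that C(1) by (simp add: A_def)
  have UA: "(\<Union>n. A n) = (\<Union>i\<in>C. B i)"
  proof
    show "(\<Union>n. A n) \<subseteq> (\<Union>i\<in>C. B i)" using AB A0 by fastforce
    show "(\<Union>i\<in>C. B i) \<subseteq> (\<Union>n. A n)" using A1 by blast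
  qed
  have Am: "A n \<in> sets M" for n
    using AB[of n] A0[of n] C(2) by (cases "n \<in> to_nat_on C ` C") auto
  have Adisj: "A m \<inter> A n = {}" if "m \<noteq> n" for m n
  proof (cases "m \<in> to_nat_on C ` C \<and> n \<in> to_nat_on C ` C")
    case True
    then obtain i j where ij: "i \<in> C" "A m = B i" "to_nat_on C i = m" "j \<in> C" "A n = B j" "to_nat_on C j = n"
      using AB by meson
    then have "i \<noteq> j" using that by auto
    then show ?thesis using C(3) ij unfolding pairwise_def disjnt_def by metis
  next
    case False
    then show ?thesis using A0 by auto
  qed
  have int: "set_integrable M (\<Union>n. A n) \<psi>"
    unfolding set_integrable_def by (rule integrable_mult_indicator[OF _ \<psi>]) (use Am in auto)
  have nn: "0 \<le> (LINT x:A n|M. \<psi> x)" for n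
    using AB[of n] A0[of n] nonneg by (cases "n \<in> to_nat_on C ` C") (auto simp: set_lebesgue_integral_def)
  have eq: "(LINT x:(\<Union>n. A n)|M. \<psi> x) = (\<Sum>n. LINT x:A n|M. \<psi> x)"
    by (rule lebesgue_integral_countable_add[OF Am Adisj int])
  have "summable (\<lambda>n. LINT x:A n|M. \<psi> x)"
  proof (rule bounded_imp_summable[OF nn])
    fix n
    have "(\<Sum>k\<le>n. LINT x:A k|M. \<psi> x) = (LINT x:(\<Union>k\<in>{..n}. A k)|M. \<psi> x)"
    proof (rule set_integral_finite_Union[symmetric])
      show "set_integrable M (A k) \<psi>" for k by (rule set_integrable_of_integrable[OF \<psi> Am])
    qed (use Adisj Am in \<open>auto simp: disjoint_family_on_def\<close>)
    also have "\<dots> \<le> (\<integral>x. \<bar>\<psi> x\<bar> \<partial>M)"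
      unfolding set_lebesgue_integral_def
    proof (rule integral_mono)
      show "integrable M (\<lambda>x. indicat_real (\<Union>k\<in>{..n}. A k) x *\<^sub>R \<psi> x)"
        by (rule integrable_mult_indicator[OF _ \<psi>]) (use Am in auto)
    qed (use \<psi> in \<open>auto simp: indicator_def\<close>)
    finally show "(\<Sum>k\<le>n. LINT x:A k|M. \<psi> x) \<le> (\<integral>x. \<bar>\<psi> x\<bar> \<partial>M)" .
  qed
  then have "0 \<le> (\<Sum>n. LINT x:A n|M. \<psi> x)" by (rule suminf_nonneg) (rule nn)
  then show ?thesis using eq UA by simp
qed

text \<open>Inside an open \<open>U\<close> with little excess over \<open>E\<close>, Vitali's
  theorem selects disjoint intervals that cover almost all of \<open>E\<close> and have nonnegative
  integrals of \<open>\<psi>\<close>. Over their union the integral is nonnegative, but the part on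
  \<open>E\<close> contributes at most \<open>- p * measure lebesgue E\<close>. Hence
  \<open>p * measure lebesgue E\<close> is at most the integral of the modulus of
  \<open>\<psi>\<close> over the excess, which is arbitrarily small.\<close>

lemma Vitali_density_null:
  fixes \<psi> :: "real \<Rightarrow> real"
  assumes \<psi>: "integrable lebesgue \<psi>" and E: "E \<in> sets lebesgue" and p: "p > 0"
    and neg: "\<And>t. t \<in> E \<Longrightarrow> \<psi> t \<le> - p"
    and int: "\<And>t \<delta>. t \<in> E \<Longrightarrow> \<delta> > 0 \<Longrightarrow>
      \<exists>a b. a < b \<and> a \<le> t \<and> t \<le> b \<and> b - a < \<delta> \<and> 0 \<le> (LINT x:{a..b}|lebesgue. \<psi> x)"
  shows "E \<in> null_sets lebesgue"
proof -
  have iE: "integrable lebesgue (indicat_real E)"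
  proof (rule Bochner_Integration.integrable_bound[of _ "\<lambda>x. \<psi> x / p"])
    show "AE x in lebesgue. norm (indicat_real E x) \<le> norm (\<psi> x / p)"
    proof (rule AE_I2)
      fix x
      show "norm (indicat_real E x) \<le> norm (\<psi> x / p)"
        using neg[of x] p by (cases "x \<in> E") (auto simp: field_simps)
    qed
  qed (use \<psi> E in auto)
  have le: "p * measure lebesgue E \<le> e" if "e > 0" for e
  proof -
    obtain U where U: "open U" "E \<subseteq> U" "(LINT x:U - E|lebesgue. \<bar>\<psi> x\<bar>) < e"
      using set_integral_small_on_open_superset[OF \<psi> E \<open>e > 0\<close>] by blast
    define K where "K = {(a, b). a < b \<and> {a..b} \<subseteq> U \<and> 0 \<le> (LINT x:{a..b}|lebesgue. \<psi> x)}"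
    define c :: "real \<times> real \<Rightarrow> real" where "c = (\<lambda>(a, b). (a + b) / 2)"
    define r :: "real \<times> real \<Rightarrow> real" where "r = (\<lambda>(a, b). (b - a) / 2)"
    have cb: "cball (c i) (r i) = {fst i..snd i}" for i
      by (cases i) (simp add: c_def r_def cball_eq_atLeastAtMost field_simps)
    have cov: "\<exists>i. i \<in> K \<and> x \<in> cball (c i) (r i) \<and> r i < d" if x: "x \<in> E" and d: "0 < d" for x d
    proof -
      obtain e' where e': "e' > 0" "ball x e' \<subseteq> U"
        using U(1,2) x by (meson open_contains_ball subsetD)
      obtain a b where ab: "a < b" "a \<le> x" "x \<le> b" "b - a < min d e'" "0 \<le> (LINT x:{a..b}|lebesgue. \<psi> x)"
        using int[OF x, of "min d e'"] d e' by auto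
      have "{a..b} \<subseteq> ball x e'" using ab by (auto simp: dist_real_def)
      then have "(a, b) \<in> K" using ab e' by (auto simp: K_def)
      then show ?thesis
        using ab by (intro exI[of _ "(a, b)"]) (simp add: cb, simp add: r_def)
    qed
    have rK: "0 < r i" if "i \<in> K" for i using that by (auto simp: K_def r_def)
    obtain D where D: "countable D" "D \<subseteq> K" "pairwise (\<lambda>i j. disjnt (cball (c i) (r i)) (cball (c j) (r j))) D"
      "negligible (E - (\<Union>i\<in>D. cball (c i) (r i)))"
      by (rule Vitali_covering_theorem_cballs[of K r E c, OF rK cov])
    define Y where "Y = (\<Union>i\<in>D. {fst i..snd i})"
    have YU: "Y \<subseteq> U" using D(2) by (fastforce simp: Y_def K_def)
    have Ym: "Y \<in> sets lebesgue" unfolding Y_def by (rule sets.countable_UN'[OF D(1)]) auto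
    have "0 \<le> (LINT x:Y|lebesgue. \<psi> x)"
      unfolding Y_def
    proof (rule set_integral_nonneg_countable_disjoint_Union[OF \<psi> D(1)])
      show "pairwise (\<lambda>i j. disjnt {fst i..snd i} {fst j..snd j}) D"
        using D(3) by (simp add: cb)
      show "0 \<le> (LINT x:{fst i..snd i}|lebesgue. \<psi> x)" if "i \<in> D" for i
        using that D(2) by (auto simp: K_def)
    qed auto
    also have "\<dots> \<le> (\<integral>x. indicat_real (U - E) x *\<^sub>R \<bar>\<psi> x\<bar> - p * indicat_real E x \<partial>lebesgue)"
      unfolding set_lebesgue_integral_def
    proof (rule integral_mono_AE)
      have "U - E \<in> sets lebesgue" using U(1) E by (intro sets.Diff) auto
      then show "integrable lebesgue (\<lambda>x. indicat_real (U - E) x *\<^sub>R \<bar>\<psi> x\<bar> - p * indicat_real E x)"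
        by (intro Bochner_Integration.integrable_diff integrable_mult_right iE integrable_mult_indicator integrable_abs \<psi>)
      have "AE x in lebesgue. x \<notin> E - Y"
        using D(4) by (intro AE_not_in) (simp add: Y_def cb negligible_iff_null_sets)
      then show "AE x in lebesgue. indicat_real Y x *\<^sub>R \<psi> x \<le> indicat_real (U - E) x *\<^sub>R \<bar>\<psi> x\<bar> - p * indicat_real E x"
      proof eventually_elim
        fix x assume "x \<notin> E - Y"
        then show "indicat_real Y x *\<^sub>R \<psi> x \<le> indicat_real (U - E) x *\<^sub>R \<bar>\<psi> x\<bar> - p * indicat_real E x"
          using neg[of x] YU U(2) by (cases "x \<in> E"; cases "x \<in> Y") (auto simp: indicator_def)
      qed
      show "integrable lebesgue (\<lambda>x. indicat_real Y x *\<^sub>R \<psi> x)"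
        by (rule integrable_mult_indicator[OF Ym \<psi>])
    qed
    also have "\<dots> = (\<integral>x. indicat_real (U - E) x *\<^sub>R \<bar>\<psi> x\<bar> \<partial>lebesgue) - p * measure lebesgue E"
    proof -
      have "U - E \<in> sets lebesgue" using U(1) E by (intro sets.Diff) auto
      then have "integrable lebesgue (\<lambda>x. indicat_real (U - E) x *\<^sub>R \<bar>\<psi> x\<bar>)"
        by (intro integrable_mult_indicator integrable_abs \<psi>)
      then show ?thesis using iE E by (subst Bochner_Integration.integral_diff) auto
    qed
    finally show ?thesis using U(3) by (simp add: set_lebesgue_integral_def)
  qed
  have "p * measure lebesgue E \<le> 0"
    by (rule field_le_epsilon) (use le in auto)
  then have "measure lebesgue E = 0" using p by (simp add: mult_le_0_iff measure_le_0_iff)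
  moreover have "emeasure lebesgue E < \<infinity>"
    using iE E by (simp add: integrable_indicator_iff)
  ultimately show ?thesis
    using E by (simp add: null_sets_def emeasure_eq_ennreal_measure less_top)
qed

lemma set_lebesgue_integral_interval_eq:
  fixes \<psi> :: "real \<Rightarrow> real"
  assumes "integrable lebesgue \<psi>"
  shows "(LINT x:{a..b}|lebesgue. \<psi> x) = integral {a..b} \<psi>"
  by (rule set_lebesgue_integral_eq_integral(2))
    (unfold set_integrable_def, rule integrable_mult_indicator[OF _ assms], simp)

lemma integrable_lebesgue_integrable_on:
  fixes \<psi> :: "real \<Rightarrow> real"
  assumes "integrable lebesgue \<psi>"
  shows "\<psi> integrable_on {a..b}"
proof -
  have "set_integrable lebesgue {a..b} \<psi>"
    unfolding set_integrable_def by (rule integrable_mult_indicator[OF _ assms]) simp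
  then show ?thesis by (rule set_lebesgue_integral_eq_integral(1))
qed

text \<open>Rational endpoints make the exceptional sets measurable.\<close>

lemma AE_upper_density:
  fixes \<phi> :: "real \<Rightarrow> real"
  assumes \<phi>: "integrable lebesgue \<phi>"
  shows "AE t in lebesgue. t \<in> {c<..<d} \<longrightarrow> (\<forall>e>0. \<exists>\<delta>>0. \<forall>a b. a \<le> t \<and> t \<le> b \<and> b - a < \<delta> \<longrightarrow>
    integral {a..b} \<phi> \<le> (\<phi> t + e) * (b - a))"
proof -
  \<comment> \<open>\<open>S q q' n\<close> collects the points lying in a short interval on which
    the mean of \<open>\<phi>\<close> exceeds \<open>q'\<close>. The estimate can fail at
    \<open>t\<close> only if \<open>t\<close> lies in some \<open>E q q'\<close> with rational
    \<open>q < q'\<close>.\<close>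
  define S where "S q q' n = (\<Union>(a, b)\<in>{(a, b). a \<in> \<rat> \<and> b \<in> \<rat> \<and> a < b \<and> b - a < 1 / real (Suc n) \<and> q' * (b - a) < integral {a..b} \<phi>}. {a..b})" for q q' :: real and n
  define E where "E q q' = ({t. \<phi> t < q} \<inter> {c<..<d}) \<inter> (\<Inter>n. S q q' n)" for q q'
  have null: "E q q' \<in> null_sets lebesgue" if "q < q'" for q q'
  proof (rule Vitali_density_null)
    \<comment> \<open>Constants are not integrable on the whole line, hence the localisation to a
      bounded interval. The intervals of the Vitali cover are taken so short that they stay inside
      it.\<close>
    define \<psi> where "\<psi> x = indicat_real {c<..<d} x *\<^sub>R (\<phi> x - q')" for x
    have i1: "integrable lebesgue (indicat_real {c<..<d})" by (cases "c \<le> d") (auto intro!: integrable_real_indicator)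
    show i\<psi>: "integrable lebesgue \<psi>"
      unfolding \<psi>_def scaleR_diff_right
      by (intro Bochner_Integration.integrable_diff integrable_mult_indicator[OF _ \<phi>] integrable_scaleR_left i1) simp
    have "S q q' n \<in> sets lebesgue" for n
      unfolding S_def
    proof (rule sets.countable_UN')
      show "countable {(a, b). a \<in> \<rat> \<and> b \<in> \<rat> \<and> a < b \<and> b - a < 1 / real (Suc n) \<and> q' * (b - a) < integral {a..b} \<phi>}"
        by (rule countable_subset[OF _ countable_SIGMA[OF countable_rat, of "\<lambda>_. \<rat>"]]) (auto intro: countable_rat)
    qed auto
    moreover have "{t. \<phi> t < q} \<in> sets lebesgue"
    proof -
      have "{t \<in> space lebesgue. \<phi> t < q} \<in> sets lebesgue"
        using \<phi> by (intro borel_measurable_less) auto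
      then show ?thesis by simp
    qed
    ultimately show "E q q' \<in> sets lebesgue"
      unfolding E_def by (intro sets.Int sets.countable_INT) auto
    show "q' - q > 0" using that by simp
    show "\<psi> t \<le> - (q' - q)" if "t \<in> E q q'" for t
      using that by (auto simp: E_def \<psi>_def)
    show "\<exists>a b. a < b \<and> a \<le> t \<and> t \<le> b \<and> b - a < \<delta> \<and> 0 \<le> (LINT x:{a..b}|lebesgue. \<psi> x)"
      if t: "t \<in> E q q'" and \<delta>: "\<delta> > 0" for t \<delta>
    proof -
      have tcd: "c < t" "t < d" using t by (auto simp: E_def)
      define m where "m = min \<delta> (min (t - c) (d - t))"
      have "m > 0" using \<delta> tcd by (simp add: m_def)
      then obtain n where n: "1 / real (Suc n) < m" using nat_approx_posE by blast
      have "t \<in> S q q' n" using t by (auto simp: E_def)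
      then obtain a b where ab: "a < b" "b - a < 1 / real (Suc n)" "q' * (b - a) < integral {a..b} \<phi>" "a \<le> t" "t \<le> b"
        by (auto simp: S_def)
      have sub: "{a..b} \<subseteq> {c<..<d}" using ab n by (auto simp: m_def)
      have "integral {a..b} \<psi> = integral {a..b} (\<lambda>x. \<phi> x - q')"
        by (rule integral_cong) (use sub in \<open>auto simp: \<psi>_def\<close>)
      also have "\<dots> = integral {a..b} \<phi> - integral {a..b} (\<lambda>x. q')"
        by (rule Henstock_Kurzweil_Integration.integral_diff) (auto intro: integrable_lebesgue_integrable_on \<phi>)
      finally have "0 \<le> (LINT x:{a..b}|lebesgue. \<psi> x)"
        using ab by (simp add: set_lebesgue_integral_interval_eq[OF i\<psi>] algebra_simps)
      then show ?thesis using ab n by (intro exI[of _ a] exI[of _ b]) (auto simp: m_def)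
    qed
  qed
  have "AE t in lebesgue. \<forall>(q, q')\<in>{(q, q'). q \<in> \<rat> \<and> q' \<in> \<rat> \<and> q < q'}. t \<notin> E q q'"
  proof (rule AE_ball_countable[THEN iffD2])
    show "countable {(q, q'). q \<in> \<rat> \<and> q' \<in> \<rat> \<and> q < (q'::real)}"
      by (rule countable_subset[OF _ countable_SIGMA[OF countable_rat, of "\<lambda>_. \<rat>"]]) (auto intro: countable_rat)
  qed (auto intro!: AE_not_in null)
  then show ?thesis
  proof eventually_elim
    fix t assume t: "\<forall>(q, q')\<in>{(q, q'). q \<in> \<rat> \<and> q' \<in> \<rat> \<and> q < q'}. t \<notin> E q q'"
    show "t \<in> {c<..<d} \<longrightarrow> (\<forall>e>0. \<exists>\<delta>>0. \<forall>a b. a \<le> t \<and> t \<le> b \<and> b - a < \<delta> \<longrightarrow>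
      integral {a..b} \<phi> \<le> (\<phi> t + e) * (b - a))"
    proof (intro impI allI)
      fix e :: real assume tcd: "t \<in> {c<..<d}" and "e > 0"
      obtain q where q: "q \<in> \<rat>" "\<phi> t < q" "q < \<phi> t + e/2" using Rats_dense_in_real[of "\<phi> t" "\<phi> t + e/2"] \<open>e > 0\<close> by auto
      obtain q' where q': "q' \<in> \<rat>" "\<phi> t + e/2 < q'" "q' < \<phi> t + e" using Rats_dense_in_real[of "\<phi> t + e/2" "\<phi> t + e"] \<open>e > 0\<close> by auto
      have "t \<notin> E q q'" using t q q' by auto
      then obtain n where n: "t \<notin> S q q' n" using q tcd by (auto simp: E_def)
      have rat: "integral {a..b} \<phi> \<le> q' * (b - a)"
        if "a \<in> \<rat>" "b \<in> \<rat>" "a < b" "b - a < 1 / real (Suc n)" "a \<le> t" "t \<le> b" for a b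
        using n that by (force simp: S_def not_less)
      have "integral {a..b} \<phi> \<le> q' * (b - a)" if ab: "a \<le> t" "t \<le> b" "b - a < 1 / real (Suc n)" for a b
      proof -
        \<comment> \<open>\<open>h\<close> is the length by which \<open>{a..b}\<close> may still
          grow. Rational intervals around it that exceed it by less than \<open>h / 3\<close> on
          either side remain admissible, and continuity of the primitive passes their estimate on to
          \<open>{a..b}\<close>.\<close>
        define h where "h = 1 / real (Suc n) - (b - a)"
        have h: "h > 0" using ab by (simp add: h_def)
        have "\<exists>a'. a' \<in> \<rat> \<and> a - h / real (k + 3) < a' \<and> a' < a" for k :: nat
          using Rats_dense_in_real[of "a - h / real (k + 3)" a] h by auto
        then obtain A where A: "\<And>k::nat. A k \<in> \<rat>" "\<And>k. a - h / real (k + 3) < A k" "\<And>k. A k < a" by metis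
        have "\<exists>b'. b' \<in> \<rat> \<and> b < b' \<and> b' < b + h / real (k + 3)" for k :: nat
          using Rats_dense_in_real[of b "b + h / real (k + 3)"] h by auto
        then obtain B where B: "\<And>k::nat. B k \<in> \<rat>" "\<And>k. b < B k" "\<And>k. B k < b + h / real (k + 3)" by metis
        have h3: "h / real (k + 3) \<le> h / 3" for k using h by (intro divide_left_mono) auto
        have lim: "(\<lambda>k. h / real (k + 3)) \<longlonglongrightarrow> 0" by (rule LIMSEQ_ignore_initial_segment[OF lim_const_over_n])
        have Al: "A \<longlonglongrightarrow> a"
        proof (rule tendsto_sandwich)
          show "(\<lambda>k. a - h / real (k + 3)) \<longlonglongrightarrow> a" using tendsto_diff[OF tendsto_const lim, of a] by simp
        qed (use A in \<open>auto intro!: always_eventually less_imp_le\<close>)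
        have Bl: "B \<longlonglongrightarrow> b"
        proof (rule tendsto_sandwich[where f="\<lambda>_. b"])
          show "(\<lambda>k. b + h / real (k + 3)) \<longlonglongrightarrow> b" using tendsto_add[OF tendsto_const lim, of b] by simp
        qed (use B in \<open>auto intro!: always_eventually less_imp_le\<close>)
        define F where "F x = integral {a - h..x} \<phi>" for x
        have cF: "continuous_on {a - h..b + h} F"
          unfolding F_def by (rule indefinite_integral_continuous_1) (rule integrable_lebesgue_integrable_on[OF \<phi>])
        have mem: "A k \<in> {a - h..b + h}" "B k \<in> {a - h..b + h}" for k
          using A(2,3)[of k] B(2,3)[of k] h3[of k] ab h unfolding atLeastAtMost_iff by linarith+
        have FF: "F y - F x = integral {x..y} \<phi>" if "a - h \<le> x" "x \<le> y" for x y
          using Henstock_Kurzweil_Integration.integral_combine[OF that integrable_lebesgue_integrable_on[OF \<phi>]] by (simp add: F_def)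
        have "(\<lambda>k. F (B k) - F (A k)) \<longlonglongrightarrow> F b - F a"
          by (intro tendsto_diff continuous_on_tendsto_compose[OF cF])
            (use Al Bl mem ab h in \<open>auto intro!: always_eventually\<close>)
        moreover have "F (B k) - F (A k) = integral {A k..B k} \<phi>" for k
          by (rule FF) (use mem[of k] A(3)[of k] B(2)[of k] ab in auto)
        moreover have "F b - F a = integral {a..b} \<phi>" by (rule FF) (use ab h in auto)
        ultimately have l1: "(\<lambda>k. integral {A k..B k} \<phi>) \<longlonglongrightarrow> integral {a..b} \<phi>" by simp
        have l2: "(\<lambda>k. q' * (B k - A k)) \<longlonglongrightarrow> q' * (b - a)" by (intro tendsto_intros Al Bl)
        have l3: "integral {A k..B k} \<phi> \<le> q' * (B k - A k)" for k
        proof (rule rat)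
          show "A k \<in> \<rat>" "B k \<in> \<rat>" "A k \<le> t" "t \<le> B k" "A k < B k" using A[of k] B[of k] ab by auto
          show "B k - A k < 1 / real (Suc n)" 
          proof -
            have "1 / real (Suc n) = h + (b - a)" by (simp add: h_def)
            then show ?thesis using A(2)[of k] B(3)[of k] h3[of k] h by linarith
          qed
        qed
        show ?thesis by (rule LIMSEQ_le[OF l1 l2]) (use l3 in auto)
      qed
      moreover have "q' * (b - a) \<le> (\<phi> t + e) * (b - a)" if "a \<le> t" "t \<le> b" for a b
        using that q' by (intro mult_right_mono) auto
      ultimately have "\<forall>a b. a \<le> t \<and> t \<le> b \<and> b - a < 1 / real (Suc n) \<longrightarrow> integral {a..b} \<phi> \<le> (\<phi> t + e) * (b - a)"
        by (meson order_trans)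
      then show "\<exists>\<delta>>0. \<forall>a b. a \<le> t \<and> t \<le> b \<and> b - a < \<delta> \<longrightarrow> integral {a..b} \<phi> \<le> (\<phi> t + e) * (b - a)"
        by (intro exI[of _ "1 / real (Suc n)"]) simp
    qed
  qed
qed


text \<open>The upper density estimate is applied to \<open>\<phi>\<close> and to
  \<open>- \<phi>\<close>, both extended by zero. The window from -1 to \<open>T + 1\<close>
  contains the end points 0 and \<open>T\<close> in its interior.\<close>

lemma AE_has_real_derivative_integral:
  fixes \<phi> :: "real \<Rightarrow> real"
  assumes \<phi>: "integrable (lebesgue_on {0..T}) \<phi>"
  shows "AE t in lebesgue_on {0..T}. ((\<lambda>u. integral {0..u} \<phi>) has_real_derivative \<phi> t) (at t within {0..T})"
proof -
  define \<phi>0 where "\<phi>0 t = (if t \<in> {0..T} then \<phi> t else 0)" for t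
  have i0: "integrable lebesgue \<phi>0"
    unfolding \<phi>0_def using Lebesgue_Measure.integrable_restrict_UNIV[of "{0..T}" \<phi>] \<phi> by simp
  have im: "integrable lebesgue (\<lambda>t. - \<phi>0 t)" using i0 by simp
  have "AE t in lebesgue. t \<in> {0..T} \<longrightarrow> ((\<lambda>u. integral {0..u} \<phi>) has_real_derivative \<phi> t) (at t within {0..T})"
    using AE_upper_density[OF i0, of "-1" "T + 1"] AE_upper_density[OF im, of "-1" "T + 1"]
  proof eventually_elim
    fix t
    assume up: "t \<in> {-1<..<T + 1} \<longrightarrow> (\<forall>e>0. \<exists>\<delta>>0. \<forall>a b. a \<le> t \<and> t \<le> b \<and> b - a < \<delta> \<longrightarrow>
        integral {a..b} \<phi>0 \<le> (\<phi>0 t + e) * (b - a))"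
      and lo: "t \<in> {-1<..<T + 1} \<longrightarrow> (\<forall>e>0. \<exists>\<delta>>0. \<forall>a b. a \<le> t \<and> t \<le> b \<and> b - a < \<delta> \<longrightarrow>
        integral {a..b} (\<lambda>t. - \<phi>0 t) \<le> (- \<phi>0 t + e) * (b - a))"
    show "t \<in> {0..T} \<longrightarrow> ((\<lambda>u. integral {0..u} \<phi>) has_real_derivative \<phi> t) (at t within {0..T})"
    proof
      assume t: "t \<in> {0..T}"
      show "((\<lambda>u. integral {0..u} \<phi>) has_real_derivative \<phi> t) (at t within {0..T})"
        unfolding has_field_derivative_def has_derivative_within_alt
      proof (intro conjI allI impI bounded_linear_mult_right)
        fix e :: real assume "0 < e"
        obtain d1 where d1: "d1 > 0" "\<And>a b. a \<le> t \<Longrightarrow> t \<le> b \<Longrightarrow> b - a < d1 \<Longrightarrow> integral {a..b} \<phi>0 \<le> (\<phi>0 t + e) * (b - a)"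
          using up t \<open>e > 0\<close> by force
        obtain d2 where d2: "d2 > 0" "\<And>a b. a \<le> t \<Longrightarrow> t \<le> b \<Longrightarrow> b - a < d2 \<Longrightarrow> integral {a..b} (\<lambda>t. - \<phi>0 t) \<le> (- \<phi>0 t + e) * (b - a)"
          using lo t \<open>e > 0\<close> by force
        have bd: "\<bar>integral {a..b} \<phi> - \<phi> t * (b - a)\<bar> \<le> e * (b - a)"
          if "a \<le> t" "t \<le> b" "b - a < min d1 d2" "a \<in> {0..T}" "b \<in> {0..T}" for a b
        proof -
          have "integral {a..b} \<phi>0 = integral {a..b} \<phi>"
            by (rule integral_cong) (use that in \<open>auto simp: \<phi>0_def\<close>)
          moreover have "integral {a..b} (\<lambda>t. - \<phi>0 t) = - integral {a..b} \<phi>0"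
            by (rule Henstock_Kurzweil_Integration.integral_neg)
          moreover have "\<phi>0 t = \<phi> t" using t by (simp add: \<phi>0_def)
          ultimately show ?thesis
            using d1(2)[of a b] d2(2)[of a b] that by (simp add: algebra_simps abs_le_iff)
        qed
        have int: "\<phi> integrable_on {0..T}" using \<phi> by (intro integrable_on_lebesgue_on) auto
        have comb: "integral {0..b} \<phi> - integral {0..a} \<phi> = integral {a..b} \<phi>" if "0 \<le> a" "a \<le> b" "b \<le> T" for a b
        proof -
          have "\<phi> integrable_on {0..b}" by (rule integrable_subinterval_real[OF int]) (use that in auto)
          then show ?thesis using Henstock_Kurzweil_Integration.integral_combine[of 0 a b \<phi>] that by simp
        qed
        show "\<exists>d>0. \<forall>y\<in>{0..T}. norm (y - t) < d \<longrightarrow>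
          norm (integral {0..y} \<phi> - integral {0..t} \<phi> - \<phi> t * (y - t)) \<le> e * norm (y - t)"
        proof (intro exI[of _ "min d1 d2"] conjI ballI impI)
          fix y assume y: "y \<in> {0..T}" "norm (y - t) < min d1 d2"
          show "norm (integral {0..y} \<phi> - integral {0..t} \<phi> - \<phi> t * (y - t)) \<le> e * norm (y - t)"
          proof (cases "t \<le> y")
            case True
            then show ?thesis using bd[of t y] comb[of t y] y t by simp
          next
            case False
            then have "\<bar>integral {y..t} \<phi> - \<phi> t * (t - y)\<bar> \<le> e * (t - y)" using bd[of y t] y t by simp
            moreover have "integral {0..y} \<phi> - integral {0..t} \<phi> - \<phi> t * (y - t) = - (integral {y..t} \<phi> - \<phi> t * (t - y))"
              using comb[of y t] False y t by (simp add: algebra_simps)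
            moreover have "norm (y - t) = t - y" using False by simp
            ultimately show ?thesis by (simp only: real_norm_def abs_minus_cancel)
          qed
        qed (use d1 d2 in auto)
      qed
    qed
  qed
  then show ?thesis by (subst AE_restrict_space_iff) auto
qed

section \<open>Subintervals and primitives of vector-valued functions\<close>

lemma complete_measure_interval: "complete_measure (lebesgue_on {a..b::real})"
  by (rule complete_measure_lebesgue_on) simp

lemma integrable_lebesgue_on_subinterval:
  fixes f :: "real \<Rightarrow> 'c::{banach, second_countable_topology}"
  assumes f: "integrable (lebesgue_on {a..b}) f" and sub: "{c..d} \<subseteq> {a..b}"
  shows "integrable (lebesgue_on {c..d}) f"
proof -
  have "set_integrable lebesgue {a..b} f"
    using f integrable_restrict_space[of "{a..b}" lebesgue f] by (simp add: set_integrable_def)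
  then have "set_integrable lebesgue {c..d} f" by (rule set_integrable_subset) (use sub in auto)
  then show ?thesis
    using integrable_restrict_space[of "{c..d}" lebesgue f] by (simp add: set_integrable_def)
qed

lemma strongly_measurable_subinterval:
  fixes f :: "real \<Rightarrow> 'a::real_normed_vector"
  assumes f: "strongly_measurable (lebesgue_on {a..b}) f" and sub: "{c..d} \<subseteq> {a..b}"
  shows "strongly_measurable (lebesgue_on {c..d}) f"
proof -
  obtain s where s: "\<And>i. simple_function (lebesgue_on {a..b}) (s i)"
    "AE x in lebesgue_on {a..b}. (\<lambda>i. s i x) \<longlonglongrightarrow> f x"
    using f by (auto simp: strongly_measurable_def)
  have "simple_function (lebesgue_on {c..d}) (s i)" for i
    unfolding simple_function_def
  proof (intro conjI ballI)
    show "finite (s i ` space (lebesgue_on {c..d}))"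
      using finite_subset[OF image_mono[OF sub, of "s i"]] simple_functionD(1)[OF s(1)[of i]] by simp
    fix x
    have eq: "s i -` {x} \<inter> {c..d} = (s i -` {x} \<inter> {a..b}) \<inter> {c..d}" using sub by auto
    have "s i -` {x} \<inter> {a..b} \<in> sets (lebesgue_on {a..b})"
      using simple_functionD(2)[OF s(1)[of i], of "{x}"] by simp
    then have "s i -` {x} \<inter> {a..b} \<in> sets lebesgue" by (subst (asm) sets_restrict_space_iff) auto
    then have "s i -` {x} \<inter> {c..d} \<in> sets lebesgue" by (subst eq) (auto intro: sets.Int)
    then show "s i -` {x} \<inter> space (lebesgue_on {c..d}) \<in> sets (lebesgue_on {c..d})"
      by (subst sets_restrict_space_iff) auto
  qed
  moreover have "AE x in lebesgue_on {c..d}. (\<lambda>i. s i x) \<longlonglongrightarrow> f x"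
  proof -
    have "AE x in lebesgue. x \<in> {a..b} \<longrightarrow> (\<lambda>i. s i x) \<longlonglongrightarrow> f x"
      using s(2) by (subst (asm) AE_restrict_space_iff) auto
    then have "AE x in lebesgue. x \<in> {c..d} \<longrightarrow> (\<lambda>i. s i x) \<longlonglongrightarrow> f x"
      by eventually_elim (use sub in auto)
    then show ?thesis by (subst AE_restrict_space_iff) auto
  qed
  ultimately show ?thesis by (auto simp: strongly_measurable_def)
qed

lemma strongly_integrable_subinterval:
  fixes f :: "real \<Rightarrow> 'a::{real_normed_vector,complete_space}"
  assumes f: "strongly_integrable (lebesgue_on {a..b}) f" and sub: "{c..d} \<subseteq> {a..b}"
  shows "strongly_integrable (lebesgue_on {c..d}) f"
  using f strongly_measurable_subinterval[OF _ sub, of f] integrable_lebesgue_on_subinterval[OF _ sub, of "\<lambda>x. norm (f x)"]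
  unfolding strongly_integrable_iff[OF complete_measure_interval] by simp

lemma strongly_integrable_norm:
  fixes f :: "'b \<Rightarrow> 'a::{real_normed_vector,complete_space}"
  assumes "complete_measure M" "strongly_integrable M f"
  shows "integrable M (\<lambda>x. norm (f x))"
  using assms strongly_integrable_iff by blast

lemma lebesgue_on_interval_integral:
  fixes f :: "real \<Rightarrow> real"
  assumes "integrable (lebesgue_on {a..b}) f"
  shows "integral\<^sup>L (lebesgue_on {a..b}) f = integral {a..b} f"
  using assms by (intro lebesgue_integral_eq_integral) auto

lemma integral_combine_diff:
  fixes f :: "real \<Rightarrow> real"
  assumes f: "integrable (lebesgue_on {0..T}) f" and "0 \<le> a" "a \<le> b" "b \<le> T"
  shows "integral {0..b} f - integral {0..a} f = integral {a..b} f"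
proof -
  have "f integrable_on {0..T}" using f by (intro integrable_on_lebesgue_on) auto
  then have "f integrable_on {0..b}" by (rule integrable_subinterval_real) (use assms in auto)
  then show ?thesis using Henstock_Kurzweil_Integration.integral_combine[of 0 a b f] assms by simp
qed

lemma strong_integral_combine:
  fixes f :: "real \<Rightarrow> 'a::{real_inner,complete_space}"
  assumes f: "strongly_integrable (lebesgue_on {0..T}) f" and ab: "0 \<le> a" "a \<le> b" "b \<le> T"
  shows "strong_integral (lebesgue_on {0..b}) f - strong_integral (lebesgue_on {0..a}) f
    = strong_integral (lebesgue_on {a..b}) f"
proof -
  note C = complete_measure_interval
  have sub: "strongly_integrable (lebesgue_on {c..d}) f" if "{c..d} \<subseteq> {0..T}" for c d
    using strongly_integrable_subinterval[OF f that] .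
  have "strong_integral (lebesgue_on {a..b}) f
    = strong_integral (lebesgue_on {0..b}) f - strong_integral (lebesgue_on {0..a}) f"
  proof (rule strong_integral_eqI[OF C sub])
    fix y
    have i: "integrable (lebesgue_on {c..d}) (\<lambda>x. f x \<bullet> y)" if "{c..d} \<subseteq> {0..T}" for c d
      using strong_integral_inner(1)[OF C sub[OF that]] .
    have e: "strong_integral (lebesgue_on {c..d}) f \<bullet> y = integral {c..d} (\<lambda>x. f x \<bullet> y)" if "{c..d} \<subseteq> {0..T}" for c d
      using strong_integral_inner(2)[OF C sub[OF that]] lebesgue_on_interval_integral[OF i[OF that]] by simp
    show "(LINT x|lebesgue_on {a..b}. f x \<bullet> y) =
         (strong_integral (lebesgue_on {0..b}) f - strong_integral (lebesgue_on {0..a}) f) \<bullet> y"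
      using integral_combine_diff[OF i[of 0 T] ab] ab
      by (simp add: inner_diff_left e lebesgue_on_interval_integral i)
  qed (use ab in auto)
  then show ?thesis by simp
qed

lemma norm_strong_integral_diff_le:
  fixes f :: "real \<Rightarrow> 'a::{real_inner,complete_space}"
  assumes f: "strongly_integrable (lebesgue_on {0..T}) f" and ab: "0 \<le> a" "a \<le> b" "b \<le> T"
  shows "norm (strong_integral (lebesgue_on {0..b}) f - strong_integral (lebesgue_on {0..a}) f)
    \<le> integral {a..b} (\<lambda>x. norm (f x))"
proof -
  have sub: "strongly_integrable (lebesgue_on {a..b}) f"
    by (rule strongly_integrable_subinterval[OF f]) (use ab in auto)
  show ?thesis
    using norm_strong_integral_le[OF complete_measure_interval sub] strong_integral_combine[OF f ab]
      lebesgue_on_interval_integral[OF strongly_integrable_norm[OF complete_measure_interval sub]] by simp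
qed

lemma strongly_integrable_const_interval:
  "strongly_integrable (lebesgue_on {a..b::real}) (\<lambda>_. c::'a::{real_normed_vector,complete_space})"
proof -
  interpret finite_measure "lebesgue_on {a..b::real}" by (rule finite_measure_lebesgue_on) simp
  show ?thesis by (simp add: strongly_integrable_iff[OF complete_measure_interval] strongly_measurable_const)
qed

lemma strong_integral_const_interval:
  fixes c :: "'a::{real_inner,complete_space}"
  assumes "a \<le> b"
  shows "strong_integral (lebesgue_on {a..b::real}) (\<lambda>_. c) = (b - a) *\<^sub>R c"
  by (rule strong_integral_eqI[OF complete_measure_interval strongly_integrable_const_interval])
    (use assms in \<open>simp add: measure_restrict_space\<close>)

text \<open>A Lebesgue point argument over a countable set \<open>D\<close> of vectors. Almost every
  \<open>t\<close> is good for the real functions \<open>norm (h t - c)\<close> with all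
  \<open>c\<close> in \<open>D\<close> at once, and \<open>h t\<close> is a limit of such
  \<open>c\<close>. Subtracting a \<open>c\<close> close to \<open>h t\<close> bounds the error of
  the difference quotient by that of a real primitive.\<close>

lemma AE_has_vector_derivative_strong_integral:
  fixes h :: "real \<Rightarrow> 'a::{real_inner,complete_space}"
  assumes h: "strongly_integrable (lebesgue_on {0..T}) h"
  shows "AE t in lebesgue_on {0..T}.
    ((\<lambda>u. strong_integral (lebesgue_on {0..u}) h) has_vector_derivative h t) (at t within {0..T})"
proof -
  note C = complete_measure_interval
  obtain s where s: "\<And>i. simple_function (lebesgue_on {0..T}) (s i)"
    "AE x in lebesgue_on {0..T}. (\<lambda>i. s i x) \<longlonglongrightarrow> h x"
    using h unfolding strongly_integrable_iff[OF C] by (auto simp: strongly_measurable_def)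
  \<comment> \<open>Each simple function takes finitely many values, so \<open>D\<close> is
    countable although the space may not be separable.\<close>
  define D where "D = (\<Union>i. s i ` {0..T})"
  have D: "countable D"
    unfolding D_def
  proof (rule countable_UN[OF countableI_type])
    show "countable (s i ` {0..T})" for i
      using simple_functionD(1)[OF s(1)[of i]] by (simp add: countable_finite)
  qed
  have hc: "strongly_integrable (lebesgue_on {0..T}) (\<lambda>t. h t - c)" for c
    by (rule strong_integral_diff(1)[OF C h strongly_integrable_const_interval])
  have "AE t in lebesgue_on {0..T}. \<forall>c\<in>D.
    ((\<lambda>u. integral {0..u} (\<lambda>t. norm (h t - c))) has_real_derivative norm (h t - c)) (at t within {0..T})"
    by (rule AE_ball_countable'[OF _ D]) (rule AE_has_real_derivative_integral[OF strongly_integrable_norm[OF C hc]])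
  then show ?thesis
    using s(2) AE_space
  proof eventually_elim
    fix t
    assume der: "\<forall>c\<in>D. ((\<lambda>u. integral {0..u} (\<lambda>t. norm (h t - c))) has_real_derivative norm (h t - c)) (at t within {0..T})"
      and lim: "(\<lambda>i. s i t) \<longlonglongrightarrow> h t" and "t \<in> space (lebesgue_on {0..T})"
    then have t: "t \<in> {0..T}" by simp
    let ?J = "\<lambda>u. strong_integral (lebesgue_on {0..u}) h"
    show "(?J has_vector_derivative h t) (at t within {0..T})"
      unfolding has_vector_derivative_def has_derivative_within_alt
    proof (intro conjI allI impI bounded_linear_scaleR_left)
      fix e :: real assume e: "0 < e"
      have "\<forall>\<^sub>F i in sequentially. dist (s i t) (h t) < e / 3" using lim e by (intro tendstoD) auto
      then obtain i where i: "dist (s i t) (h t) < e / 3" by (auto simp: eventually_sequentially)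
      define c where "c = s i t"
      have cD: "c \<in> D" unfolding D_def c_def using t by blast
      have nc: "norm (h t - c) < e / 3" using i by (simp add: c_def dist_norm norm_minus_commute)
      let ?N = "\<lambda>u. integral {0..u} (\<lambda>t. norm (h t - c))"
      obtain d where d: "d > 0" "\<And>y. y \<in> {0..T} \<Longrightarrow> norm (y - t) < d \<Longrightarrow>
          norm (?N y - ?N t - norm (h t - c) * (y - t)) \<le> e / 3 * norm (y - t)"
        using der[rule_format, OF cD] e unfolding has_field_derivative_def has_derivative_within_alt
        by (metis divide_pos_pos zero_less_numeral)
      have key: "norm (?J b - ?J a - (b - a) *\<^sub>R c) \<le> ?N b - ?N a" if ab: "0 \<le> a" "a \<le> b" "b \<le> T" for a b
      proof -
        have sub: "strongly_integrable (lebesgue_on {a..b}) h"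
          by (rule strongly_integrable_subinterval[OF h]) (use ab in auto)
        have "?J b - ?J a - (b - a) *\<^sub>R c = strong_integral (lebesgue_on {a..b}) (\<lambda>t. h t - c)"
          using strong_integral_combine[OF h ab] strong_integral_diff(2)[OF C sub strongly_integrable_const_interval, of c]
            strong_integral_const_interval[OF ab(2), of c] by simp
        also have "\<dots> = strong_integral (lebesgue_on {0..b}) (\<lambda>t. h t - c) - strong_integral (lebesgue_on {0..a}) (\<lambda>t. h t - c)"
          using strong_integral_combine[OF hc ab] by simp
        also have "norm \<dots> \<le> integral {a..b} (\<lambda>x. norm (h x - c))"
          by (rule norm_strong_integral_diff_le[OF hc ab])
        also have "\<dots> = ?N b - ?N a"
          using integral_combine_diff[OF strongly_integrable_norm[OF C hc] ab] by simp
        finally show ?thesis .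
      qed
      show "\<exists>d>0. \<forall>y\<in>{0..T}. norm (y - t) < d \<longrightarrow> norm (?J y - ?J t - (y - t) *\<^sub>R h t) \<le> e * norm (y - t)"
      proof (intro exI[of _ d] conjI ballI impI d(1))
        fix y assume y: "y \<in> {0..T}" "norm (y - t) < d"
        have 1: "norm (?J y - ?J t - (y - t) *\<^sub>R c) \<le> \<bar>?N y - ?N t\<bar>"
        proof (cases "t \<le> y")
          case True
          then show ?thesis using key[of t y] y t by simp
        next
          case False
          have "?J y - ?J t - (y - t) *\<^sub>R c = - (?J t - ?J y - (t - y) *\<^sub>R c)"
            by (simp add: algebra_simps)
          then have "norm (?J y - ?J t - (y - t) *\<^sub>R c) = norm (?J t - ?J y - (t - y) *\<^sub>R c)"
            by (simp only: norm_minus_cancel)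
          then show ?thesis using key[of y t] y t False by simp
        qed
        have "\<bar>?N y - ?N t\<bar> \<le> e / 3 * norm (y - t) + \<bar>norm (h t - c) * (y - t)\<bar>"
          using d(2)[OF y] unfolding real_norm_def by linarith
        also have "\<bar>norm (h t - c) * (y - t)\<bar> \<le> e / 3 * norm (y - t)"
          using mult_right_mono[OF less_imp_le[OF nc], of "norm (y - t)"] by (simp add: abs_mult)
        finally have 2: "\<bar>?N y - ?N t\<bar> \<le> e / 3 * norm (y - t) + e / 3 * norm (y - t)" by simp
        have 3: "norm ((y - t) *\<^sub>R (c - h t)) \<le> e / 3 * norm (y - t)"
          using mult_right_mono[OF less_imp_le[OF nc], of "norm (y - t)"]
          by (simp add: norm_minus_commute[of c] mult.commute)
        have "?J y - ?J t - (y - t) *\<^sub>R h t = (?J y - ?J t - (y - t) *\<^sub>R c) + (y - t) *\<^sub>R (c - h t)"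
          by (simp add: algebra_simps)
        then have "norm (?J y - ?J t - (y - t) *\<^sub>R h t) \<le> norm (?J y - ?J t - (y - t) *\<^sub>R c) + norm ((y - t) *\<^sub>R (c - h t))"
          by (metis norm_triangle_ineq)
        then show "norm (?J y - ?J t - (y - t) *\<^sub>R h t) \<le> e * norm (y - t)"
          using 1 2 3 by simp
      qed
    qed
  qed
qed

section \<open>Absolutely continuous curves in Hilbert spaces\<close>

text \<open>The variance identity for the slopes \<open>a i / p i\<close> with weights
  \<open>p i\<close>: their weighted mean is the slope of the sums. With \<open>a i\<close> and
  \<open>p i\<close> the increments over the cells of a refinement, it measures the energy gained by
  refining.\<close>

lemma sum_norm_slope_diff:
  fixes a :: "'i \<Rightarrow> 'a::real_inner" and p :: "'i \<Rightarrow> real"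
  assumes I: "finite I" "I \<noteq> {}" and p: "\<And>i. i \<in> I \<Longrightarrow> p i > 0"
  shows "(\<Sum>i\<in>I. (norm (a i /\<^sub>R p i - (\<Sum>i\<in>I. a i) /\<^sub>R (\<Sum>i\<in>I. p i)))\<^sup>2 * p i)
    = (\<Sum>i\<in>I. (norm (a i))\<^sup>2 / p i) - (norm (\<Sum>i\<in>I. a i))\<^sup>2 / (\<Sum>i\<in>I. p i)"
proof -
  define A where "A = (\<Sum>i\<in>I. a i)"
  define P where "P = (\<Sum>i\<in>I. p i)"
  have P: "P > 0" unfolding P_def using I p by (intro sum_pos) auto
  have "(norm (a i /\<^sub>R p i - A /\<^sub>R P))\<^sup>2 * p i
      = (norm (a i))\<^sup>2 / p i - 2 * (a i \<bullet> A) / P + (norm A)\<^sup>2 / P\<^sup>2 * p i" if "i \<in> I" for i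
  proof -
    have "(norm (a i /\<^sub>R p i - A /\<^sub>R P))\<^sup>2
        = (norm (a i))\<^sup>2 / (p i)\<^sup>2 - 2 * (a i \<bullet> A) / (p i * P) + (norm A)\<^sup>2 / P\<^sup>2"
    proof -
      have "p i > 0" using p[OF that] .
      then show ?thesis using P unfolding power2_norm_eq_inner
        by (simp add: inner_diff_left inner_diff_right inner_commute[of A "a i"] power2_eq_square field_simps)
    qed
    then show ?thesis using p[OF that] P by (simp add: field_simps power2_eq_square)
  qed
  then have "(\<Sum>i\<in>I. (norm (a i /\<^sub>R p i - A /\<^sub>R P))\<^sup>2 * p i)
      = (\<Sum>i\<in>I. (norm (a i))\<^sup>2 / p i - 2 * (a i \<bullet> A) / P + (norm A)\<^sup>2 / P\<^sup>2 * p i)"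
    by (rule sum.cong[OF refl])
  also have "\<dots> = (\<Sum>i\<in>I. (norm (a i))\<^sup>2 / p i) - 2 * ((\<Sum>i\<in>I. a i) \<bullet> A) / P + (norm A)\<^sup>2 / P\<^sup>2 * (\<Sum>i\<in>I. p i)"
    by (simp add: sum.distrib sum_subtractf sum_distrib_left sum_divide_distrib inner_sum_left)
  also have "\<dots> = (\<Sum>i\<in>I. (norm (a i))\<^sup>2 / p i) - (norm A)\<^sup>2 / P"
    unfolding A_def[symmetric] P_def[symmetric] power2_norm_eq_inner[symmetric] using P
    by (simp add: field_simps power2_eq_square)
  finally show ?thesis by (simp add: A_def P_def)
qed

lemma AE_lebesgue_on_subset:
  assumes "AE x in lebesgue_on B. P x" "A \<subseteq> B" "A \<in> sets lebesgue" "B \<in> sets lebesgue"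
  shows "AE x in lebesgue_on A. P x"
proof -
  have "AE x in lebesgue. x \<in> B \<longrightarrow> P x"
    using assms(1) by (subst (asm) AE_restrict_space_iff) (use assms in auto)
  then have "AE x in lebesgue. x \<in> A \<longrightarrow> P x"
    by eventually_elim (use assms(2) in auto)
  then show ?thesis by (subst AE_restrict_space_iff) (use assms in auto)
qed

lemma Cauchy_if_summable_dist:
  fixes f :: "nat \<Rightarrow> 'a::metric_space"
  assumes f: "\<And>k. dist (f (Suc k)) (f k) \<le> b k" and b: "summable b"
  shows "Cauchy f"
proof (rule metric_CauchyI)
  fix e :: real assume "e > 0"
  then obtain N where N: "\<And>m n. m \<ge> N \<Longrightarrow> norm (sum b {m..<n}) < e"
    using b unfolding summable_Cauchy by blast
  have le: "dist (f (m + d)) (f m) \<le> sum b {m..<m + d}" for m d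
  proof (induction d)
    case (Suc d)
    have "dist (f (Suc (m + d))) (f m) \<le> dist (f (Suc (m + d))) (f (m + d)) + dist (f (m + d)) (f m)"
      by (rule dist_triangle)
    then show ?case using Suc f[of "m + d"] by simp
  qed simp
  have "dist (f n) (f m) < e" if "m \<ge> N" "m \<le> n" for m n
    using le[of m "n - m"] N[OF that(1), of n] that(2) by simp
  then have "dist (f m) (f n) < e" if "m \<ge> N" "n \<ge> N" for m n
    using that by (metis dist_commute nle_le)
  then show "\<exists>N. \<forall>m\<ge>N. \<forall>n\<ge>N. dist (f m) (f n) < e" by blast
qed

section \<open>Dyadic grids and cells\<close>

context
  fixes T :: real
begin

definition grid :: "nat \<Rightarrow> nat \<Rightarrow> real" where "grid n i = real i * T / 2 ^ n"

text \<open>Cells are half-open on the right, so the point \<open>T\<close> has the index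
  \<open>2 ^ n\<close>, one beyond the last proper cell.\<close>

definition cell :: "nat \<Rightarrow> real \<Rightarrow> nat" where "cell n t = nat \<lfloor>t * 2 ^ n / T\<rfloor>"

context
  assumes T: "T > 0"
begin

lemma grid_0 [simp]: "grid n 0 = 0"
  by (simp add: grid_def)

lemma grid_last [simp]: "grid n (2 ^ n) = T"
  by (simp add: grid_def)

lemma grid_mono: "i \<le> j \<Longrightarrow> grid n i \<le> grid n j"
  using T by (simp add: grid_def divide_right_mono mult_right_mono)

lemma grid_strict_mono: "i < j \<Longrightarrow> grid n i < grid n j"
  using T by (simp add: grid_def divide_strict_right_mono)

lemma grid_nonneg: "0 \<le> grid n i"
  using T by (simp add: grid_def)

lemma grid_le: "i \<le> 2 ^ n \<Longrightarrow> grid n i \<le> T"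
  using grid_mono[of i "2 ^ n" n] by simp

lemma grid_refine: "n \<le> m \<Longrightarrow> grid m (i * 2 ^ (m - n)) = grid n i"
proof -
  assume "n \<le> m"
  then have "(2::real) ^ m = 2 ^ n * 2 ^ (m - n)" by (simp flip: power_add)
  then show ?thesis by (simp add: grid_def field_simps)
qed

lemma grid_Suc: "grid n (Suc i) = grid n i + T / 2 ^ n"
  by (simp add: grid_def field_simps)

lemma cell_eq_iff:
  assumes "0 \<le> t"
  shows "cell n t = i \<longleftrightarrow> grid n i \<le> t \<and> t < grid n (Suc i)"
proof -
  have "0 \<le> t * 2 ^ n / T" using assms T by simp
  then have "cell n t = i \<longleftrightarrow> \<lfloor>t * 2 ^ n / T\<rfloor> = int i" by (auto simp: cell_def)
  also have "\<dots> \<longleftrightarrow> real i \<le> t * 2 ^ n / T \<and> t * 2 ^ n / T < real i + 1"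
    by (simp add: floor_eq_iff)
  also have "\<dots> \<longleftrightarrow> grid n i \<le> t \<and> t < grid n (Suc i)"
    using T by (simp add: grid_def field_simps)
  finally show ?thesis .
qed

lemma grid_cell_le: "0 \<le> t \<Longrightarrow> grid n (cell n t) \<le> t"
  using cell_eq_iff by blast

lemma less_grid_Suc_cell: "0 \<le> t \<Longrightarrow> t < grid n (cell n t) + T / 2 ^ n"
  using cell_eq_iff[of t n "cell n t"] by (simp add: grid_Suc)

lemma cell_mono: "s \<le> t \<Longrightarrow> cell n s \<le> cell n t"
  using T unfolding cell_def by (intro nat_mono floor_mono divide_right_mono mult_right_mono) auto

lemma cell_0 [simp]: "cell n 0 = 0"
  by (simp add: cell_def)

lemma cell_T [simp]: "cell n T = 2 ^ n"
  using T by (simp add: cell_def nat_power_eq)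

lemma cell_le: "t \<le> T \<Longrightarrow> cell n t \<le> 2 ^ n"
  using cell_mono[of t T n] by simp

lemma grid_cell_tendsto:
  assumes "0 \<le> t"
  shows "(\<lambda>n. grid n (cell n t)) \<longlonglongrightarrow> t"
proof (rule tendsto_sandwich[where f="\<lambda>n. t - T * (1/2)^n" and h="\<lambda>_. t"])
  have "(\<lambda>n. t - T * (1/2)^n) \<longlonglongrightarrow> t - T * 0"
    by (intro tendsto_intros LIMSEQ_realpow_zero) auto
  then show "(\<lambda>n. t - T * (1/2)^n) \<longlonglongrightarrow> t" by simp
  show "\<forall>\<^sub>F n in sequentially. t - T * (1/2)^n \<le> grid n (cell n t)"
    using less_grid_Suc_cell[OF assms] by (intro always_eventually allI) (simp add: power_divide less_imp_le algebra_simps)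
  show "\<forall>\<^sub>F n in sequentially. grid n (cell n t) \<le> t"
    using grid_cell_le[OF assms] by (intro always_eventually allI)
qed auto

lemma grid_cell_mem: "t \<in> {0..T} \<Longrightarrow> grid n (cell n t) \<in> {0..t}"
  using grid_cell_le grid_nonneg by simp

lemma simple_function_cell:
  shows "simple_function (lebesgue_on {0..T}) (\<lambda>t. c (cell n t))"
proof -
  have "simple_function (lebesgue_on {0..T}) (cell n)"
    unfolding simple_function_def
  proof (intro conjI ballI)
    have "cell n ` {0..T} \<subseteq> {..2 ^ n}" using cell_le by auto
    then show "finite (cell n ` space (lebesgue_on {0..T}))"
      using finite_subset by auto
    fix i
    have "cell n -` {i} \<inter> {0..T} = {grid n i..<grid n (Suc i)} \<inter> {0..T}"
    proof (intro set_eqI)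
      show "t \<in> cell n -` {i} \<inter> {0..T} \<longleftrightarrow> t \<in> {grid n i..<grid n (Suc i)} \<inter> {0..T}" for t
        using cell_eq_iff[of t n i] by (cases "0 \<le> t") auto
    qed
    also have "\<dots> \<in> sets lebesgue" by simp
    finally show "cell n -` {i} \<inter> space (lebesgue_on {0..T}) \<in> sets (lebesgue_on {0..T})"
      by (subst sets_restrict_space_iff) auto
  qed
  then have "simple_function (lebesgue_on {0..T}) (c \<circ> cell n)" by (rule simple_function_compose)
  then show ?thesis by (simp add: comp_def)
qed

lemma integrable_cell_mult:
  fixes c :: "nat \<Rightarrow> real"
  assumes \<psi>: "integrable (lebesgue_on {0..T}) \<psi>"
  shows "integrable (lebesgue_on {0..T}) (\<lambda>t. c (cell n t) * \<psi> t)"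
proof (rule Bochner_Integration.integrable_bound)
  define B where "B = Max ((\<lambda>i. \<bar>c i\<bar>) ` {..2 ^ n})"
  show "integrable (lebesgue_on {0..T}) (\<lambda>t. B * \<psi> t)" using \<psi> by simp
  have B: "\<bar>c i\<bar> \<le> B" if "i \<le> 2 ^ n" for i
    unfolding B_def using that by (intro Max_ge) auto
  have "norm (c (cell n t) * \<psi> t) \<le> norm (B * \<psi> t)" if "t \<in> {0..T}" for t
    using B[OF cell_le[of t n]] that by (simp add: abs_mult mult_right_mono order_trans[OF _ abs_ge_self])
  then show "AE t in lebesgue_on {0..T}. norm (c (cell n t) * \<psi> t) \<le> norm (B * \<psi> t)"
    by (intro AE_I2) simp
  show "(\<lambda>t. c (cell n t) * \<psi> t) \<in> borel_measurable (lebesgue_on {0..T})"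
    using \<psi> borel_measurable_simple_function[OF simple_function_cell[of c n]] by auto
qed

lemma integral_cell_mult:
  fixes c :: "nat \<Rightarrow> real"
  assumes \<psi>: "integrable (lebesgue_on {0..T}) \<psi>" and "i \<le> 2 ^ n"
  shows "integral {0..grid n i} (\<lambda>t. c (cell n t) * \<psi> t)
    = (\<Sum>j<i. c j * integral {grid n j..grid n (Suc j)} \<psi>)"
  using assms(2)
proof (induction i)
  case (Suc i)
  have "integral {0..grid n (Suc i)} (\<lambda>t. c (cell n t) * \<psi> t)
    = integral {0..grid n i} (\<lambda>t. c (cell n t) * \<psi> t) + integral {grid n i..grid n (Suc i)} (\<lambda>t. c (cell n t) * \<psi> t)"
    using integral_combine_diff[OF integrable_cell_mult[OF \<psi>], of "grid n i" "grid n (Suc i)"]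
      grid_nonneg grid_mono[of i "Suc i"] grid_le[OF Suc.prems] by (simp add: algebra_simps)
  also have "integral {grid n i..grid n (Suc i)} (\<lambda>t. c (cell n t) * \<psi> t) = integral {grid n i..grid n (Suc i)} (\<lambda>t. c i * \<psi> t)"
  \<comment> \<open>The right end point of a cell already belongs to the next one.\<close>
  proof (rule integral_spike[of "{grid n (Suc i)}"])
    show "c i * \<psi> t = c (cell n t) * \<psi> t" if "t \<in> {grid n i..grid n (Suc i)} - {grid n (Suc i)}" for t
    proof -
      have "0 \<le> t" using that grid_nonneg[of n i] by (simp add: order_trans[of 0 "grid n i"])
      then have "cell n t = i" using that by (subst cell_eq_iff) auto
      then show ?thesis by simp
    qed
  qed simp
  finally show ?case using Suc by simp
qed simp

end

end

text \<open>The derivative is the limit of a dyadic martingale of difference quotients with respect to the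
  measure \<open>\<psi> dt\<close>; orthogonality of its increments makes it a Cauchy sequence in \<open>L\<^sup>2\<close>.\<close>

lemma strong_integral_representation_aux:
  fixes x :: "real \<Rightarrow> 'a::{real_inner,complete_space}"
  assumes T: "T > 0" and \<psi>: "integrable (lebesgue_on {0..T}) \<psi>"
    and \<psi>1: "\<And>t. t \<in> {0..T} \<Longrightarrow> \<psi> t \<ge> 1"
    and x: "\<And>s t. 0 \<le> s \<Longrightarrow> s \<le> t \<Longrightarrow> t \<le> T \<Longrightarrow> norm (x t - x s) \<le> integral {s..t} \<psi>"
  shows "\<exists>h. strongly_integrable (lebesgue_on {0..T}) h \<and>
    (\<forall>t\<in>{0..T}. x t = x 0 + strong_integral (lebesgue_on {0..t}) h)"
proof -
  let ?M = "lebesgue_on {0..T}"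
  let ?g = "grid T" and ?k = "cell T"
  note C = complete_measure_interval
  define dV where "dV n i = integral {?g n i..?g n (Suc i)} \<psi>" for n i
  define dx where "dx n i = x (?g n (Suc i)) - x (?g n i)" for n i
  \<comment> \<open>The slope with respect to \<open>\<psi> dt\<close>. The index
    \<open>2 ^ n\<close> occurs only at \<open>t = T\<close>, where the next grid point would lie
    outside the interval.\<close>
  define q where "q n i = (if i < 2 ^ n then dx n i /\<^sub>R dV n i else 0)" for n i
  define h where "h n t = q n (?k n t)" for n t
  have int: "\<psi> integrable_on {a..b}" if "0 \<le> a" "b \<le> T" for a b
  proof -
    have "\<psi> integrable_on {0..T}" using \<psi> by (intro integrable_on_lebesgue_on) auto
    then show ?thesis by (rule integrable_subinterval_real) (use that in auto)
  qed
  have dVpos: "dV n i > 0" if "i < 2 ^ n" for n i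
  proof -
    have le: "0 \<le> ?g n i" "?g n i < ?g n (Suc i)" "?g n (Suc i) \<le> T"
      using that grid_nonneg[OF T] grid_strict_mono[OF T] grid_le[OF T] by auto
    have "?g n (Suc i) - ?g n i = integral {?g n i..?g n (Suc i)} (\<lambda>_. 1)" using le by simp
    also have "\<dots> \<le> dV n i"
      unfolding dV_def by (rule integral_le) (use int \<psi>1 le in auto)
    finally show ?thesis using le by linarith
  qed
  have dxV: "norm (dx n i) \<le> dV n i" if "i < 2 ^ n" for n i
    unfolding dx_def dV_def
    using that grid_nonneg[OF T] less_imp_le[OF grid_strict_mono[OF T]] grid_le[OF T] by (intro x) auto
  have q1: "norm (q n i) \<le> 1" for n i
    using dxV[of i n] dVpos[of i n] by (auto simp: q_def field_simps)
  \<comment> \<open>\<open>E n\<close> is the squared norm of \<open>h n\<close> in the space of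
    square integrable functions for \<open>\<psi> dt\<close>.\<close>
  define E where "E n = (\<Sum>i<2 ^ n. (norm (dx n i))\<^sup>2 / dV n i)" for n
  \<comment> \<open>Pythagoras' theorem for the martingale: on each coarse cell the coarse slope is
    the mean of the fine slopes, and \<open>sum_norm_slope_diff\<close> applies cell by cell. Hence
    \<open>E\<close> increases, and its boundedness makes the distances small.\<close>
  have L2: "integral {0..T} (\<lambda>t. (norm (h m t - h n t))\<^sup>2 * \<psi> t) = E m - E n" if nm: "n \<le> m" for n m
  proof -
    define d where "d = m - n"
    have m: "(2::nat) ^ m = 2 ^ n * 2 ^ d" using nm by (simp add: d_def flip: power_add)
    have hn: "h n t = q n (?k m t div 2 ^ d)" if t: "t \<in> {0..T}" for t
    proof -
      have "?k n t = ?k m t div 2 ^ d"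
      proof (subst cell_eq_iff[OF T], use t in simp, intro conjI)
        define j where "j = ?k m t"
        have j: "?g m j \<le> t" "t < ?g m (Suc j)" using cell_eq_iff[OF T, of t m j] t by (auto simp: j_def)
        have "?g n (j div 2 ^ d) = ?g m (j div 2 ^ d * 2 ^ d)" using grid_refine[OF T nm] by (simp add: d_def)
        also have "\<dots> \<le> ?g m j" by (rule grid_mono[OF T]) simp
        finally show "?g n (?k m t div 2 ^ d) \<le> t" using j by (simp add: j_def)
        have "Suc j \<le> Suc (j div 2 ^ d) * 2 ^ d"
        proof -
          have "j mod 2 ^ d < 2 ^ d" by simp
          then have "Suc (j div 2 ^ d * 2 ^ d + j mod 2 ^ d) \<le> 2 ^ d + j div 2 ^ d * 2 ^ d" by linarith
          then show ?thesis by (simp only: div_mult_mod_eq mult_Suc)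
        qed
        then have "?g m (Suc j) \<le> ?g m (Suc (j div 2 ^ d) * 2 ^ d)" by (rule grid_mono[OF T])
        also have "\<dots> = ?g n (Suc (j div 2 ^ d))"
          using grid_refine[OF T nm, of "Suc (j div 2 ^ d)"] by (simp only: d_def)
        finally show "t < ?g n (Suc (?k m t div 2 ^ d))" using j by (simp add: j_def)
      qed
      then show ?thesis by (simp add: h_def)
    qed
    define c where "c j = (norm (q m j - q n (j div 2 ^ d)))\<^sup>2" for j
    have "integral {0..T} (\<lambda>t. (norm (h m t - h n t))\<^sup>2 * \<psi> t) = integral {0..T} (\<lambda>t. c (?k m t) * \<psi> t)"
      by (rule integral_cong) (simp add: hn c_def, simp add: h_def)
    also have "\<dots> = (\<Sum>j<2 ^ m. c j * dV m j)"
      using integral_cell_mult[OF T \<psi>, of "2 ^ m" m c] by (simp add: grid_last[OF T] dV_def)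
    also have "\<dots> = (\<Sum>i<2 ^ n. \<Sum>j\<in>{i * 2 ^ d..<i * 2 ^ d + 2 ^ d}. c j * dV m j)"
      unfolding m by (rule sum.nat_group[symmetric])
    also have "\<dots> = (\<Sum>i<2 ^ n. (\<Sum>j\<in>{i * 2 ^ d..<i * 2 ^ d + 2 ^ d}. (norm (dx m j))\<^sup>2 / dV m j) - (norm (dx n i))\<^sup>2 / dV n i)"
    proof (rule sum.cong[OF refl])
      fix i :: nat assume i: "i \<in> {..<2 ^ n}"
      let ?I = "{i * 2 ^ d..<i * 2 ^ d + 2 ^ d}"
      have lt: "j < 2 ^ m" if "j \<in> ?I" for j
      proof -
        have "j < Suc i * 2 ^ d" using that by simp
        also have "\<dots> \<le> 2 ^ n * 2 ^ d" using i by (intro mult_right_mono) auto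
        finally show ?thesis using m by simp
      qed
      have div: "j div 2 ^ d = i" if "j \<in> ?I" for j
        using that by (intro div_nat_eqI) (auto simp: mult.commute)
      have e1: "?g m (i * 2 ^ d) = ?g n i" "?g m (i * 2 ^ d + 2 ^ d) = ?g n (Suc i)"
        using grid_refine[OF T nm, of i] grid_refine[OF T nm, of "Suc i"] by (auto simp: d_def algebra_simps)
      have sx: "(\<Sum>j\<in>?I. dx m j) = dx n i"
        unfolding dx_def using sum_Suc_diff'[of "i * 2 ^ d" "i * 2 ^ d + 2 ^ d" "\<lambda>j. x (?g m j)"] e1 by simp
      have dV: "dV k j = integral {0..?g k (Suc j)} \<psi> - integral {0..?g k j} \<psi>" if "j < 2 ^ k" for j k
        unfolding dV_def using that grid_nonneg[OF T] less_imp_le[OF grid_strict_mono[OF T]] grid_le[OF T]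
        by (intro integral_combine_diff[OF \<psi>, symmetric]) auto
      have sV: "(\<Sum>j\<in>?I. dV m j) = dV n i"
      proof -
        have "(\<Sum>j\<in>?I. dV m j) = (\<Sum>j\<in>?I. integral {0..?g m (Suc j)} \<psi> - integral {0..?g m j} \<psi>)"
          by (rule sum.cong[OF refl]) (use dV lt in auto)
        also have "\<dots> = dV n i"
          using sum_Suc_diff'[of "i * 2 ^ d" "i * 2 ^ d + 2 ^ d" "\<lambda>j. integral {0..?g m j} \<psi>"] e1 dV[of i n] i by simp
        finally show ?thesis .
      qed
      have "(\<Sum>j\<in>?I. c j * dV m j) = (\<Sum>j\<in>?I. (norm (dx m j /\<^sub>R dV m j - (\<Sum>j\<in>?I. dx m j) /\<^sub>R (\<Sum>j\<in>?I. dV m j)))\<^sup>2 * dV m j)"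
        by (rule sum.cong[OF refl]) (use lt div i in \<open>simp add: c_def q_def sx sV\<close>)
      also have "\<dots> = (\<Sum>j\<in>?I. (norm (dx m j))\<^sup>2 / dV m j) - (norm (\<Sum>j\<in>?I. dx m j))\<^sup>2 / (\<Sum>j\<in>?I. dV m j)"
        by (rule sum_norm_slope_diff) (use lt dVpos in auto)
      finally show "(\<Sum>j\<in>?I. c j * dV m j) = (\<Sum>j\<in>?I. (norm (dx m j))\<^sup>2 / dV m j) - (norm (dx n i))\<^sup>2 / dV n i"
        by (simp add: sx sV)
    qed
    also have "\<dots> = E m - E n"
      unfolding sum_subtractf E_def m by (subst sum.nat_group) simp
    finally show ?thesis .
  qed
  have hs: "simple_function ?M (h n)" for n
    unfolding h_def by (rule simple_function_cell[OF T])
  have L2i: "integrable ?M (\<lambda>t. (norm (h m t - h n t))\<^sup>2 * \<psi> t)" for m n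
  proof (rule Bochner_Integration.integrable_bound[of _ "\<lambda>t. 4 * \<psi> t"])
    have "simple_function ?M (\<lambda>t. (norm (h m t - h n t))\<^sup>2)"
      by (rule simple_function_compose2[OF hs hs])
    then show "(\<lambda>t. (norm (h m t - h n t))\<^sup>2 * \<psi> t) \<in> borel_measurable ?M"
      by (intro borel_measurable_times borel_measurable_simple_function borel_measurable_integrable[OF \<psi>])
    have "(norm (h m t - h n t))\<^sup>2 \<le> 4" for t
    proof -
      have "norm (h m t - h n t) \<le> 2" using norm_triangle_ineq4[of "h m t" "h n t"] q1[of m "?k m t"] q1[of n "?k n t"] by (simp add: h_def)
      then have "(norm (h m t - h n t))\<^sup>2 \<le> 2\<^sup>2" by (intro power_mono) auto
      then show ?thesis by simp
    qed
    then show "AE t in ?M. norm ((norm (h m t - h n t))\<^sup>2 * \<psi> t) \<le> norm (4 * \<psi> t)"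
      by (intro AE_I2) (simp add: abs_mult mult_right_mono)
  qed (use \<psi> in auto)
  have Emono: "E n \<le> E m" if "n \<le> m" for n m
  proof -
    have "0 \<le> integral {0..T} (\<lambda>t. (norm (h m t - h n t))\<^sup>2 * \<psi> t)"
      by (rule Henstock_Kurzweil_Integration.integral_nonneg)
        (use integrable_on_lebesgue_on[OF L2i] \<psi>1 in \<open>auto intro!: mult_nonneg_nonneg intro: order_trans[of 0 1]\<close>)
    then show ?thesis using L2[OF that] by simp
  qed
  have Ebd: "E n \<le> integral {0..T} \<psi>" for n
  proof -
    have "E n \<le> (\<Sum>i<2 ^ n. dV n i)"
      unfolding E_def
    proof (rule sum_mono)
      fix i :: nat assume "i \<in> {..<2 ^ n}"
      then have "norm (dx n i) \<le> dV n i" "dV n i > 0" using dxV dVpos by auto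
      then have "(norm (dx n i))\<^sup>2 \<le> (dV n i)\<^sup>2" by (intro power_mono) auto
      then show "(norm (dx n i))\<^sup>2 / dV n i \<le> dV n i" using \<open>dV n i > 0\<close> by (simp add: field_simps power2_eq_square)
    qed
    also have "\<dots> = integral {0..T} \<psi>"
      using integral_cell_mult[OF T \<psi>, of "2 ^ n" n "\<lambda>_. 1"] by (simp add: grid_last[OF T] dV_def)
    finally show ?thesis .
  qed
  have "incseq E" using Emono by (simp add: incseq_def)
  then obtain E' where E': "E \<longlonglongrightarrow> E'" "\<And>n. E n \<le> E'"
    using incseq_convergent[of E "integral {0..T} \<psi>"] Ebd by blast
  have "\<exists>n. E' - E n < (1/8)^k" for k :: nat
  proof -
    have "\<forall>\<^sub>F n in sequentially. E' - (1/8)^k < E n"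
      by (rule order_tendstoD(1)[OF E'(1)]) simp
    then show ?thesis by (auto simp: eventually_sequentially algebra_simps)
  qed
  then obtain r0 where r0: "\<And>k::nat. E' - E (r0 k) < (1/8)^k" by metis
  \<comment> \<open>The partial sum makes \<open>r\<close> monotone and at least \<open>r0\<close>;
    the summand \<open>k\<close> makes it unbounded.\<close>
  define r where "r k = k + (\<Sum>i\<le>k. r0 i)" for k
  have rSuc: "r k \<le> r (Suc k)" and rge: "k \<le> r k" for k by (simp_all add: r_def)
  have "r0 k \<le> r k" for k
    unfolding r_def using member_le_sum[of k "{..k}" r0] by (simp add: trans_le_add2)
  then have rE: "E' - E (r k) < (1/8)^k" for k
    using r0[of k] Emono[of "r0 k" "r k"] by (smt (verit))
  define D where "D k t = norm (h (r (Suc k)) t - h (r k) t)" for k t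
  have Dint: "(\<integral>t. (D k t)\<^sup>2 * \<psi> t \<partial>?M) \<le> (1/8)^k" for k
  proof -
    have "(\<integral>t. (D k t)\<^sup>2 * \<psi> t \<partial>?M) = E (r (Suc k)) - E (r k)"
      unfolding D_def using L2[OF rSuc] lebesgue_on_interval_integral[OF L2i] by simp
    then show ?thesis using rE[of k] E'(2)[of "r (Suc k)"] by linarith
  qed
  have Dmeas: "integrable ?M (\<lambda>t. 2 ^ k * ((D k t)\<^sup>2 * \<psi> t))" for k
    unfolding D_def using L2i by (intro integrable_mult_right)
  have Dnn: "0 \<le> 2 ^ k * ((D k t)\<^sup>2 * \<psi> t)" if "t \<in> {0..T}" for k t
    using \<psi>1[OF that] by simp
  \<comment> \<open>Summable squares would not give summable distances. The weight
    \<open>2 ^ k\<close> does, by the inequality \<open>2 * D \<le> (1/2)^k + 2 ^ k * D^2\<close>,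
    and against the rate \<open>(1/8)^k\<close> it still leaves the summable
    \<open>(1/4)^k\<close>.\<close>
  have "AE t in ?M. summable (\<lambda>k. 2 ^ k * ((D k t)\<^sup>2 * \<psi> t))"
  proof -
    have "(\<integral>\<^sup>+t. (\<Sum>k. ennreal (2 ^ k * ((D k t)\<^sup>2 * \<psi> t))) \<partial>?M)
      = (\<Sum>k. \<integral>\<^sup>+t. ennreal (2 ^ k * ((D k t)\<^sup>2 * \<psi> t)) \<partial>?M)"
      using Dmeas by (intro nn_integral_suminf) auto
    also have "\<dots> \<le> (\<Sum>k. ennreal ((1/4)^k))"
    proof (rule suminf_le)
      fix k
      have "(\<integral>\<^sup>+t. ennreal (2 ^ k * ((D k t)\<^sup>2 * \<psi> t)) \<partial>?M) = ennreal (\<integral>t. 2 ^ k * ((D k t)\<^sup>2 * \<psi> t) \<partial>?M)"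
        by (rule nn_integral_eq_integral[OF Dmeas]) (use Dnn in auto)
      also have "\<dots> \<le> ennreal (2 ^ k * (1/8)^k)"
        using Dint[of k] by (intro ennreal_leI) simp
      also have "(2::real) ^ k * (1/8)^k = (1/4)^k" by (simp flip: power_mult_distrib)
      finally show "(\<integral>\<^sup>+t. ennreal (2 ^ k * ((D k t)\<^sup>2 * \<psi> t)) \<partial>?M) \<le> ennreal ((1/4)^k)" .
    qed auto
    also have "\<dots> = ennreal (\<Sum>k. (1/4)^k)"
      by (rule suminf_ennreal2) (auto intro: summable_geometric)
    finally have "(\<integral>\<^sup>+t. (\<Sum>k. ennreal (2 ^ k * ((D k t)\<^sup>2 * \<psi> t))) \<partial>?M) \<noteq> \<infinity>"
      by (auto simp: top_unique)
    then have "AE t in ?M. (\<Sum>k. ennreal (2 ^ k * ((D k t)\<^sup>2 * \<psi> t))) \<noteq> \<infinity>"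
      using Dmeas by (intro nn_integral_PInf_AE) auto
    then show ?thesis
      using AE_space
    proof eventually_elim
      fix t assume "(\<Sum>k. ennreal (2 ^ k * ((D k t)\<^sup>2 * \<psi> t))) \<noteq> \<infinity>" "t \<in> space ?M"
      then show "summable (\<lambda>k. 2 ^ k * ((D k t)\<^sup>2 * \<psi> t))"
        using Dnn by (intro summable_suminf_not_top) auto
    qed
  qed
  define H where "H t = lim (\<lambda>k. h (r k) t)" for t
  have conv: "AE t in ?M. (\<lambda>k. h (r k) t) \<longlonglongrightarrow> H t"
    using \<open>AE t in ?M. summable (\<lambda>k. 2 ^ k * ((D k t)\<^sup>2 * \<psi> t))\<close> AE_space
  proof eventually_elim
    fix t assume sm: "summable (\<lambda>k. 2 ^ k * ((D k t)\<^sup>2 * \<psi> t))" and t: "t \<in> space ?M"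
    have "Cauchy (\<lambda>k. h (r k) t)"
    proof (rule Cauchy_if_summable_dist)
      show "summable (\<lambda>k. (1/2)^k + 2 ^ k * ((D k t)\<^sup>2 * \<psi> t))"
        by (intro summable_add sm summable_geometric) simp
      fix k
      have e: "(1/2)^k * 2 ^ k = (1::real)" by (simp flip: power_mult_distrib)
      have "2 * D k t \<le> (1/2)^k + 2 ^ k * (D k t)\<^sup>2"
      proof -
        have "0 \<le> 2 ^ k * (D k t - (1/2)^k)\<^sup>2" by simp
        also have "\<dots> = 2 ^ k * (D k t)\<^sup>2 - 2 * ((1/2)^k * 2 ^ k) * D k t + ((1/2)^k * 2 ^ k) * (1/2)^k"
          by (simp add: power2_eq_square algebra_simps)
        finally show ?thesis using e by simp
      qed
      also have "2 ^ k * (D k t)\<^sup>2 \<le> 2 ^ k * ((D k t)\<^sup>2 * \<psi> t)"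
        using \<psi>1[of t] t mult_left_mono[of 1 "\<psi> t" "(D k t)\<^sup>2"] by (intro mult_left_mono) auto
      finally have "2 * D k t \<le> (1/2)^k + 2 ^ k * ((D k t)\<^sup>2 * \<psi> t)" by simp
      moreover have "0 \<le> D k t" by (simp add: D_def)
      ultimately have "D k t \<le> (1/2)^k + 2 ^ k * ((D k t)\<^sup>2 * \<psi> t)" by linarith
      then show "dist (h (r (Suc k)) t) (h (r k) t) \<le> (1/2)^k + 2 ^ k * ((D k t)\<^sup>2 * \<psi> t)"
        by (simp add: D_def dist_norm)
    qed
    then show "(\<lambda>k. h (r k) t) \<longlonglongrightarrow> H t"
      unfolding H_def by (intro convergent_LIMSEQ_iff[THEN iffD1] Cauchy_convergent)
  qed
  have h1: "norm (h n t) \<le> 1" for n t by (simp add: h_def q1)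
  have smH: "strongly_measurable ?M H"
    unfolding strongly_measurable_def using hs conv by (intro exI[of _ "\<lambda>k. h (r k)"]) auto
  \<comment> \<open>\<open>H\<close> is the density with respect to \<open>\<psi> dt\<close>;
    multiplication by \<open>\<psi>\<close> gives the density with respect to Lebesgue
    measure.\<close>
  define g where "g t = \<psi> t *\<^sub>R H t" for t
  have smg: "strongly_measurable ?M g"
    unfolding g_def using \<psi>
    by (intro strongly_measurable_scaleR[OF _ smH] borel_measurable_imp_strongly_measurable) auto
  have g\<psi>: "AE t in ?M. norm (g t) \<le> \<psi> t"
    using conv AE_space
  proof eventually_elim
    fix t assume l: "(\<lambda>k. h (r k) t) \<longlonglongrightarrow> H t" and t: "t \<in> space ?M"
    have "norm (H t) \<le> 1"
      by (rule LIMSEQ_le_const2[OF tendsto_norm[OF l]]) (use h1 in auto)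
    then show "norm (g t) \<le> \<psi> t"
      using \<psi>1[of t] t mult_left_mono[of "norm (H t)" 1 "\<psi> t"] by (simp add: g_def)
  qed
  have g: "strongly_integrable ?M g"
    by (rule strongly_integrable_bound[OF C smg \<psi> g\<psi>])
  let ?J = "\<lambda>t. strong_integral (lebesgue_on {0..t}) g"
  have dyadic: "?J (?g n i) = x (?g n i) - x 0" if i: "i \<le> 2 ^ n" for n i
  proof -
    define t where "t = ?g n i"
    have t: "0 \<le> t" "t \<le> T" using grid_nonneg[OF T] grid_le[OF T i] by (auto simp: t_def)
    have sub: "strongly_integrable (lebesgue_on {0..t}) g"
      by (rule strongly_integrable_subinterval[OF g]) (use t in auto)
    have "?J t = x t - x 0"
    proof (rule strong_integral_eqI[OF C sub])
      fix y
      have i\<psi>: "integrable (lebesgue_on {0..t}) \<psi>"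
        by (rule integrable_lebesgue_on_subinterval[OF \<psi>]) (use t in auto)
      have hint: "integrable (lebesgue_on {0..T}) (\<lambda>s. (h m s \<bullet> y) * \<psi> s)" for m
        unfolding h_def by (rule integrable_cell_mult[OF T \<psi>, of "\<lambda>i. q m i \<bullet> y"])
      have hint': "integrable (lebesgue_on {0..t}) (\<lambda>s. (h m s \<bullet> y) * \<psi> s)" for m
        by (rule integrable_lebesgue_on_subinterval[OF hint]) (use t in auto)
      have "(\<lambda>k. LINT s|lebesgue_on {0..t}. (h (r k) s \<bullet> y) * \<psi> s) \<longlonglongrightarrow> (LINT s|lebesgue_on {0..t}. g s \<bullet> y)"
      proof (rule integral_dominated_convergence[where w="\<lambda>s. norm y * \<psi> s"])
        have "AE s in lebesgue_on {0..t}. (\<lambda>k. h (r k) s) \<longlonglongrightarrow> H s"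
          by (rule AE_lebesgue_on_subset[OF conv]) (use t in auto)
        then show "AE s in lebesgue_on {0..t}. (\<lambda>k. (h (r k) s \<bullet> y) * \<psi> s) \<longlonglongrightarrow> g s \<bullet> y"
        proof eventually_elim
          fix s assume "(\<lambda>k. h (r k) s) \<longlonglongrightarrow> H s"
          then have "(\<lambda>k. (h (r k) s \<bullet> y) * \<psi> s) \<longlonglongrightarrow> (H s \<bullet> y) * \<psi> s" by (intro tendsto_intros)
          then show "(\<lambda>k. (h (r k) s \<bullet> y) * \<psi> s) \<longlonglongrightarrow> g s \<bullet> y" by (simp add: g_def mult.commute)
        qed
        have "norm ((h m s \<bullet> y) * \<psi> s) \<le> norm y * \<psi> s" if "s \<in> {0..t}" for m s
        proof -
          have "\<bar>h m s \<bullet> y\<bar> \<le> 1 * norm y"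
            using Cauchy_Schwarz_ineq2[of "h m s" y] mult_right_mono[OF h1[of m s], of "norm y"] by simp
          then show ?thesis using \<psi>1[of s] that t by (simp add: abs_mult mult_right_mono)
        qed
        then show "AE s in lebesgue_on {0..t}. norm ((h (r k) s \<bullet> y) * \<psi> s) \<le> norm y * \<psi> s" for k
          by (intro AE_I2) simp
        show "(\<lambda>s. g s \<bullet> y) \<in> borel_measurable (lebesgue_on {0..t})"
          using strong_integral_inner(1)[OF C sub] by blast
        show "(\<lambda>s. (h (r k) s \<bullet> y) * \<psi> s) \<in> borel_measurable (lebesgue_on {0..t})" for k
          using hint' by blast
      qed (use i\<psi> in simp)
      \<comment> \<open>On every grid that contains \<open>t\<close> the sum of slopes times weights
        telescopes, so the sequence is eventually constant and its limit is known.\<close>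
      moreover have "(LINT s|lebesgue_on {0..t}. (h (r k) s \<bullet> y) * \<psi> s) = (x t - x 0) \<bullet> y" if "n \<le> k" for k
      proof -
        define m where "m = r k"
        have nm: "n \<le> m" using that rge[of k] by (simp add: m_def)
        define i' where "i' = i * 2 ^ (m - n)"
        have ti': "t = ?g m i'" using grid_refine[OF T nm] by (simp add: t_def i'_def)
        have i': "i' \<le> 2 ^ m"
        proof -
          have "i' \<le> 2 ^ n * 2 ^ (m - n)" unfolding i'_def using i by (intro mult_right_mono) auto
          then show ?thesis using nm by (simp flip: power_add)
        qed
        have "(LINT s|lebesgue_on {0..t}. (h m s \<bullet> y) * \<psi> s) = integral {0..?g m i'} (\<lambda>s. (h m s \<bullet> y) * \<psi> s)"
          using lebesgue_on_interval_integral[OF hint'] by (simp add: ti')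
        also have "\<dots> = (\<Sum>j<i'. (q m j \<bullet> y) * dV m j)"
          unfolding h_def dV_def by (rule integral_cell_mult[OF T \<psi> i', of "\<lambda>j. q m j \<bullet> y"])
        also have "\<dots> = (\<Sum>j<i'. (x (?g m (Suc j)) - x (?g m j)) \<bullet> y)"
        proof (rule sum.cong[OF refl])
          fix j assume "j \<in> {..<i'}"
          then have "j < 2 ^ m" using i' by simp
          then show "(q m j \<bullet> y) * dV m j = (x (?g m (Suc j)) - x (?g m j)) \<bullet> y"
            using dVpos[of j m] by (simp add: q_def dx_def)
        qed
        also have "\<dots> = (x t - x 0) \<bullet> y"
          using sum_lessThan_telescope[of "\<lambda>j. x (?g m j)" i']
          by (simp add: ti' grid_0[OF T] flip: inner_sum_left)
        finally show ?thesis by (simp add: m_def)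
      qed
      then have "\<forall>\<^sub>F k in sequentially. (LINT s|lebesgue_on {0..t}. (h (r k) s \<bullet> y) * \<psi> s) = (x t - x 0) \<bullet> y"
        unfolding eventually_sequentially by blast
      then have "(\<lambda>k. LINT s|lebesgue_on {0..t}. (h (r k) s \<bullet> y) * \<psi> s) \<longlonglongrightarrow> (x t - x 0) \<bullet> y"
        by (rule tendsto_eventually)
      ultimately show "(LINT s|lebesgue_on {0..t}. g s \<bullet> y) = (x t - x 0) \<bullet> y"
        by (rule LIMSEQ_unique)
    qed
    then show ?thesis by (simp add: t_def)
  qed
  \<comment> \<open>Both sides are continuous in \<open>t\<close>, and the dyadic grid points below
    \<open>t\<close> approach it.\<close>
  have "x t = x 0 + ?J t" if t: "t \<in> {0..T}" for t
  proof -
    define tn where "tn n = ?g n (?k n t)" for n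
    have tn: "tn n \<in> {0..t}" "tn \<longlonglongrightarrow> t" for n
      using grid_cell_mem[OF T t] grid_cell_tendsto[OF T, of t] t by (auto simp: tn_def[abs_def])
    have small: "(\<lambda>n. integral {tn n..t} \<phi>) \<longlonglongrightarrow> 0" if \<phi>: "integrable ?M \<phi>" for \<phi> :: "real \<Rightarrow> real"
    proof -
      have "continuous_on {0..T} (\<lambda>s. integral {0..s} \<phi>)"
        using \<phi> by (intro indefinite_integral_continuous_1 integrable_on_lebesgue_on) auto
      then have "(\<lambda>n. integral {0..tn n} \<phi>) \<longlonglongrightarrow> integral {0..t} \<phi>"
      proof (rule continuous_on_tendsto_compose[OF _ tn(2) t])
        show "\<forall>\<^sub>F n in sequentially. tn n \<in> {0..T}"
          using tn(1) t by (intro always_eventually allI) (meson atLeastAtMost_iff order_trans)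
      qed
      then have "(\<lambda>n. integral {0..t} \<phi> - integral {0..tn n} \<phi>) \<longlonglongrightarrow> integral {0..t} \<phi> - integral {0..t} \<phi>"
        by (intro tendsto_intros)
      moreover have "integral {0..t} \<phi> - integral {0..tn n} \<phi> = integral {tn n..t} \<phi>" for n
        using tn(1)[of n] t by (intro integral_combine_diff[OF \<phi>]) auto
      ultimately show ?thesis by simp
    qed
    have "(\<lambda>n. x t - x (tn n)) \<longlonglongrightarrow> 0"
    proof (rule Lim_null_comparison[OF _ small[OF \<psi>]])
      show "\<forall>\<^sub>F n in sequentially. norm (x t - x (tn n)) \<le> integral {tn n..t} \<psi>"
        using tn(1) t by (intro always_eventually allI x) auto
    qed
    moreover have "(\<lambda>n. ?J t - ?J (tn n)) \<longlonglongrightarrow> 0"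
    proof (rule Lim_null_comparison[OF _ small[OF strongly_integrable_norm[OF C g]]])
      show "\<forall>\<^sub>F n in sequentially. norm (?J t - ?J (tn n)) \<le> integral {tn n..t} (\<lambda>s. norm (g s))"
        using tn(1) t by (intro always_eventually allI norm_strong_integral_diff_le[OF g]) auto
    qed
    ultimately have "(\<lambda>n. (x t - x (tn n)) - (?J t - ?J (tn n))) \<longlonglongrightarrow> 0 - 0"
      by (intro tendsto_diff)
    moreover have "(x t - x (tn n)) - (?J t - ?J (tn n)) = x t - x 0 - ?J t" for n
      using dyadic[of "?k n t" n] cell_le[OF T, of t n] t by (simp add: tn_def)
    ultimately have "x t - x 0 - ?J t = 0" by (simp add: LIMSEQ_const_iff)
    then show ?thesis by (simp add: algebra_simps)
  qed
  then show ?thesis using g by blast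
qed

text \<open>The Radon-Nikodym property in the form used here. Passing to the larger density
  \<open>\<bar>\<phi> t\<bar> + 1\<close> gives every dyadic cell a positive weight.\<close>

theorem strong_integral_representation:
  fixes x :: "real \<Rightarrow> 'a::{real_inner,complete_space}"
  assumes T: "T > 0" and \<phi>: "integrable (lebesgue_on {0..T}) \<phi>"
    and x: "\<And>s t. 0 \<le> s \<Longrightarrow> s \<le> t \<Longrightarrow> t \<le> T \<Longrightarrow> norm (x t - x s) \<le> integral {s..t} \<phi>"
  shows "\<exists>h. strongly_integrable (lebesgue_on {0..T}) h \<and>
    (\<forall>t\<in>{0..T}. x t = x 0 + strong_integral (lebesgue_on {0..t}) h)"
proof (rule strong_integral_representation_aux[OF T])
  interpret finite_measure "lebesgue_on {0..T}" by (rule finite_measure_lebesgue_on) simp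
  show i: "integrable (lebesgue_on {0..T}) (\<lambda>t. \<bar>\<phi> t\<bar> + 1)" using \<phi> by auto
  show "norm (x t - x s) \<le> integral {s..t} (\<lambda>t. \<bar>\<phi> t\<bar> + 1)" if st: "0 \<le> s" "s \<le> t" "t \<le> T" for s t
  proof (rule order_trans[OF x[OF st]])
    have "integrable (lebesgue_on {s..t}) \<phi>" "integrable (lebesgue_on {s..t}) (\<lambda>t. \<bar>\<phi> t\<bar> + 1)"
      using st by (auto intro: integrable_lebesgue_on_subinterval[OF \<phi>] integrable_lebesgue_on_subinterval[OF i])
    then show "integral {s..t} \<phi> \<le> integral {s..t} (\<lambda>t. \<bar>\<phi> t\<bar> + 1)"
      by (intro integral_le integrable_on_lebesgue_on) auto
  qed
qed simp

corollary AE_has_vector_derivative: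
  fixes x :: "real \<Rightarrow> 'a::{real_inner,complete_space}"
  assumes T: "T > 0" and \<phi>: "integrable (lebesgue_on {0..T}) \<phi>"
    and x: "\<And>s t. 0 \<le> s \<Longrightarrow> s \<le> t \<Longrightarrow> t \<le> T \<Longrightarrow> norm (x t - x s) \<le> integral {s..t} \<phi>"
  shows "AE t in lebesgue_on {0..T}. \<exists>w. (x has_vector_derivative w) (at t within {0..T})"
proof -
  obtain h where h: "strongly_integrable (lebesgue_on {0..T}) h"
    "\<And>t. t \<in> {0..T} \<Longrightarrow> x t = x 0 + strong_integral (lebesgue_on {0..t}) h"
    using strong_integral_representation[OF assms] by blast
  show ?thesis
    using AE_has_vector_derivative_strong_integral[OF h(1)] AE_space
  proof eventually_elim
    fix t
    assume d: "((\<lambda>u. strong_integral (lebesgue_on {0..u}) h) has_vector_derivative h t) (at t within {0..T})"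
      and t: "t \<in> space (lebesgue_on {0..T})"
    have "((\<lambda>u. x 0 + strong_integral (lebesgue_on {0..u}) h) has_vector_derivative 0 + h t) (at t within {0..T})"
      by (intro has_vector_derivative_add has_vector_derivative_const d)
    then have "(x has_vector_derivative 0 + h t) (at t within {0..T})"
      by (rule has_vector_derivative_transform[rotated 2]) (use t in simp, rule h(2))
    then show "\<exists>w. (x has_vector_derivative w) (at t within {0..T})" by blast
  qed
qed

text \<open>Differential inequalities become integral inequalities here. The bound is asked of every
  derivative \<open>D\<close> that exists, hence of nothing where \<open>u\<close> is not
  differentiable; absolute continuity, expressed through \<open>\<phi>\<close>, takes care of that
  null set.\<close>

corollary le_integral_of_derivative_le:
  fixes u :: "real \<Rightarrow> real"
  assumes T: "T > 0" and \<phi>: "integrable (lebesgue_on {0..T}) \<phi>"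
    and u: "\<And>s t. 0 \<le> s \<Longrightarrow> s \<le> t \<Longrightarrow> t \<le> T \<Longrightarrow> \<bar>u t - u s\<bar> \<le> integral {s..t} \<phi>"
    and \<psi>: "integrable (lebesgue_on {0..T}) \<psi>"
    and der: "AE t in lebesgue_on {0..T}. \<forall>D. (u has_vector_derivative D) (at t within {0..T}) \<longrightarrow> D \<le> \<psi> t"
    and t: "t \<in> {0..T}"
  shows "u t - u 0 \<le> integral {0..t} \<psi>"
proof -
  note C = complete_measure_interval
  have "norm (u t - u s) \<le> integral {s..t} \<phi>" if "0 \<le> s" "s \<le> t" "t \<le> T" for s t
    using u[OF that] by simp
  then obtain h where h: "strongly_integrable (lebesgue_on {0..T}) h"
    "\<And>t. t \<in> {0..T} \<Longrightarrow> u t = u 0 + strong_integral (lebesgue_on {0..t}) h"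
    using strong_integral_representation[OF T \<phi>, of u] by blast
  have ih: "integrable (lebesgue_on {0..T}) h" using h(1) strongly_integrable_real_iff[OF C] by blast
  have "AE t in lebesgue_on {0..T}. h t \<le> \<psi> t"
    using AE_has_vector_derivative_strong_integral[OF h(1)] der AE_space
  proof eventually_elim
    fix t
    assume d: "((\<lambda>u. strong_integral (lebesgue_on {0..u}) h) has_vector_derivative h t) (at t within {0..T})"
      and D: "\<forall>D. (u has_vector_derivative D) (at t within {0..T}) \<longrightarrow> D \<le> \<psi> t"
      and t: "t \<in> space (lebesgue_on {0..T})"
    have "((\<lambda>s. u 0 + strong_integral (lebesgue_on {0..s}) h) has_vector_derivative 0 + h t) (at t within {0..T})"
      by (intro has_vector_derivative_add has_vector_derivative_const d)
    then have "(u has_vector_derivative 0 + h t) (at t within {0..T})"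
      by (rule has_vector_derivative_transform[rotated 2]) (use t in simp, rule h(2))
    then show "h t \<le> \<psi> t" using D by simp
  qed
  then have ae: "AE s in lebesgue_on {0..t}. h s \<le> \<psi> s"
    by (rule AE_lebesgue_on_subset) (use t in auto)
  have i: "integrable (lebesgue_on {0..t}) h" "integrable (lebesgue_on {0..t}) \<psi>"
    using t by (auto intro: integrable_lebesgue_on_subinterval[OF ih] integrable_lebesgue_on_subinterval[OF \<psi>])
  have "u t - u 0 = (LINT s|lebesgue_on {0..t}. h s)"
    using h(2)[OF t] strong_integral_real[OF C i(1)] by simp
  also have "\<dots> \<le> (LINT s|lebesgue_on {0..t}. \<psi> s)" by (rule integral_mono_AE[OF i ae])
  also have "\<dots> = integral {0..t} \<psi>" by (rule lebesgue_on_interval_integral[OF i(2)])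
  finally show ?thesis .
qed

section \<open>Projections onto prox-regular sets\<close>

lemma infdist_lessD:
  assumes "S \<noteq> {}" "infdist z S < c"
  obtains y where "y \<in> S" "dist z y < c"
proof -
  have "(INF a\<in>S. dist z a) < c" using assms by (simp add: infdist_notempty)
  then have "\<exists>a\<in>S. dist z a < c"
    using assms(1) by (subst (asm) cINF_less_iff) (auto intro: bdd_belowI[where m=0])
  then show ?thesis using that by blast
qed

text \<open>Move repeatedly by shrinking fractions towards almost nearest points: almost nearest points of
  the new base point lie close to the old one.\<close>

lemma exists_near_point_with_projection:
  fixes S :: "'a::{real_inner,complete_space} set"
  assumes S: "closed S" "S \<noteq> {}" and e: "e > 0"
  obtains z' p where "dist z' z < e" "p \<in> S" "dist z' p = infdist z' S"
proof -
  define d0 where "d0 = infdist z S"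
  have d0: "d0 \<ge> 0" by (simp add: d0_def infdist_nonneg)
  \<comment> \<open>Each move of the base point is the fraction \<open>l n\<close> of a distance at
    most \<open>d0 + 1\<close>; the second bound on \<open>\<delta>\<close> limits the sum of all
    moves to \<open>e / 2\<close>, and the first one yields that distance bound.\<close>
  define \<delta> where "\<delta> = min (1/2) (e / (4 * (d0 + 1)))"
  have \<delta>: "\<delta> > 0" "\<delta> \<le> 1/2" "\<delta> \<le> e / (4 * (d0 + 1))" 
  proof -
    show "\<delta> > 0" using e d0 by (simp add: \<delta>_def)
  qed (simp_all only: \<delta>_def min.cobounded1 min.cobounded2)
  \<comment> \<open>The tolerance \<open>\<epsilon> n\<close> decays so much faster than the
    fraction \<open>l n\<close> that their quotient is \<open>(1/4)^n\<close>, whose square root is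
    summable. This square root controls the steps of \<open>Y\<close>.\<close>
  define l where "l n = \<delta> * (1/2)^n" for n :: nat
  define \<epsilon> where "\<epsilon> n = \<delta> * (1/8)^n" for n :: nat
  have l: "0 < l n" "l n \<le> 1/2" for n
    using \<delta> power_le_one[of "1/2::real" n] mult_mono[of \<delta> "1/2" "(1/2)^n" 1] by (auto simp: l_def)
  have \<epsilon>: "0 < \<epsilon> n" for n using \<delta> by (simp add: \<epsilon>_def)
  have "\<exists>y\<in>S. (dist x y)\<^sup>2 \<le> (infdist x S)\<^sup>2 + \<epsilon> n" for x n
  proof -
    have "infdist x S < sqrt ((infdist x S)\<^sup>2 + \<epsilon> n)"
      using \<epsilon>[of n] by (intro real_less_rsqrt) simp
    then obtain y where y: "y \<in> S" "dist x y < sqrt ((infdist x S)\<^sup>2 + \<epsilon> n)"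
      using infdist_lessD[OF S(2)] by blast
    have "(dist x y)\<^sup>2 \<le> (sqrt ((infdist x S)\<^sup>2 + \<epsilon> n))\<^sup>2" using y by (intro power_mono) auto
    then show ?thesis using y(1) \<epsilon>[of n] by (intro bexI[of _ y]) auto
  qed
  note ex = this
  define pick where "pick n x = (SOME y. y \<in> S \<and> (dist x y)\<^sup>2 \<le> (infdist x S)\<^sup>2 + \<epsilon> n)" for n x
  have pick: "pick n x \<in> S \<and> (dist x (pick n x))\<^sup>2 \<le> (infdist x S)\<^sup>2 + \<epsilon> n" for n x
    unfolding pick_def by (rule someI_ex) (use ex[of x n] in blast)
  define X where "X = rec_nat z (\<lambda>n x. x + l n *\<^sub>R (pick n x - x))"
  define Y where "Y n = pick n (X n)" for n
  have X0: "X 0 = z" and XS: "X (Suc n) = X n + l n *\<^sub>R (Y n - X n)" for n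
    by (simp_all add: X_def Y_def)
  define b where "b n = norm (Y n - X n)" for n
  have YS: "Y n \<in> S" for n by (simp add: Y_def pick)
  have b: "(b n)\<^sup>2 \<le> (infdist (X n) S)\<^sup>2 + \<epsilon> n" for n
    using pick[of n "X n"] by (simp add: b_def Y_def dist_norm norm_minus_commute)
  have YX: "norm (Y n - X (Suc n)) = (1 - l n) * b n" for n
  proof -
    have "Y n - X (Suc n) = (1 - l n) *\<^sub>R (Y n - X n)" by (simp add: XS algebra_simps)
    then show ?thesis using l[of n] by (simp add: b_def)
  qed
  have dS: "infdist (X (Suc n)) S \<le> (1 - l n) * b n" for n
    using infdist_le[OF YS[of n], of "X (Suc n)"] YX[of n] by (simp add: dist_norm norm_minus_commute)
  have l1b: "0 \<le> (1 - l n) * b n" "(1 - l n) * b n \<le> b n" for n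
    using l[of n] mult_right_mono[of "1 - l n" 1 "b n"] by (auto simp: b_def intro!: mult_nonneg_nonneg)
  \<comment> \<open>The term \<open>- \<epsilon> n\<close> closes the induction, since the next
    tolerance is an eighth of it.\<close>
  have bbound: "(b n)\<^sup>2 \<le> d0\<^sup>2 + 2 * \<delta> - \<epsilon> n" for n
  proof (induction n)
    case 0
    then show ?case using b[of 0] \<delta> by (simp add: X0 d0_def \<epsilon>_def)
  next
    case (Suc n)
    have "(infdist (X (Suc n)) S)\<^sup>2 \<le> (b n)\<^sup>2"
      using dS[of n] l1b[of n] by (intro power_mono infdist_nonneg) linarith
    then have "(b (Suc n))\<^sup>2 \<le> d0\<^sup>2 + 2 * \<delta> - \<epsilon> n + \<epsilon> (Suc n)" using b[of "Suc n"] Suc by linarith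
    moreover have "\<epsilon> n = 8 * \<epsilon> (Suc n)" by (simp add: \<epsilon>_def)
    ultimately show ?case using \<epsilon>[of "Suc n"] by linarith
  qed
  have bL: "b n \<le> d0 + 1" for n
  proof (rule power2_le_imp_le)
    have "(d0 + 1)\<^sup>2 = d0\<^sup>2 + 2 * d0 + 1" by (simp add: power2_eq_square algebra_simps)
    then show "(b n)\<^sup>2 \<le> (d0 + 1)\<^sup>2" using bbound[of n] \<delta> \<epsilon>[of n] d0 by linarith
  qed (use d0 in simp)
  have Xstep: "norm (X (Suc n) - X n) \<le> (e / 4) * (1/2)^n" for n
  proof -
    have "norm (X (Suc n) - X n) = l n * b n" using l[of n] by (simp add: XS b_def)
    also have "\<dots> \<le> l n * (d0 + 1)" using bL l[of n] by (intro mult_left_mono) auto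
    also have "\<dots> = (\<delta> * (d0 + 1)) * (1/2)^n" by (simp add: l_def)
    also have "\<dots> \<le> (e / 4) * (1/2)^n"
      using \<delta>(3) d0 by (intro mult_right_mono) (auto simp: field_simps)
    finally show ?thesis .
  qed
  have Ystep: "norm (Y (Suc n) - Y n) \<le> 2 * (1/2)^n" for n
  proof -
    define y where "y = Y (Suc n)"
    define c where "c = infdist (X n) S"
    have yc: "c \<le> norm (y - X n)"
      using infdist_le[OF YS[of "Suc n"], of "X n"] by (simp add: c_def y_def dist_norm norm_minus_commute)
    \<comment> \<open>Stewart's identity for \<open>X (Suc n)\<close>, which divides the segment
      from \<open>X n\<close> to \<open>Y n\<close>.\<close>
    have id: "(norm (y - X (Suc n)))\<^sup>2 = (1 - l n) * (norm (y - X n))\<^sup>2 + l n * (norm (y - Y n))\<^sup>2 - l n * (1 - l n) * (b n)\<^sup>2"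
    proof -
      have 1: "y - X (Suc n) = (y - X n) - l n *\<^sub>R (Y n - X n)" by (simp add: XS algebra_simps)
      have 2: "y - Y n = (y - X n) - (Y n - X n)" by simp
      show ?thesis unfolding 1 2 b_def power2_norm_eq_inner
        by (simp only: inner_diff_left inner_diff_right inner_scaleR_left inner_scaleR_right)
          (simp add: algebra_simps inner_commute)
    qed
    have up: "(norm (y - X (Suc n)))\<^sup>2 \<le> (1 - l n)\<^sup>2 * (b n)\<^sup>2 + \<epsilon> (Suc n)"
    proof -
      have "(infdist (X (Suc n)) S)\<^sup>2 \<le> ((1 - l n) * b n)\<^sup>2"
        using dS[of n] by (intro power_mono infdist_nonneg)
      then show ?thesis using b[of "Suc n"] by (simp add: b_def y_def power_mult_distrib)
    qed
    have "c\<^sup>2 \<le> (norm (y - X n))\<^sup>2" using yc by (intro power_mono) (simp_all add: c_def infdist_nonneg)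
    then have "(1 - l n) * c\<^sup>2 \<le> (1 - l n) * (norm (y - X n))\<^sup>2" using l[of n] by (intro mult_left_mono) auto
    \<comment> \<open>The new point \<open>y\<close> is almost nearest to \<open>X (Suc n)\<close>,
      yet no nearer to \<open>X n\<close> than \<open>c\<close>. This leaves room of order
      \<open>\<epsilon> n / l n\<close> for its squared distance from \<open>Y n\<close>.\<close>
    then have "l n * (norm (y - Y n))\<^sup>2 \<le> (1 - l n)\<^sup>2 * (b n)\<^sup>2 + \<epsilon> (Suc n) - (1 - l n) * c\<^sup>2 + l n * (1 - l n) * (b n)\<^sup>2"
      using id up by linarith
    also have "\<dots> = (1 - l n) * ((b n)\<^sup>2 - c\<^sup>2) + \<epsilon> (Suc n)" by (simp add: power2_eq_square algebra_simps)
    also have "(1 - l n) * ((b n)\<^sup>2 - c\<^sup>2) \<le> (1 - l n) * \<epsilon> n"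
      using b[of n] l[of n] by (intro mult_left_mono) (auto simp: c_def)
    also have "\<dots> \<le> 1 * \<epsilon> n" using l[of n] \<epsilon>[of n] by (intro mult_right_mono) auto
    finally have "l n * (norm (y - Y n))\<^sup>2 \<le> \<epsilon> n + \<epsilon> (Suc n)" by simp
    also have "\<dots> \<le> 2 * \<epsilon> n" using \<epsilon>[of "Suc n"] by (simp add: \<epsilon>_def)
    also have "\<dots> = l n * (2 * (1/4)^n)"
    proof -
      have "(1/8::real)^n = (1/2)^n * (1/4)^n" by (simp flip: power_mult_distrib)
      then show ?thesis by (simp add: l_def \<epsilon>_def)
    qed
    finally have "(norm (y - Y n))\<^sup>2 \<le> 2 * (1/4)^n" using l[of n] by (simp only: mult_le_cancel_left_pos)
    also have "\<dots> \<le> (2 * (1/2)^n)\<^sup>2"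
      by (simp add: power_mult_distrib power2_eq_square) (simp flip: power_mult_distrib)
    finally show ?thesis unfolding y_def by (rule power2_le_imp_le) simp
  qed
  have "Cauchy Y"
    by (rule Cauchy_if_summable_dist[of Y "\<lambda>n. 2 * (1/2)^n"])
      (use Ystep in \<open>auto simp: dist_norm intro: summable_mult summable_geometric\<close>)
  then obtain p where p: "Y \<longlonglongrightarrow> p" using Cauchy_convergent convergent_def by blast
  have "Cauchy X"
    by (rule Cauchy_if_summable_dist[of X "\<lambda>n. (e/4) * (1/2)^n"])
      (use Xstep in \<open>auto simp: dist_norm intro!: summable_mult summable_geometric\<close>)
  then obtain z' where z': "X \<longlonglongrightarrow> z'" using Cauchy_convergent convergent_def by blast
  show ?thesis
  proof
    show "p \<in> S" using closed_sequentially[OF S(1) _ p] YS by blast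
    have "norm (X n - z) \<le> e / 2 - e / 2 * (1/2)^n" for n
    proof (induction n)
      case (Suc n)
      have "norm (X (Suc n) - z) \<le> norm (X (Suc n) - X n) + norm (X n - z)"
        using norm_triangle_ineq[of "X (Suc n) - X n" "X n - z"] by simp
      then show ?case using Suc Xstep[of n] by simp
    qed (simp add: X0)
    then have "norm (X n - z) \<le> e / 2" for n
      using e by (smt (verit) mult_nonneg_nonneg zero_le_power divide_nonneg_nonneg)
    then have "norm (z' - z) \<le> e / 2"
      by (intro LIMSEQ_le_const2[OF tendsto_norm[OF tendsto_diff[OF z' tendsto_const]]]) auto
    then show "dist z' z < e" using e by (simp add: dist_norm)
    show "dist z' p = infdist z' S"
    proof (rule antisym)
      have "(\<lambda>n. \<epsilon> n) \<longlonglongrightarrow> \<delta> * 0"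
        unfolding \<epsilon>_def by (intro tendsto_intros LIMSEQ_realpow_zero) auto
      then have "(\<lambda>n. (infdist (X n) S)\<^sup>2 + \<epsilon> n) \<longlonglongrightarrow> (infdist z' S)\<^sup>2 + 0"
        by (intro tendsto_add tendsto_power tendsto_infdist z') simp
      moreover have "(\<lambda>n. (b n)\<^sup>2) \<longlonglongrightarrow> (norm (p - z'))\<^sup>2"
        unfolding b_def by (intro tendsto_intros p z')
      ultimately have "(norm (p - z'))\<^sup>2 \<le> (infdist z' S)\<^sup>2 + 0"
        by (intro LIMSEQ_le) (use b in auto)
      then have "(norm (p - z'))\<^sup>2 \<le> (infdist z' S)\<^sup>2" by simp
      then have "norm (p - z') \<le> infdist z' S" by (rule power2_le_imp_le) (rule infdist_nonneg)
      then show "dist z' p \<le> infdist z' S" by (simp add: dist_norm norm_minus_commute)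
      show "infdist z' S \<le> dist z' p" using \<open>p \<in> S\<close> by (rule infdist_le)
    qed
  qed
qed

text \<open>The constant \<open>\<sigma>\<close> of the normal cone depends on the point and the
  normal; prox-regularity replaces it by \<open>norm n / (2 * r)\<close>. For the normalised vector
  \<open>v\<close> the point \<open>x\<close> is nearest to \<open>x + r v\<close>, and expanding
  the squared distances gives the inequality.\<close>

lemma prox_normal_cone_inner_le:
  fixes S :: "'a::real_inner set"
  assumes S: "uniformly_prox_regular \<rho> S" and r: "0 < r" "ereal r \<le> \<rho>"
    and x: "x \<in> S" and n: "n \<in> prox_normal_cone S x" and y: "y \<in> S"
  shows "n \<bullet> (y - x) \<le> norm n / (2 * r) * (norm (y - x))\<^sup>2"
proof (cases "n = 0")
  case False
  define v where "v = n /\<^sub>R norm n"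
  obtain \<sigma> where \<sigma>: "\<sigma> \<ge> 0" "\<And>y. y \<in> S \<Longrightarrow> n \<bullet> (y - x) \<le> \<sigma> * (norm (y - x))\<^sup>2"
    using n x by (auto simp: prox_normal_cone_def)
  have "v \<bullet> (z - x) \<le> (\<sigma> / norm n) * (norm (z - x))\<^sup>2" if "z \<in> S" for z
    using \<sigma>(2)[OF that] False by (simp add: v_def divide_simps)
  then have "v \<in> prox_normal_cone S x"
    using x \<sigma>(1) unfolding prox_normal_cone_def by (auto intro!: exI[of _ "\<sigma> / norm n"])
  moreover have nv: "norm v = 1" using False by (simp add: v_def)
  ultimately have "x \<in> Proj S (x + r *\<^sub>R v)"
    using S x r unfolding uniformly_prox_regular_def by auto
  then have "dist (x + r *\<^sub>R v) x \<le> dist (x + r *\<^sub>R v) y"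
    using infdist_le[OF y, of "x + r *\<^sub>R v"] by (simp add: Proj_def)
  then have "norm (r *\<^sub>R v) \<le> norm (r *\<^sub>R v - (y - x))"
    by (simp add: dist_norm algebra_simps)
  then have "(norm (r *\<^sub>R v))\<^sup>2 \<le> (norm (r *\<^sub>R v - (y - x)))\<^sup>2" by (intro power_mono) auto
  then have "2 * r * (v \<bullet> (y - x)) \<le> (norm (y - x))\<^sup>2"
    unfolding power2_norm_eq_inner by (simp add: inner_diff_left inner_diff_right inner_commute algebra_simps)
  then have "norm n * (2 * r * (v \<bullet> (y - x))) \<le> norm n * (norm (y - x))\<^sup>2" by (intro mult_left_mono) auto
  moreover have "norm n * (v \<bullet> (y - x)) = n \<bullet> (y - x)" using False by (simp add: v_def)
  ultimately have "2 * r * (n \<bullet> (y - x)) \<le> norm n * (norm (y - x))\<^sup>2"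
    by (metis mult.assoc mult.commute)
  then show ?thesis using r by (simp add: field_simps)
qed simp

lemma diff_projection_mem_prox_normal_cone:
  fixes S :: "'a::real_inner set"
  assumes "p \<in> S" "dist z p = infdist z S"
  shows "z - p \<in> prox_normal_cone S p"
proof -
  have "(z - p) \<bullet> (y - p) \<le> 1/2 * (norm (y - p))\<^sup>2" if "y \<in> S" for y
  proof -
    have "norm (z - p) \<le> norm ((z - p) - (y - p))"
      using infdist_le[OF that, of z] assms(2) by (simp add: dist_norm)
    then have "(norm (z - p))\<^sup>2 \<le> (norm ((z - p) - (y - p)))\<^sup>2" by (intro power_mono) auto
    then show ?thesis
      unfolding power2_norm_eq_inner by (simp only: inner_diff_left inner_diff_right) (simp add: inner_commute)
  qed
  then show ?thesis using assms(1) unfolding prox_normal_cone_def by (auto intro!: exI[of _ "1/2"])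
qed

text \<open>Base points near \<open>z\<close> with nearest points exist by
  \<open>exists_near_point_with_projection\<close>. Adding the normal inequalities of two of them
  shows that nearest points are Lipschitz in the base point with constant
  \<open>1 / (1 - R / r)\<close>, so those belonging to a sequence tending to \<open>z\<close>
  converge.\<close>

lemma prox_regular_projection_exists:
  fixes S :: "'a::{real_inner,complete_space} set"
  assumes S: "uniformly_prox_regular \<rho> S" "S \<noteq> {}" and r: "0 < r" "ereal r \<le> \<rho>"
    and z: "infdist z S < r"
  obtains p where "p \<in> S" "dist z p = infdist z S"
proof -
  have cl: "closed S" using S(1) by (simp add: uniformly_prox_regular_def)
  define R where "R = (infdist z S + r) / 2"
  have R: "infdist z S < R" "R < r" "0 \<le> R" using z infdist_nonneg[of z S] by (auto simp: R_def)
  \<comment> \<open>The first bound keeps the perturbed points within distance \<open>R < r\<close>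
    of \<open>S\<close>; the second makes them converge to \<open>z\<close>.\<close>
  have "\<exists>z' p. dist z' z < min (R - infdist z S) ((1/2)^n) \<and> p \<in> S \<and> dist z' p = infdist z' S" for n :: nat
  proof -
    have "min (R - infdist z S) ((1/2)^n) > 0" using R by simp
    from exists_near_point_with_projection[OF cl S(2) this, of z] show ?thesis by metis
  qed
  then obtain zn p where zn: "\<And>n. dist (zn n) z < min (R - infdist z S) ((1/2)^n)" "\<And>n. p n \<in> S"
    "\<And>n. dist (zn n) (p n) = infdist (zn n) S" by metis
  have bd: "norm (zn n - p n) \<le> R" for n
    using zn(1)[of n] zn(3)[of n] infdist_triangle[of "zn n" S z] by (simp add: dist_norm)
  have half: "(zn n - p n) \<bullet> (p m - p n) \<le> R / (2 * r) * (norm (p m - p n))\<^sup>2" for n m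
  proof -
    have "(zn n - p n) \<bullet> (p m - p n) \<le> norm (zn n - p n) / (2 * r) * (norm (p m - p n))\<^sup>2"
      by (rule prox_normal_cone_inner_le[OF S(1) r]) (use zn(2) diff_projection_mem_prox_normal_cone[OF zn(2,3)] in auto)
    also have "\<dots> \<le> R / (2 * r) * (norm (p m - p n))\<^sup>2"
      using bd[of n] r by (intro mult_right_mono divide_right_mono) auto
    finally show ?thesis .
  qed
  have lip: "(1 - R / r) * norm (p m - p n) \<le> norm (zn m - zn n)" for m n
  proof (cases "p m = p n")
    case False
    define d where "d = norm (p m - p n)"
    have d: "d > 0" using False by (simp add: d_def)
    have "(zn n - p n) \<bullet> (p m - p n) + (zn m - p m) \<bullet> (p n - p m) \<le> R / r * d\<^sup>2"
      using half[of n m] half[of m n] by (simp add: d_def norm_minus_commute)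
    moreover have "(zn n - p n) \<bullet> (p m - p n) + (zn m - p m) \<bullet> (p n - p m) = d\<^sup>2 - (zn m - zn n) \<bullet> (p m - p n)"
      unfolding d_def power2_norm_eq_inner by (simp add: inner_diff_left inner_diff_right algebra_simps)
    moreover have "(zn m - zn n) \<bullet> (p m - p n) \<le> norm (zn m - zn n) * d"
      unfolding d_def by (rule norm_cauchy_schwarz)
    ultimately have "((1 - R / r) * d) * d \<le> norm (zn m - zn n) * d"
      by (simp add: power2_eq_square algebra_simps)
    then show ?thesis using d unfolding d_def by simp
  qed simp
  have Rr: "1 - R / r > 0" using R r by simp
  have zl: "zn \<longlonglongrightarrow> z"
  proof (rule metric_tendsto_imp_tendsto)
    show "(\<lambda>n. (1/2::real)^n) \<longlonglongrightarrow> 0" by (intro LIMSEQ_realpow_zero) auto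
    show "\<forall>\<^sub>F n in sequentially. dist (zn n) z \<le> dist ((1/2::real)^n) 0"
      using zn(1) by (intro always_eventually allI) (simp add: less_imp_le)
  qed
  have "Cauchy p"
  proof (rule metric_CauchyI)
    fix e :: real assume "e > 0"
    then have "(1 - R / r) * e > 0" using Rr by simp
    then obtain N where N: "\<And>m n. m \<ge> N \<Longrightarrow> n \<ge> N \<Longrightarrow> dist (zn m) (zn n) < (1 - R / r) * e"
      using LIMSEQ_imp_Cauchy[OF zl] unfolding Cauchy_def by metis
    have "dist (p m) (p n) < e" if "m \<ge> N" "n \<ge> N" for m n
    proof -
      have "(1 - R / r) * dist (p m) (p n) < (1 - R / r) * e"
        using lip[of m n] N[OF that] by (simp add: dist_norm)
      then show ?thesis using Rr by simp
    qed
    then show "\<exists>N. \<forall>m\<ge>N. \<forall>n\<ge>N. dist (p m) (p n) < e" by blast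
  qed
  then obtain q where q: "p \<longlonglongrightarrow> q" using Cauchy_convergent convergent_def by blast
  have "q \<in> S" using closed_sequentially[OF cl _ q] zn(2) by blast
  moreover have "dist z q = infdist z S"
    using LIMSEQ_unique[OF tendsto_dist[OF zl q]] tendsto_infdist[OF zl, of S] zn(3) by simp
  ultimately show ?thesis using that by blast
qed

text \<open>The translation-invariant consequence of prox-regularity on which the catching-up scheme rests.\<close>

definition proximable :: "real \<Rightarrow> 'a::real_inner set \<Rightarrow> bool" where
  "proximable r S \<longleftrightarrow> closed S \<and> S \<noteq> {} \<and>
    (\<forall>z. infdist z S < r \<longrightarrow> (\<exists>p\<in>S. dist z p = infdist z S \<and>
      (\<forall>y\<in>S. (z - p) \<bullet> (y - p) \<le> norm (z - p) / (2 * r) * (norm (y - p))\<^sup>2)))"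

lemma proximable_translation:
  fixes S :: "'a::{real_inner,complete_space} set"
  assumes S: "uniformly_prox_regular \<rho> S" "S \<noteq> {}" and r: "0 < r" "ereal r \<le> \<rho>"
  shows "proximable r ((\<lambda>x. x - c) ` S)"
proof -
  let ?K = "(\<lambda>x. x - c) ` S"
  have inf: "infdist z ?K = infdist (z + c) S" for z
    using S(2) by (simp add: infdist_notempty image_image dist_norm algebra_simps)
  have "closed S" using S(1) by (simp add: uniformly_prox_regular_def)
  then have "closed ?K" using closed_translation[of S "- c"] by simp
  moreover have "\<exists>p\<in>?K. dist z p = infdist z ?K \<and>
      (\<forall>y\<in>?K. (z - p) \<bullet> (y - p) \<le> norm (z - p) / (2 * r) * (norm (y - p))\<^sup>2)" if z: "infdist z ?K < r" for z
  proof -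
    obtain p where p: "p \<in> S" "dist (z + c) p = infdist (z + c) S"
      using prox_regular_projection_exists[OF S r, of "z + c"] z inf by auto
    have "(z - (p - c)) \<bullet> ((y - c) - (p - c)) \<le> norm (z - (p - c)) / (2 * r) * (norm ((y - c) - (p - c)))\<^sup>2"
      if "y \<in> S" for y
      using prox_normal_cone_inner_le[OF S(1) r p(1) diff_projection_mem_prox_normal_cone[OF p] that]
      by (simp add: algebra_simps)
    then show ?thesis
      using p inf[of z] by (intro bexI[of _ "p - c"]) (auto simp: dist_norm algebra_simps)
  qed
  ultimately show ?thesis using S(2) unfolding proximable_def by blast
qed

text \<open>The error of a stretch of the catching-up scheme over which \<open>V\<close> grows by
  \<open>d\<close>, tested at distance \<open>c\<close> from its end. Test point and iterate are
  each displaced by at most \<open>d\<close> within the stretch: this enlarges the distance in the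
  quadratic term by \<open>2 * d\<close> and adds \<open>2 * d\<close> for the inner products with
  the displacements.\<close>

definition slack :: "real \<Rightarrow> real \<Rightarrow> real \<Rightarrow> real" where
  "slack r d c = d * ((c + 2 * d)\<^sup>2 / (2 * r) + 2 * d)"

text \<open>One step of a discrete Gronwall estimate. Each curve is tested against the end point of
  the other; in the sum of the two inequalities the left sides combine to the new squared distance
  minus the inner product of old and new difference.\<close>

lemma slack_comparison:
  fixes a0 a1 b0 b1 :: "'a::real_inner"
  assumes r: "r > 0" and d: "0 \<le> d" "8 * d \<le> r"
    and a: "(a0 - a1) \<bullet> (b1 - a1) \<le> slack r d (norm (b1 - a1))"
    and b: "(b0 - b1) \<bullet> (a1 - b1) \<le> slack r d (norm (a1 - b1))"
  shows "(norm (a1 - b1))\<^sup>2 \<le> exp (8 * d / r) * ((norm (a0 - b0))\<^sup>2 + 10 * d\<^sup>2)"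
proof -
  define n0 where "n0 = norm (a0 - b0)"
  define n1 where "n1 = norm (a1 - b1)"
  have "(a0 - a1) \<bullet> (b1 - a1) + (b0 - b1) \<bullet> (a1 - b1) = n1\<^sup>2 - (a0 - b0) \<bullet> (a1 - b1)"
    unfolding n1_def power2_norm_eq_inner by (simp add: inner_diff_left inner_diff_right algebra_simps inner_commute)
  moreover have "(a0 - b0) \<bullet> (a1 - b1) \<le> n0\<^sup>2 / 2 + n1\<^sup>2 / 2"
  proof -
    have "(a0 - b0) \<bullet> (a1 - b1) \<le> n0 * n1" unfolding n0_def n1_def by (rule norm_cauchy_schwarz)
    moreover have "0 \<le> (n0 - n1)\<^sup>2" by simp
    ultimately show ?thesis by (simp add: power2_eq_square algebra_simps)
  qed
  ultimately have 1: "n1\<^sup>2 - n0\<^sup>2 \<le> 4 * slack r d n1"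
    using a b by (simp add: n1_def norm_minus_commute)
  have "(n1 + 2 * d)\<^sup>2 \<le> 2 * n1\<^sup>2 + 8 * d\<^sup>2"
    using zero_le_power2[of "n1 - 2 * d"] by (simp add: power2_eq_square algebra_simps)
  then have "(n1 + 2 * d)\<^sup>2 / (2 * r) \<le> (2 * n1\<^sup>2 + 8 * d\<^sup>2) / (2 * r)" using r by (intro divide_right_mono) auto
  also have "\<dots> = n1\<^sup>2 / r + 4 * d\<^sup>2 / r" using r by (simp add: field_simps)
  \<comment> \<open>Here \<open>8 * d \<le> r\<close> enters. Together with the \<open>2 * d\<close>
    of \<open>slack\<close> this leaves \<open>5/2 * d\<close>, and \<open>4 * d\<close> times it is
    the error \<open>10 * d^2\<close>.\<close>
  also have "4 * d\<^sup>2 / r \<le> d / 2"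
    using r d mult_left_mono[of "8 * d" r d] by (simp add: power2_eq_square field_simps)
  finally have "slack r d n1 \<le> d * (n1\<^sup>2 / r + d / 2 + 2 * d)"
    unfolding slack_def using d by (intro mult_left_mono) auto
  then have 2: "4 * slack r d n1 \<le> 4 * d / r * n1\<^sup>2 + 10 * d\<^sup>2"
  proof -
    have "4 * slack r d n1 \<le> 4 * (d * (n1\<^sup>2 / r + d / 2 + 2 * d))"
      using \<open>slack r d n1 \<le> _\<close> by simp
    then show ?thesis by (simp add: power2_eq_square algebra_simps)
  qed
  \<comment> \<open>For \<open>u\<close> between 0 and 1/2 the product
    \<open>(1 - u) * (1 + 2 * u)\<close> is at least 1, so division by \<open>1 - u\<close> costs at
    most the factor \<open>exp (2 * u)\<close>.\<close>
  define u where "u = 4 * d / r"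
  have u: "0 \<le> u" "u \<le> 1/2" using d r by (auto simp: u_def field_simps)
  have 3: "(1 - u) * n1\<^sup>2 \<le> n0\<^sup>2 + 10 * d\<^sup>2" using 1 2 by (simp add: u_def algebra_simps)
  have "1 \<le> (1 - u) * (1 + 2 * u)" using u mult_left_mono[of u "1/2" u] by (simp add: algebra_simps)
  also have "\<dots> \<le> (1 - u) * exp (2 * u)"
    using u exp_ge_add_one_self[of "2 * u"] by (intro mult_left_mono) auto
  finally have 4: "1 \<le> (1 - u) * exp (2 * u)" .
  have "n1\<^sup>2 = 1 * n1\<^sup>2" by simp
  also have "\<dots> \<le> (1 - u) * exp (2 * u) * n1\<^sup>2" by (rule mult_right_mono[OF 4]) simp
  also have "\<dots> = exp (2 * u) * ((1 - u) * n1\<^sup>2)" by (simp add: algebra_simps)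
  also have "\<dots> \<le> exp (2 * u) * (n0\<^sup>2 + 10 * d\<^sup>2)" by (rule mult_left_mono[OF 3]) simp
  finally show ?thesis by (simp add: u_def n0_def n1_def)
qed

section \<open>The catching-up scheme along dyadic grids\<close>

locale catching_up =
  fixes T r :: real and K :: "real \<Rightarrow> 'a::{real_inner,complete_space} set" and V :: "real \<Rightarrow> real" and z0 :: 'a
  assumes T: "T > 0" and r: "r > 0"
    and K: "\<And>t. t \<in> {0..T} \<Longrightarrow> proximable r (K t)"
    and V_mono: "\<And>s t. 0 \<le> s \<Longrightarrow> s \<le> t \<Longrightarrow> t \<le> T \<Longrightarrow> V s \<le> V t"
    and V_cont: "continuous_on {0..T} V"
    and K_V: "\<And>s t x. s \<in> {0..T} \<Longrightarrow> t \<in> {0..T} \<Longrightarrow> x \<in> K s \<Longrightarrow> infdist x (K t) \<le> \<bar>V t - V s\<bar>"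
    and z0: "z0 \<in> K 0"
begin

abbreviation "G \<equiv> grid T"

abbreviation "k \<equiv> cell T"

text \<open>The choice is known to have a witness while the next set is at distance less than
  \<open>r\<close>. The condition \<open>small_inc r n\<close> below ensures this, as
  \<open>V\<close> then grows by less than \<open>r\<close> per grid step.\<close>

definition iterate :: "nat \<Rightarrow> nat \<Rightarrow> 'a" where
  "iterate n = rec_nat z0 (\<lambda>i y. SOME p. p \<in> K (G n (Suc i)) \<and> dist y p = infdist y (K (G n (Suc i))) \<and>
    (\<forall>w\<in>K (G n (Suc i)). (y - p) \<bullet> (w - p) \<le> norm (y - p) / (2 * r) * (norm (w - p))\<^sup>2))"

definition small_inc :: "real \<Rightarrow> nat \<Rightarrow> bool" where
  "small_inc \<delta> n \<longleftrightarrow> (\<forall>s t. 0 \<le> s \<longrightarrow> s \<le> t \<longrightarrow> t \<le> T \<longrightarrow> t - s \<le> T / 2 ^ n \<longrightarrow> V t - V s < \<delta>)"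

lemma eventually_small_inc:
  assumes "\<delta> > 0"
  shows "\<exists>N. \<forall>n\<ge>N. small_inc \<delta> n"
proof -
  have "uniformly_continuous_on {0..T} V"
    by (rule compact_uniformly_continuous[OF V_cont]) simp
  then obtain d where d: "d > 0" "\<And>x x'. x \<in> {0..T} \<Longrightarrow> x' \<in> {0..T} \<Longrightarrow> dist x' x < d \<Longrightarrow> dist (V x') (V x) < \<delta>"
    using assms unfolding uniformly_continuous_on_def by metis
  have "(\<lambda>n. T * (1/2)^n) \<longlonglongrightarrow> T * 0" by (intro tendsto_intros LIMSEQ_realpow_zero) auto
  then have "\<forall>\<^sub>F n in sequentially. T * (1/2)^n < d" by (rule order_tendstoD(2)) (use d in simp)
  then obtain N where N: "\<And>n. n \<ge> N \<Longrightarrow> T * (1/2)^n < d" by (auto simp: eventually_sequentially)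
  have "small_inc \<delta> n" if "n \<ge> N" for n
    unfolding small_inc_def
  proof (intro allI impI)
    fix s t assume st: "0 \<le> s" "s \<le> t" "t \<le> T" "t - s \<le> T / 2 ^ n"
    then have "dist t s < d" using N[OF that] by (simp add: dist_real_def power_divide)
    then have "dist (V t) (V s) < \<delta>" using d(2)[of s t] st by auto
    then show "V t - V s < \<delta>" by (simp add: dist_real_def)
  qed
  then show ?thesis by blast
qed

lemma grid_mem: "i \<le> 2 ^ n \<Longrightarrow> G n i \<in> {0..T}"
  using grid_nonneg[OF T] grid_le[OF T] by simp

lemma V_grid_mono: "i \<le> j \<Longrightarrow> j \<le> 2 ^ n \<Longrightarrow> V (G n i) \<le> V (G n j)"
  using grid_nonneg[OF T] grid_mono[OF T] grid_le[OF T] by (intro V_mono) auto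

lemma iterate_0 [simp]: "iterate n 0 = z0"
  by (simp add: iterate_def)

lemma small_inc_step: "small_inc \<delta> n \<Longrightarrow> i < 2 ^ n \<Longrightarrow> V (G n (Suc i)) - V (G n i) < \<delta>"
  using grid_nonneg[OF T, of n i] grid_mono[OF T, of i "Suc i" n] grid_le[OF T, of "Suc i" n]
  unfolding small_inc_def by (simp add: grid_Suc[OF T])

lemma iterate_Suc:
  assumes small_inc: "small_inc r n" and i: "i < 2 ^ n" and Yi: "iterate n i \<in> K (G n i)"
  shows "iterate n (Suc i) \<in> K (G n (Suc i))"
    "norm (iterate n i - iterate n (Suc i)) \<le> V (G n (Suc i)) - V (G n i)"
    "\<And>w. w \<in> K (G n (Suc i)) \<Longrightarrow> (iterate n i - iterate n (Suc i)) \<bullet> (w - iterate n (Suc i))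
      \<le> (V (G n (Suc i)) - V (G n i)) / (2 * r) * (norm (w - iterate n (Suc i)))\<^sup>2"
proof -
  let ?K = "K (G n (Suc i))"
  have mem: "G n i \<in> {0..T}" "G n (Suc i) \<in> {0..T}" using i grid_mem by auto
  have dVnn: "0 \<le> V (G n (Suc i)) - V (G n i)" using V_grid_mono[of i "Suc i" n] i by simp
  have inf: "infdist (iterate n i) ?K \<le> V (G n (Suc i)) - V (G n i)"
    using K_V[OF mem Yi] dVnn by simp
  then have "infdist (iterate n i) ?K < r" using small_inc_step[OF small_inc i] by simp
  then have "\<exists>p. p \<in> ?K \<and> dist (iterate n i) p = infdist (iterate n i) ?K \<and>
    (\<forall>w\<in>?K. (iterate n i - p) \<bullet> (w - p) \<le> norm (iterate n i - p) / (2 * r) * (norm (w - p))\<^sup>2)"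
    using K[OF mem(2)] unfolding proximable_def by blast
  from someI_ex[OF this] have S: "iterate n (Suc i) \<in> ?K" "dist (iterate n i) (iterate n (Suc i)) = infdist (iterate n i) ?K"
    "\<And>w. w \<in> ?K \<Longrightarrow> (iterate n i - iterate n (Suc i)) \<bullet> (w - iterate n (Suc i)) \<le> norm (iterate n i - iterate n (Suc i)) / (2 * r) * (norm (w - iterate n (Suc i)))\<^sup>2"
    by (auto simp: iterate_def)
  show "iterate n (Suc i) \<in> ?K" by (rule S)
  show nb: "norm (iterate n i - iterate n (Suc i)) \<le> V (G n (Suc i)) - V (G n i)" using S(2) inf by (simp add: dist_norm)
  show "(iterate n i - iterate n (Suc i)) \<bullet> (w - iterate n (Suc i))
      \<le> (V (G n (Suc i)) - V (G n i)) / (2 * r) * (norm (w - iterate n (Suc i)))\<^sup>2" if "w \<in> ?K" for w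
    by (rule order_trans[OF S(3)[OF that]]) (use nb r in \<open>auto intro!: mult_right_mono divide_right_mono\<close>)
qed

lemma iterate_mem: "small_inc r n \<Longrightarrow> i \<le> 2 ^ n \<Longrightarrow> iterate n i \<in> K (G n i)"
proof (induction i)
  case (Suc i)
  then show ?case using iterate_Suc(1)[of n i] by simp
qed (simp add: z0 grid_0[OF T])

lemma iterate_dist:
  assumes "small_inc r n" "i \<le> j" "j \<le> 2 ^ n"
  shows "norm (iterate n i - iterate n j) \<le> V (G n j) - V (G n i)"
  using assms(2,3)
proof (induction j rule: dec_induct)
  case (step j)
  have "norm (iterate n i - iterate n (Suc j)) \<le> norm (iterate n i - iterate n j) + norm (iterate n j - iterate n (Suc j))"
    using norm_triangle_ineq[of "iterate n i - iterate n j" "iterate n j - iterate n (Suc j)"] by simp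
  then show ?case using step iterate_Suc(2)[OF assms(1), of j] iterate_mem[OF assms(1), of j] by simp
qed simp

text \<open>The projection inequalities of the steps from \<open>i\<close> to \<open>j\<close> are
  summed, all tested against the same \<open>y\<close> in the last set. At step \<open>l\<close> the
  point \<open>y\<close> is replaced by a point of the current set and the last iterate by the
  current one. Every step then contributes the increment of \<open>V\<close> times the same constant
  \<open>c\<close>, and the increments telescope.\<close>

lemma iterate_slack:
  assumes small_inc: "small_inc r n" and ij: "i \<le> j" "j \<le> 2 ^ n" and small: "V (G n j) - V (G n i) < r"
    and y: "y \<in> K (G n j)"
  shows "(iterate n i - iterate n j) \<bullet> (y - iterate n j) \<le> slack r (V (G n j) - V (G n i)) (norm (y - iterate n j))"
proof -
  define d where "d = V (G n j) - V (G n i)"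
  define c where "c = (norm (y - iterate n j) + 2 * d)\<^sup>2 / (2 * r) + 2 * d"
  have d: "0 \<le> d" "d < r" using V_grid_mono[OF ij] small by (auto simp: d_def)
  have "(iterate n i - iterate n l) \<bullet> (y - iterate n j) \<le> (V (G n l) - V (G n i)) * c" if "i \<le> l" "l \<le> j" for l
    using that
  proof (induction l rule: dec_induct)
    case (step l)
    have l: "l < 2 ^ n" "Suc l \<le> 2 ^ n" using step ij by auto
    define p where "p = V (G n (Suc l)) - V (G n l)"
    have p: "0 \<le> p" using V_grid_mono[of l "Suc l" n] l by (simp add: p_def)
    have rest: "V (G n j) - V (G n (Suc l)) \<le> d" "0 \<le> V (G n j) - V (G n (Suc l))"
      using V_grid_mono[of i "Suc l" n] V_grid_mono[of "Suc l" j n] step ij by (auto simp: d_def)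
    \<comment> \<open>Sets at later times are close to earlier ones too; since \<open>d < r\<close>,
      the set at time \<open>G n (Suc l)\<close> contains a nearest point of
      \<open>y\<close>.\<close>
    have "infdist y (K (G n (Suc l))) \<le> d"
      using K_V[of "G n j" "G n (Suc l)" y] grid_mem[of j n] grid_mem[of "Suc l" n] l ij y rest by auto
    then obtain y' where y': "y' \<in> K (G n (Suc l))" "norm (y - y') \<le> d"
      using K[of "G n (Suc l)"] grid_mem[of "Suc l" n] l d unfolding proximable_def dist_norm
      by (metis le_less_trans)
    note st = iterate_Suc[OF small_inc l(1) iterate_mem[OF small_inc less_imp_le[OF l(1)]], folded p_def]
    have Yj: "norm (iterate n (Suc l) - iterate n j) \<le> d"
      using iterate_dist[OF small_inc, of "Suc l" j] step ij rest by simp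
    have "norm (y' - iterate n (Suc l)) \<le> norm (y - iterate n j) + 2 * d"
    proof -
      have "y' - iterate n (Suc l) = (y - iterate n j) - (y - y') - (iterate n (Suc l) - iterate n j)" by simp
      then have "norm (y' - iterate n (Suc l)) \<le> norm (y - iterate n j) + norm (y - y') + norm (iterate n (Suc l) - iterate n j)"
        using order_trans[OF norm_triangle_ineq4 add_right_mono[OF norm_triangle_ineq4]]
        by (subst \<open>y' - iterate n (Suc l) = _\<close>)
      then show ?thesis using y'(2) Yj by simp
    qed
    then have "(norm (y' - iterate n (Suc l)))\<^sup>2 \<le> (norm (y - iterate n j) + 2 * d)\<^sup>2" by (intro power_mono) auto
    then have 1: "(iterate n l - iterate n (Suc l)) \<bullet> (y' - iterate n (Suc l)) \<le> p / (2 * r) * (norm (y - iterate n j) + 2 * d)\<^sup>2"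
      using r p by (intro order_trans[OF st(3)[OF y'(1)]] mult_left_mono) auto
    have cs: "(iterate n l - iterate n (Suc l)) \<bullet> w \<le> p * d" if "norm w \<le> d" for w
    proof -
      have "(iterate n l - iterate n (Suc l)) \<bullet> w \<le> norm (iterate n l - iterate n (Suc l)) * norm w" by (rule norm_cauchy_schwarz)
      also have "\<dots> \<le> p * d" using st(2) that p by (intro mult_mono) auto
      finally show ?thesis .
    qed
    have "(iterate n l - iterate n (Suc l)) \<bullet> (y - iterate n j) = (iterate n l - iterate n (Suc l)) \<bullet> (y' - iterate n (Suc l))
        + (iterate n l - iterate n (Suc l)) \<bullet> (y - y') + (iterate n l - iterate n (Suc l)) \<bullet> (iterate n (Suc l) - iterate n j)"
      by (simp flip: inner_add_right)
    also have "\<dots> \<le> p / (2 * r) * (norm (y - iterate n j) + 2 * d)\<^sup>2 + p * d + p * d"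
      by (intro add_mono 1 cs y'(2) Yj)
    also have "\<dots> = p * c" by (simp add: c_def algebra_simps)
    finally have 2: "(iterate n l - iterate n (Suc l)) \<bullet> (y - iterate n j) \<le> p * c" .
    have "(iterate n i - iterate n (Suc l)) \<bullet> (y - iterate n j) = (iterate n i - iterate n l) \<bullet> (y - iterate n j) + (iterate n l - iterate n (Suc l)) \<bullet> (y - iterate n j)"
      by (simp flip: inner_add_left)
    also have "\<dots> \<le> (V (G n l) - V (G n i)) * c + p * c" using step 2 by (intro add_mono) auto
    finally show ?case by (simp add: p_def algebra_simps)
  qed simp
  from this[OF ij(1) order_refl] show ?thesis by (simp add: slack_def d_def c_def)
qed

text \<open>Induction over the coarse grid. The fine scheme satisfies the slack inequality across a
  whole coarse step, because \<open>iterate_slack\<close> holds between any two grid points with a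
  small increment of \<open>V\<close>; hence both schemes can be compared at common grid points. The
  local errors satisfy \<open>10 * d^2 \<le> 10 * \<delta> * d\<close> and sum up to
  \<open>10 * \<delta>\<close> times the total increment of \<open>V\<close>.\<close>

lemma iterate_refine:
  assumes small_inc: "small_inc r n" "small_inc r m" "small_inc \<delta> n" and \<delta>: "0 < \<delta>" "8 * \<delta> \<le> r" and nm: "n \<le> m" and i: "i \<le> 2 ^ n"
  shows "(norm (iterate n i - iterate m (i * 2 ^ (m - n))))\<^sup>2
    \<le> exp (8 * (V (G n i) - V 0) / r) * (10 * \<delta> * (V (G n i) - V 0))"
  using i
proof (induction i)
  case (Suc i)
  define e where "e = (2::nat) ^ (m - n)"
  define d where "d = V (G n (Suc i)) - V (G n i)"
  define A where "A = V (G n i) - V 0"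
  have le: "Suc i * e \<le> 2 ^ m" "i * e \<le> Suc i * e"
  proof -
    have "Suc i * e \<le> 2 ^ n * e" using Suc.prems by (intro mult_right_mono) auto
    then show "Suc i * e \<le> 2 ^ m" using nm by (simp add: e_def flip: power_add)
  qed simp
  have g: "G m (i * e) = G n i" "G m (Suc i * e) = G n (Suc i)"
    unfolding e_def by (rule grid_refine[OF T nm])+
  have d: "0 \<le> d" "d \<le> \<delta>" "8 * d \<le> r" "d < r"
    using V_grid_mono[of i "Suc i" n] small_inc_step[OF small_inc(3), of i] Suc.prems \<delta> by (auto simp: d_def)
  have A: "0 \<le> A" using V_grid_mono[of 0 i n] Suc.prems by (simp add: A_def grid_0[OF T])
  have "(norm (iterate n (Suc i) - iterate m (Suc i * e)))\<^sup>2 \<le> exp (8 * d / r) * ((norm (iterate n i - iterate m (i * e)))\<^sup>2 + 10 * d\<^sup>2)"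
  proof (rule slack_comparison[OF r d(1,3)])
    have "iterate m (Suc i * e) \<in> K (G n (Suc i))" using iterate_mem[OF small_inc(2) le(1)] g by simp
    then show "(iterate n i - iterate n (Suc i)) \<bullet> (iterate m (Suc i * e) - iterate n (Suc i)) \<le> slack r d (norm (iterate m (Suc i * e) - iterate n (Suc i)))"
      using iterate_slack[OF small_inc(1), of i "Suc i"] Suc.prems d by (simp add: d_def)
    have "iterate n (Suc i) \<in> K (G m (Suc i * e))" using iterate_mem[OF small_inc(1) Suc.prems] g by simp
    then show "(iterate m (i * e) - iterate m (Suc i * e)) \<bullet> (iterate n (Suc i) - iterate m (Suc i * e)) \<le> slack r d (norm (iterate n (Suc i) - iterate m (Suc i * e)))"
      using iterate_slack[OF small_inc(2) le(2,1)] d unfolding g d_def by simp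
  qed
  also have "(norm (iterate n i - iterate m (i * e)))\<^sup>2 + 10 * d\<^sup>2 \<le> exp (8 * A / r) * (10 * \<delta> * A) + exp (8 * A / r) * (10 * \<delta> * d)"
  proof (rule add_mono)
    show "(norm (iterate n i - iterate m (i * e)))\<^sup>2 \<le> exp (8 * A / r) * (10 * \<delta> * A)"
      using Suc by (simp add: A_def e_def)
    have "10 * d\<^sup>2 \<le> 10 * \<delta> * d" using d by (simp add: power2_eq_square mult_right_mono)
    also have "\<dots> \<le> exp (8 * A / r) * (10 * \<delta> * d)"
      using A r d \<delta> mult_right_mono[of 1 "exp (8 * A / r)" "10 * \<delta> * d"] by simp
    finally show "10 * d\<^sup>2 \<le> exp (8 * A / r) * (10 * \<delta> * d)" .
  qed
  also have "exp (8 * d / r) * (exp (8 * A / r) * (10 * \<delta> * A) + exp (8 * A / r) * (10 * \<delta> * d))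
    = exp (8 * (A + d) / r) * (10 * \<delta> * (A + d))"
    by (simp add: exp_add add_divide_distrib algebra_simps)
  also have "A + d = V (G n (Suc i)) - V 0" by (simp add: A_def d_def)
  finally show ?case by (simp add: e_def)
qed (simp add: grid_0[OF T])

definition step_curve :: "nat \<Rightarrow> real \<Rightarrow> 'a" where "step_curve n t = iterate n (k n t)"

lemma V_cell:
  assumes "t \<in> {0..T}"
  shows "V (G n (k n t)) \<le> V t" "small_inc \<delta> n \<Longrightarrow> V t - V (G n (k n t)) < \<delta>"
    and "(\<lambda>n. V (G n (k n t))) \<longlonglongrightarrow> V t"
proof -
  have mem: "G n (k n t) \<in> {0..t}" for n by (rule grid_cell_mem[OF T assms])
  show "V (G n (k n t)) \<le> V t" using mem[of n] assms by (intro V_mono) auto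
  show "V t - V (G n (k n t)) < \<delta>" if "small_inc \<delta> n"
  proof -
    have "0 \<le> G n (k n t)" "G n (k n t) \<le> t" "t \<le> T" "t - G n (k n t) \<le> T / 2 ^ n"
      using mem[of n] less_grid_Suc_cell[OF T, of t n] assms by auto
    then show ?thesis using that unfolding small_inc_def by blast
  qed
  show "(\<lambda>n. V (G n (k n t))) \<longlonglongrightarrow> V t"
  proof (rule continuous_on_tendsto_compose[OF V_cont])
    show "(\<lambda>n. G n (k n t)) \<longlonglongrightarrow> t" using grid_cell_tendsto[OF T] assms by simp
    show "\<forall>\<^sub>F n in sequentially. G n (k n t) \<in> {0..T}"
      using mem assms by (intro always_eventually allI) (meson atLeastAtMost_iff order_trans)
  qed fact
qed

text \<open>Both schemes are compared at the last coarse grid point before \<open>t\<close>, a point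
  of the fine grid as well. From there the fine scheme moves to its value at \<open>t\<close> by
  less than the oscillation of \<open>V\<close> on a coarse cell.\<close>

lemma step_curve_Cauchy:
  assumes t: "t \<in> {0..T}"
  shows "Cauchy (\<lambda>n. step_curve n t)"
proof (rule metric_CauchyI)
  fix e :: real assume e: "e > 0"
  define L where "L = V T - V 0"
  have L: "L \<ge> 0" using V_mono[of 0 T] T by (simp add: L_def)
  define C where "C = exp (8 * L / r) * (10 * L)"
  have C: "C \<ge> 0" using L by (simp add: C_def)
  \<comment> \<open>The three bounds serve the motion within a coarse cell, the condition
    \<open>8 * \<delta> \<le> r\<close> of the comparison, and the smallness of its result
    \<open>C * \<delta>\<close>.\<close>
  define \<delta> where "\<delta> = min (e / 4) (min (r / 8) ((e / 4)\<^sup>2 / (C + 1)))"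
  have \<delta>: "\<delta> > 0" "\<delta> \<le> e / 4" "8 * \<delta> \<le> r" "\<delta> \<le> (e / 4)\<^sup>2 / (C + 1)"
  proof -
    show "\<delta> > 0" using e r C by (simp add: \<delta>_def)
    show "8 * \<delta> \<le> r" "\<delta> \<le> e / 4" "\<delta> \<le> (e / 4)\<^sup>2 / (C + 1)" unfolding \<delta>_def by linarith+
  qed
  have C\<delta>: "C * \<delta> \<le> (e / 4)\<^sup>2"
  proof -
    have "C * \<delta> \<le> (C + 1) * \<delta>" using \<delta> by simp
    also have "\<dots> \<le> (e / 4)\<^sup>2" using \<delta>(4) C by (simp add: field_simps)
    finally show ?thesis .
  qed
  obtain N where N: "\<And>n. n \<ge> N \<Longrightarrow> small_inc \<delta> n" using eventually_small_inc[OF \<delta>(1)] by blast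
  have fr: "small_inc r n" if "small_inc \<delta> n" for n
    using that \<delta> unfolding small_inc_def by (smt (verit) r)
  have key: "dist (step_curve n t) (step_curve m t) < e" if "n \<ge> N" "n \<le> m" for n m
  proof -
    define i where "i = k n t"
    define i' where "i' = i * 2 ^ (m - n)"
    define j where "j = k m t"
    have i: "i \<le> 2 ^ n" "j \<le> 2 ^ m" using cell_le[OF T] t by (auto simp: i_def j_def)
    have g: "G m i' = G n i" unfolding i'_def by (rule grid_refine[OF T that(2)])
    have "i' \<le> j"
    proof -
      have "k m (G n i) = i'"
        using grid_nonneg[OF T, of m i'] grid_strict_mono[OF T, of i' "Suc i'" m]
        by (subst cell_eq_iff[OF T]) (auto simp flip: g)
      moreover have "k m (G n i) \<le> k m t"
        using grid_cell_le[OF T, of t n] t by (intro cell_mono[OF T]) (simp add: i_def)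
      ultimately show ?thesis by (simp add: j_def)
    qed
    have f: "small_inc \<delta> n" "small_inc \<delta> m" using N that by auto
    have Vi: "0 \<le> V (G n i) - V 0" "V (G n i) - V 0 \<le> L"
      using V_grid_mono[of 0 i n] V_grid_mono[of i "2 ^ n" n] i by (auto simp: grid_0[OF T] grid_last[OF T] L_def)
    have "(norm (iterate n i - iterate m i'))\<^sup>2 \<le> exp (8 * (V (G n i) - V 0) / r) * (10 * \<delta> * (V (G n i) - V 0))"
      unfolding i'_def by (rule iterate_refine[OF fr[OF f(1)] fr[OF f(2)] f(1) \<delta>(1,3) that(2) i(1)])
    also have "\<dots> \<le> exp (8 * L / r) * (10 * \<delta> * L)"
      using Vi \<delta> r by (intro mult_mono) (auto intro!: divide_right_mono mult_left_mono)
    also have "\<dots> = C * \<delta>" by (simp add: C_def)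
    finally have "(norm (iterate n i - iterate m i'))\<^sup>2 \<le> (e / 4)\<^sup>2" using C\<delta> by simp
    then have 1: "norm (iterate n i - iterate m i') \<le> e / 4" by (rule power2_le_imp_le) (use e in simp)
    have "norm (iterate m i' - iterate m j) \<le> V (G m j) - V (G m i')"
      by (rule iterate_dist[OF fr[OF f(2)] \<open>i' \<le> j\<close> i(2)])
    also have "\<dots> \<le> V t - V (G n i)" using V_cell(1)[OF t, of m] by (simp add: g j_def)
    also have "\<dots> < \<delta>" using V_cell(2)[OF t f(1)] by (simp add: i_def)
    finally have 2: "norm (iterate m i' - iterate m j) < e / 4" using \<delta> by simp
    have "norm (iterate n i - iterate m j) \<le> norm (iterate n i - iterate m i') + norm (iterate m i' - iterate m j)"
      using norm_triangle_ineq[of "iterate n i - iterate m i'" "iterate m i' - iterate m j"] by simp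
    then show ?thesis using 1 2 e by (simp add: dist_norm step_curve_def i_def j_def)
  qed
  have "dist (step_curve m t) (step_curve n t) < e" if "m \<ge> N" "n \<ge> N" for m n
    using key[of m n] key[of n m] that by (metis dist_commute nle_le)
  then show "\<exists>N. \<forall>m\<ge>N. \<forall>n\<ge>N. dist (step_curve m t) (step_curve n t) < e" by blast
qed

lemma eventually_small_inc_seq: "\<delta> > 0 \<Longrightarrow> \<forall>\<^sub>F n in sequentially. small_inc \<delta> n"
  using eventually_small_inc by (simp add: eventually_sequentially)

theorem sweeping_limit:
  obtains z where "z 0 = z0" "\<And>t. t \<in> {0..T} \<Longrightarrow> z t \<in> K t"
    "\<And>s t. 0 \<le> s \<Longrightarrow> s \<le> t \<Longrightarrow> t \<le> T \<Longrightarrow> norm (z s - z t) \<le> V t - V s"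
    "\<And>s t y. 0 \<le> s \<Longrightarrow> s \<le> t \<Longrightarrow> t \<le> T \<Longrightarrow> V t - V s < r \<Longrightarrow> y \<in> K t \<Longrightarrow>
      (z s - z t) \<bullet> (y - z t) \<le> slack r (V t - V s) (norm (y - z t))"
proof -
  define z where "z t = lim (\<lambda>n. step_curve n t)" for t
  have z: "(\<lambda>n. step_curve n t) \<longlonglongrightarrow> z t" if "t \<in> {0..T}" for t
    unfolding z_def using Cauchy_convergent[OF step_curve_Cauchy[OF that]] convergent_LIMSEQ_iff by blast
  have kle: "k n t \<le> 2 ^ n" if "t \<in> {0..T}" for t n using cell_le[OF T] that by simp
  show ?thesis
  proof
    have "step_curve n 0 = z0" for n by (simp add: step_curve_def cell_0[OF T])
    then show "z 0 = z0" using LIMSEQ_unique[OF z[of 0]] T by simp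
    show "z t \<in> K t" if t: "t \<in> {0..T}" for t
    proof -
      have "infdist (z t) (K t) \<le> 0"
      proof (rule tendsto_le[OF trivial_limit_sequentially])
        show "(\<lambda>n. V t - V (G n (k n t))) \<longlonglongrightarrow> 0"
          using tendsto_diff[OF tendsto_const V_cell(3)[OF t], of "V t"] by simp
        show "(\<lambda>n. infdist (step_curve n t) (K t)) \<longlonglongrightarrow> infdist (z t) (K t)" by (intro tendsto_infdist z t)
        show "\<forall>\<^sub>F n in sequentially. infdist (step_curve n t) (K t) \<le> V t - V (G n (k n t))"
          using eventually_small_inc_seq[OF r]
        proof eventually_elim
          fix n assume "small_inc r n"
          then show "infdist (step_curve n t) (K t) \<le> V t - V (G n (k n t))"
            using K_V[OF grid_mem[OF kle[OF t]] t iterate_mem[OF _ kle[OF t]], of n] V_cell(1)[OF t, of n]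
            by (simp add: step_curve_def)
        qed
      qed
      then show ?thesis
        using K[OF t] infdist_nonneg[of "z t" "K t"] unfolding proximable_def
        by (metis in_closed_iff_infdist_zero order_antisym)
    qed
    show "norm (z s - z t) \<le> V t - V s" if st: "0 \<le> s" "s \<le> t" "t \<le> T" for s t
    proof (rule tendsto_le[OF trivial_limit_sequentially])
      have mem: "s \<in> {0..T}" "t \<in> {0..T}" using st by auto
      show "(\<lambda>n. V (G n (k n t)) - V (G n (k n s))) \<longlonglongrightarrow> V t - V s"
        by (intro tendsto_diff V_cell mem)
      show "(\<lambda>n. norm (step_curve n s - step_curve n t)) \<longlonglongrightarrow> norm (z s - z t)" by (intro tendsto_intros z mem)
      show "\<forall>\<^sub>F n in sequentially. norm (step_curve n s - step_curve n t) \<le> V (G n (k n t)) - V (G n (k n s))"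
        using eventually_small_inc_seq[OF r]
        by eventually_elim (use iterate_dist kle mem cell_mono[OF T st(2)] in \<open>simp add: step_curve_def\<close>)
    qed
    show "(z s - z t) \<bullet> (y - z t) \<le> slack r (V t - V s) (norm (y - z t))"
      if st: "0 \<le> s" "s \<le> t" "t \<le> T" and small: "V t - V s < r" and y: "y \<in> K t" for s t y
    proof -
      have mem: "s \<in> {0..T}" "t \<in> {0..T}" using st by auto
      \<comment> \<open>The approximating inequality needs a test point in the set at the grid time,
        not at time \<open>t\<close>. By continuity of \<open>V\<close> such points can be chosen
        converging to \<open>y\<close>.\<close>
      have "\<exists>y'. small_inc r n \<longrightarrow> y' \<in> K (G n (k n t)) \<and> norm (y' - y) \<le> V t - V (G n (k n t))" for n
      proof (cases "small_inc r n")
        case True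
        have "infdist y (K (G n (k n t))) \<le> V t - V (G n (k n t))"
          using K_V[OF mem(2) grid_mem[OF kle[OF mem(2)]] y, of n] V_cell(1)[OF mem(2), of n] by simp
        moreover have "\<dots> < r" by (rule V_cell(2)[OF mem(2) True])
        ultimately show ?thesis
          using K[OF grid_mem[OF kle[OF mem(2)]], of n] unfolding proximable_def dist_norm
          by (metis le_less_trans norm_minus_commute)
      qed simp
      then obtain yn where yn: "\<And>n. small_inc r n \<Longrightarrow> yn n \<in> K (G n (k n t))"
        "\<And>n. small_inc r n \<Longrightarrow> norm (yn n - y) \<le> V t - V (G n (k n t))" by metis
      have "(\<lambda>n. V t - V (G n (k n t))) \<longlonglongrightarrow> 0"
        using tendsto_diff[OF tendsto_const V_cell(3)[OF mem(2)], of "V t"] by simp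
      moreover have "\<forall>\<^sub>F n in sequentially. norm (yn n - y) \<le> V t - V (G n (k n t))"
        using eventually_small_inc_seq[OF r] by eventually_elim (rule yn(2))
      ultimately have "(\<lambda>n. yn n - y) \<longlonglongrightarrow> 0" by (rule Lim_null_comparison[rotated])
      then have yl: "yn \<longlonglongrightarrow> y" by (simp add: LIM_zero_iff)
      let ?d = "\<lambda>n. V (G n (k n t)) - V (G n (k n s))"
      have dl: "?d \<longlonglongrightarrow> V t - V s" by (intro tendsto_diff V_cell mem)
      have ev: "\<forall>\<^sub>F n in sequentially. (step_curve n s - step_curve n t) \<bullet> (yn n - step_curve n t) \<le> slack r (?d n) (norm (yn n - step_curve n t))"
        using eventually_small_inc_seq[OF r] order_tendstoD(2)[OF dl small]
        by eventually_elim (use iterate_slack kle mem cell_mono[OF T st(2)] yn in \<open>simp add: step_curve_def\<close>)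
      show ?thesis
      proof (rule tendsto_le[OF trivial_limit_sequentially _ _ ev])
        show "(\<lambda>n. (step_curve n s - step_curve n t) \<bullet> (yn n - step_curve n t)) \<longlonglongrightarrow> (z s - z t) \<bullet> (y - z t)"
          by (intro tendsto_intros z mem yl)
        show "(\<lambda>n. slack r (?d n) (norm (yn n - step_curve n t))) \<longlonglongrightarrow> slack r (V t - V s) (norm (y - z t))"
          unfolding slack_def using r by (intro tendsto_intros dl yl z mem) auto
      qed
    qed
  qed
qed

end

section \<open>The sweeping process with an integrable forcing\<close>

lemma infdist_le_Haus:
  assumes H: "Haus A B \<le> ennreal c" and c: "0 \<le> c" and x: "x \<in> A"
  shows "infdist x B \<le> c"
proof -
  have "ennreal (infdist x B) \<le> (SUP x\<in>A. ennreal (infdist x B))" using x by (rule SUP_upper)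
  also have "\<dots> \<le> Haus A B" by (simp add: Haus_def)
  also have "\<dots> \<le> ennreal c" by (rule H)
  finally show ?thesis using c by (simp add: infdist_nonneg)
qed

text \<open>The slack inequality compares an earlier position with the set at a later time, so only
  quotients from the left are available. The shift in \<open>n + 2\<close> keeps
  \<open>t - t / real (n + 2)\<close> strictly between 0 and \<open>t\<close>.\<close>

lemma left_difference_quotient_tendsto:
  fixes z :: "real \<Rightarrow> 'a::real_normed_vector"
  assumes z: "(z has_vector_derivative u) (at t within {0..T})" and t: "0 < t" "t \<le> T"
  shows "(\<lambda>n. (z t - z (t - t / real (n + 2))) /\<^sub>R (t / real (n + 2))) \<longlonglongrightarrow> u"
proof (rule LIMSEQ_I)
  fix e :: real assume e: "e > 0"
  obtain d where d: "d > 0" "\<And>y. y \<in> {0..T} \<Longrightarrow> norm (y - t) < d \<Longrightarrow>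
      norm (z y - z t - (y - t) *\<^sub>R u) \<le> e / 2 * norm (y - t)"
    using z half_gt_zero[OF e] unfolding has_vector_derivative_def has_derivative_within_alt by blast
  have "(\<lambda>n. t / real (n + 2)) \<longlonglongrightarrow> 0" by (rule LIMSEQ_ignore_initial_segment[OF lim_const_over_n])
  then have "\<forall>\<^sub>F n in sequentially. t / real (n + 2) < d" by (rule order_tendstoD(2)) (use d in simp)
  then obtain N where N: "\<And>n. n \<ge> N \<Longrightarrow> t / real (n + 2) < d" by (auto simp: eventually_sequentially)
  have "norm ((z t - z (t - t / real (n + 2))) /\<^sub>R (t / real (n + 2)) - u) < e" if "n \<ge> N" for n
  proof -
    define h where "h = t / real (n + 2)"
    have h: "0 < h" "h \<le> t" "h < d" using t N[OF that] by (auto simp: h_def field_simps)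
    have "norm (z (t - h) - z t - ((t - h) - t) *\<^sub>R u) \<le> e / 2 * norm ((t - h) - t)"
      by (rule d(2)) (use h t in auto)
    then have le: "norm (z (t - h) - z t + h *\<^sub>R u) \<le> e / 2 * h" using h by simp
    have "(z t - z (t - h)) /\<^sub>R h - u = (- 1 / h) *\<^sub>R (z (t - h) - z t + h *\<^sub>R u)"
      using h by (simp add: algebra_simps divide_inverse)
    then have "norm ((z t - z (t - h)) /\<^sub>R h - u) = norm (z (t - h) - z t + h *\<^sub>R u) / h"
      using h by simp
    also have "\<dots> \<le> e / 2" using le h by (simp add: divide_le_eq)
    finally show ?thesis using e by (simp add: h_def)
  qed
  then show "\<exists>N. \<forall>n\<ge>N. norm ((z t - z (t - t / real (n + 2))) /\<^sub>R (t / real (n + 2)) - u) < e" by blast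
qed

text \<open>A formulation of the sweeping process with forcing primitive \<open>G\<close> that contains no derivatives
  and therefore passes to pointwise limits.\<close>

definition integrated_sweeping ::
    "real \<Rightarrow> real \<Rightarrow> (real \<Rightarrow> 'a::real_inner set) \<Rightarrow> (real \<Rightarrow> real) \<Rightarrow> (real \<Rightarrow> 'a) \<Rightarrow> (real \<Rightarrow> 'a) \<Rightarrow> bool" where
  "integrated_sweeping T r C V G x \<longleftrightarrow>
    (\<forall>t\<in>{0..T}. x t \<in> C t) \<and>
    (\<forall>s t. 0 \<le> s \<longrightarrow> s \<le> t \<longrightarrow> t \<le> T \<longrightarrow> norm (x t - x s - (G t - G s)) \<le> V t - V s) \<and>
    (\<forall>s t y. 0 \<le> s \<longrightarrow> s \<le> t \<longrightarrow> t \<le> T \<longrightarrow> V t - V s < r \<longrightarrow> y \<in> C t \<longrightarrow>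
      (x s - x t + (G t - G s)) \<bullet> (y - x t) \<le> slack r (V t - V s) (norm (y - x t)))"

lemma integrated_sweeping_LIMSEQ:
  assumes isw: "\<And>n::nat. integrated_sweeping T r C V (Gn n) (xn n)" and r: "r > 0"
    and G: "\<And>t. t \<in> {0..T} \<Longrightarrow> (\<lambda>n. Gn n t) \<longlonglongrightarrow> G t"
    and x: "\<And>t. t \<in> {0..T} \<Longrightarrow> (\<lambda>n. xn n t) \<longlonglongrightarrow> x t"
    and C: "\<And>t. t \<in> {0..T} \<Longrightarrow> closed (C t)"
  shows "integrated_sweeping T r C V G x"
  unfolding integrated_sweeping_def
proof (intro conjI ballI allI impI)
  fix t assume t: "t \<in> {0..T}"
  show "x t \<in> C t"
    by (rule closed_sequentially[OF C[OF t] _ x[OF t]]) (use isw t in \<open>auto simp: integrated_sweeping_def\<close>)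
next
  fix s t assume st: "0 \<le> s" "s \<le> t" "t \<le> T"
  then have mem: "s \<in> {0..T}" "t \<in> {0..T}" by auto
  show "norm (x t - x s - (G t - G s)) \<le> V t - V s"
  proof (rule LIMSEQ_le_const2)
    show "(\<lambda>n. norm (xn n t - xn n s - (Gn n t - Gn n s))) \<longlonglongrightarrow> norm (x t - x s - (G t - G s))"
      by (intro tendsto_intros x G mem)
  qed (use isw st in \<open>auto simp: integrated_sweeping_def\<close>)
next
  fix s t y assume st: "0 \<le> s" "s \<le> t" "t \<le> T" and V: "V t - V s < r" and y: "y \<in> C t"
  then have mem: "s \<in> {0..T}" "t \<in> {0..T}" by auto
  show "(x s - x t + (G t - G s)) \<bullet> (y - x t) \<le> slack r (V t - V s) (norm (y - x t))"
  proof (rule LIMSEQ_le)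
    show "(\<lambda>n. (xn n s - xn n t + (Gn n t - Gn n s)) \<bullet> (y - xn n t)) \<longlonglongrightarrow> (x s - x t + (G t - G s)) \<bullet> (y - x t)"
      by (intro tendsto_intros x G mem)
    show "(\<lambda>n. slack r (V t - V s) (norm (y - xn n t))) \<longlonglongrightarrow> slack r (V t - V s) (norm (y - x t))"
      unfolding slack_def using r by (intro tendsto_intros x mem) auto
  qed (use isw st V y in \<open>auto simp: integrated_sweeping_def\<close>)
qed

lemma integral_nonneg_mono:
  fixes \<phi> :: "real \<Rightarrow> real"
  assumes \<phi>: "integrable (lebesgue_on {0..T}) \<phi>" "\<And>t. t \<in> {0..T} \<Longrightarrow> 0 \<le> \<phi> t" and st: "0 \<le> s" "s \<le> t" "t \<le> T"
  shows "0 \<le> integral {s..t} \<phi>"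
proof -
  have "integrable (lebesgue_on {s..t}) \<phi>" by (rule integrable_lebesgue_on_subinterval[OF \<phi>(1)]) (use st in auto)
  then show ?thesis
    by (intro Henstock_Kurzweil_Integration.integral_nonneg integrable_on_lebesgue_on) (use \<phi>(2) st in auto)
qed

lemma continuous_on_integral:
  fixes \<phi> :: "real \<Rightarrow> real"
  assumes "integrable (lebesgue_on {0..T}) \<phi>"
  shows "continuous_on {0..T} (\<lambda>t. integral {0..t} \<phi>)"
  using assms by (intro indefinite_integral_continuous_1 integrable_on_lebesgue_on) auto

lemma integral_mono_AE_on:
  fixes \<phi> \<psi> :: "real \<Rightarrow> real"
  assumes i: "integrable (lebesgue_on {0..T}) \<phi>" "integrable (lebesgue_on {0..T}) \<psi>"
    and ae: "AE t in lebesgue_on {0..T}. \<phi> t \<le> \<psi> t" and st: "0 \<le> s" "s \<le> t" "t \<le> T"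
  shows "integral {s..t} \<phi> \<le> integral {s..t} \<psi>"
proof -
  have sub: "{s..t} \<subseteq> {0..T}" using st by auto
  note i' = i[THEN integrable_lebesgue_on_subinterval, OF sub]
  have "AE x in lebesgue_on {s..t}. \<phi> x \<le> \<psi> x" by (rule AE_lebesgue_on_subset[OF ae sub]) auto
  from integral_mono_AE[OF i' this] show ?thesis by (simp add: lebesgue_on_interval_integral i')
qed

lemma norm_primitive_diff_le:
  fixes F :: "real \<Rightarrow> 'a::{real_inner,complete_space}"
  assumes F: "strongly_integrable (lebesgue_on {0..T}) F" and m: "integrable (lebesgue_on {0..T}) m"
    and Fm: "AE t in lebesgue_on {0..T}. norm (F t) \<le> m t" and st: "0 \<le> s" "s \<le> t" "t \<le> T"
  shows "norm (strong_integral (lebesgue_on {0..t}) F - strong_integral (lebesgue_on {0..s}) F) \<le> integral {s..t} m"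
  by (rule order_trans[OF norm_strong_integral_diff_le[OF F st]
        integral_mono_AE_on[OF strongly_integrable_norm[OF complete_measure_interval F] m Fm st]])

lemma strong_integral_singleton [simp]:
  fixes F :: "real \<Rightarrow> 'a::{real_inner,complete_space}"
  shows "strong_integral (lebesgue_on {a::real}) F = 0"
proof (cases "strongly_integrable (lebesgue_on {a}) F")
  case True
  have "AE x in lebesgue_on {a}. norm (F x) = 0"
  proof -
    have "{a} \<in> null_sets lebesgue" by (simp add: null_sets_def)
    then have "AE x in lebesgue. x \<notin> {a}" by (rule AE_not_in)
    then have "AE x in lebesgue. x \<in> {a} \<longrightarrow> norm (F x) = 0" by eventually_elim simp
    then show ?thesis by (subst AE_restrict_space_iff) auto
  qed
  then have "(LINT x|lebesgue_on {a}. norm (F x)) = 0" by (rule integral_eq_zero_AE)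
  then show ?thesis using norm_strong_integral_le[OF complete_measure_lebesgue_on True] by simp
qed (simp add: strong_integral_def)

lemma integral_add_on:
  fixes \<phi> \<psi> :: "real \<Rightarrow> real"
  assumes i: "integrable (lebesgue_on {0..T}) \<phi>" "integrable (lebesgue_on {0..T}) \<psi>" and st: "0 \<le> s" "t \<le> T"
  shows "integral {s..t} (\<lambda>x. \<phi> x + \<psi> x) = integral {s..t} \<phi> + integral {s..t} \<psi>"
proof -
  have sub: "{s..t} \<subseteq> {0..T}" using st by auto
  note i' = i[THEN integrable_lebesgue_on_subinterval, OF sub]
  show ?thesis using i' by (intro Henstock_Kurzweil_Integration.integral_add integrable_on_lebesgue_on) auto
qed

text \<open>\<open>r\<close> is a finite radius not exceeding \<open>\<rho>\<close>, which itself
  may be infinite. The Hausdorff bound is kept in integrated form, once for each direction of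
  time.\<close>

locale moving_set =
  fixes T r :: real and \<rho> :: ereal and C :: "real \<Rightarrow> 'a::{real_inner,complete_space} set" and w :: "real \<Rightarrow> real"
  assumes T: "T > 0" and r: "r > 0" "ereal r \<le> \<rho>"
    and C: "\<And>t. t \<in> {0..T} \<Longrightarrow> C t \<noteq> {}" "\<And>t. t \<in> {0..T} \<Longrightarrow> uniformly_prox_regular \<rho> (C t)"
    and w: "integrable (lebesgue_on {0..T}) w" "\<And>t. t \<in> {0..T} \<Longrightarrow> 0 \<le> w t"
    and C_w: "\<And>s t x. 0 \<le> s \<Longrightarrow> s \<le> t \<Longrightarrow> t \<le> T \<Longrightarrow> x \<in> C s \<Longrightarrow> infdist x (C t) \<le> integral {s..t} w"
      "\<And>s t x. 0 \<le> s \<Longrightarrow> s \<le> t \<Longrightarrow> t \<le> T \<Longrightarrow> x \<in> C t \<Longrightarrow> infdist x (C s) \<le> integral {s..t} w"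
begin

lemma closed_C: "t \<in> {0..T} \<Longrightarrow> closed (C t)"
  using C(2) by (simp add: uniformly_prox_regular_def)

text \<open>The primitive of \<open>w + m\<close> contains a bound \<open>m\<close> of the forcing
  rather than its norm. One and the same bound on the speed therefore serves all iterates of the
  later Picard scheme, which is what lets their inequalities pass to the limit.\<close>

lemma integrated_sweeping_exists:
  assumes F: "strongly_integrable (lebesgue_on {0..T}) F"
    and m: "integrable (lebesgue_on {0..T}) m" "\<And>t. t \<in> {0..T} \<Longrightarrow> 0 \<le> m t"
    and Fm: "AE t in lebesgue_on {0..T}. norm (F t) \<le> m t" and x0: "x0 \<in> C 0"
  shows "\<exists>x. x 0 = x0 \<and>
    integrated_sweeping T r C (\<lambda>t. integral {0..t} (\<lambda>s. w s + m s)) (\<lambda>t. strong_integral (lebesgue_on {0..t}) F) x"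
proof -
  define G where "G t = strong_integral (lebesgue_on {0..t}) F" for t
  define V where "V t = integral {0..t} (\<lambda>s. w s + m s)" for t
  define K where "K t = (\<lambda>x. x - G t) ` C t" for t
  have i: "integrable (lebesgue_on {0..T}) (\<lambda>s. w s + m s)" using w m by simp
  have Vd: "V t - V s = integral {s..t} w + integral {s..t} m" if st: "0 \<le> s" "s \<le> t" "t \<le> T" for s t
    unfolding V_def integral_combine_diff[OF i st] using st by (intro integral_add_on[OF w(1) m(1)]) auto
  have Gd: "norm (G t - G s) \<le> integral {s..t} m" if "0 \<le> s" "s \<le> t" "t \<le> T" for s t
    unfolding G_def by (rule norm_primitive_diff_le[OF F m(1) Fm that])
  have G0: "G 0 = 0" by (simp add: G_def)
  have Kdist: "infdist (x - G s) (K t) \<le> infdist x (C t) + norm (G t - G s)" if "t \<in> {0..T}" for x s t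
  proof -
    have "infdist (x - G s) (K t) = infdist (x - G s + G t) (C t)"
      using C(1)[OF that] by (simp add: K_def infdist_notempty image_image dist_norm algebra_simps)
    also have "\<dots> \<le> infdist x (C t) + dist (x - G s + G t) x" by (rule infdist_triangle)
    finally show ?thesis by (simp add: dist_norm)
  qed
  interpret catching_up T r K V x0
  proof
    show "proximable r (K t)" if "t \<in> {0..T}" for t
      unfolding K_def by (rule proximable_translation[OF C(2)[OF that] C(1)[OF that] r])
    show mono: "V s \<le> V t" if "0 \<le> s" "s \<le> t" "t \<le> T" for s t
      using Vd[OF that] integral_nonneg_mono[OF w that] integral_nonneg_mono[OF m that] by simp
    show "continuous_on {0..T} V" unfolding V_def by (rule continuous_on_integral[OF i])
    show "x0 \<in> K 0" using x0 by (simp add: K_def G0)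
    show "infdist x (K t) \<le> \<bar>V t - V s\<bar>" if s: "s \<in> {0..T}" and t: "t \<in> {0..T}" and "x \<in> K s" for s t x
    proof -
      obtain y where y: "y \<in> C s" "x = y - G s" using \<open>x \<in> K s\<close> by (auto simp: K_def)
      show ?thesis
      proof (cases "s \<le> t")
        case True
        then show ?thesis
          using Kdist[OF t, of y s] C_w(1)[of s t y] Gd[of s t] Vd[of s t] s t y by auto
      next
        case False
        then show ?thesis
          using Kdist[OF t, of y s] C_w(2)[of t s y] Gd[of t s] Vd[of t s] s t y by (auto simp: norm_minus_commute)
      qed
    qed
  qed (use T r in auto)
  obtain z where z: "z 0 = x0" "\<And>t. t \<in> {0..T} \<Longrightarrow> z t \<in> K t"
    "\<And>s t. 0 \<le> s \<Longrightarrow> s \<le> t \<Longrightarrow> t \<le> T \<Longrightarrow> norm (z s - z t) \<le> V t - V s"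
    "\<And>s t y. 0 \<le> s \<Longrightarrow> s \<le> t \<Longrightarrow> t \<le> T \<Longrightarrow> V t - V s < r \<Longrightarrow> y \<in> K t \<Longrightarrow>
      (z s - z t) \<bullet> (y - z t) \<le> slack r (V t - V s) (norm (y - z t))"
    using sweeping_limit by blast
  have "integrated_sweeping T r C V G (\<lambda>t. z t + G t)"
    unfolding integrated_sweeping_def
  proof (intro conjI ballI allI impI)
    show "z t + G t \<in> C t" if "t \<in> {0..T}" for t using z(2)[OF that] by (auto simp: K_def)
    show "norm (z t + G t - (z s + G s) - (G t - G s)) \<le> V t - V s" if "0 \<le> s" "s \<le> t" "t \<le> T" for s t
      using z(3)[OF that] by (simp add: norm_minus_commute)
    show "(z s + G s - (z t + G t) + (G t - G s)) \<bullet> (y - (z t + G t)) \<le> slack r (V t - V s) (norm (y - (z t + G t)))"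
      if "0 \<le> s" "s \<le> t" "t \<le> T" "V t - V s < r" "y \<in> C t" for s t y
    proof -
      have "y - G t \<in> K t" using that by (simp add: K_def)
      from z(4)[OF that(1-4) this] show ?thesis by (simp add: algebra_simps)
    qed
  qed
  then show ?thesis using z(1) G0 unfolding G_def V_def by (intro exI[of _ "\<lambda>t. z t + G t"]) (simp add: G_def)
qed

end

text \<open>One \<open>\<phi>\<close> bounds the increment of \<open>x\<close> minus the primitive
  of the forcing, the other that of the primitive.\<close>

lemma integrated_sweeping_lipschitz:
  fixes x :: "real \<Rightarrow> 'a::{real_inner,complete_space}"
  assumes isw: "integrated_sweeping T r C (\<lambda>t. integral {0..t} \<phi>) (\<lambda>t. strong_integral (lebesgue_on {0..t}) F) x"
    and \<phi>: "integrable (lebesgue_on {0..T}) \<phi>"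
    and F: "strongly_integrable (lebesgue_on {0..T}) F" "AE t in lebesgue_on {0..T}. norm (F t) \<le> \<phi> t"
    and st: "0 \<le> s" "s \<le> t" "t \<le> T"
  shows "norm (x t - x s) \<le> integral {s..t} (\<lambda>s. 2 * \<phi> s)"
proof -
  let ?G = "\<lambda>t. strong_integral (lebesgue_on {0..t}) F"
  have "norm (x t - x s) \<le> norm (x t - x s - (?G t - ?G s)) + norm (?G t - ?G s)"
    by (metis norm_triangle_sub add.commute)
  also have "\<dots> \<le> integral {s..t} \<phi> + integral {s..t} \<phi>"
  proof (rule add_mono)
    have "norm (x t - x s - (?G t - ?G s)) \<le> integral {0..t} \<phi> - integral {0..s} \<phi>"
      using isw st unfolding integrated_sweeping_def by blast
    then show "norm (x t - x s - (?G t - ?G s)) \<le> integral {s..t} \<phi>"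
      using integral_combine_diff[OF \<phi> st] by simp
  qed (rule norm_primitive_diff_le[OF F(1) \<phi> F(2) st])
  finally show ?thesis by simp
qed

text \<open>The normal vector is bounded explicitly because the hypomonotonicity constant is
  proportional to its norm; an integrable bound is what the comparison of two solutions
  requires.\<close>

definition inclusion_at ::
    "real \<Rightarrow> (real \<Rightarrow> 'a::real_inner set) \<Rightarrow> (real \<Rightarrow> 'a) \<Rightarrow> real \<Rightarrow> (real \<Rightarrow> 'a) \<Rightarrow> real \<Rightarrow> bool" where
  "inclusion_at T C F c x t \<longleftrightarrow> (\<exists>u. (x has_vector_derivative u) (at t within {0..T}) \<and>
    F t - u \<in> prox_normal_cone (C t) (x t) \<and> norm (F t - u) \<le> c)"

lemma inclusion_at_mono: "inclusion_at T C F c x t \<Longrightarrow> c \<le> c' \<Longrightarrow> inclusion_at T C F c' x t"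
  unfolding inclusion_at_def by (meson order_trans)

text \<open>At a time where \<open>z\<close>, the primitive of \<open>F\<close> and \<open>V\<close>
  are all differentiable, the slack inequality between \<open>t - h n\<close> and \<open>t\<close>
  is divided by \<open>h n\<close>. The increments of \<open>V\<close> vanish in the limit and the
  cone inequality for \<open>- u\<close> remains, with constant
  \<open>\<phi> t / (2 * r)\<close>.\<close>

lemma integrated_sweeping_imp_inclusion:
  fixes x :: "real \<Rightarrow> 'a::{real_inner,complete_space}"
  assumes T: "T > 0" and r: "r > 0"
    and isw: "integrated_sweeping T r C (\<lambda>t. integral {0..t} \<phi>) (\<lambda>t. strong_integral (lebesgue_on {0..t}) F) x"
    and \<phi>: "integrable (lebesgue_on {0..T}) \<phi>" "\<And>t. t \<in> {0..T} \<Longrightarrow> 0 \<le> \<phi> t"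
    and F: "strongly_integrable (lebesgue_on {0..T}) F"
  shows "AE t in lebesgue_on {0..T}. inclusion_at T C F (\<phi> t) x t"
proof -
  define G where "G t = strong_integral (lebesgue_on {0..t}) F" for t
  define V where "V t = integral {0..t} \<phi>" for t
  define z where "z t = x t - G t" for t
  have isw': "\<And>t. t \<in> {0..T} \<Longrightarrow> x t \<in> C t"
    "\<And>s t. 0 \<le> s \<Longrightarrow> s \<le> t \<Longrightarrow> t \<le> T \<Longrightarrow> norm (z t - z s) \<le> V t - V s"
    "\<And>s t y. 0 \<le> s \<Longrightarrow> s \<le> t \<Longrightarrow> t \<le> T \<Longrightarrow> V t - V s < r \<Longrightarrow> y \<in> C t \<Longrightarrow>
      (z s - z t) \<bullet> (y - x t) \<le> slack r (V t - V s) (norm (y - x t))"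
    using isw unfolding integrated_sweeping_def z_def G_def[symmetric] V_def[symmetric] by (auto simp: algebra_simps)
  have "norm (z t - z s) \<le> integral {s..t} \<phi>" if "0 \<le> s" "s \<le> t" "t \<le> T" for s t
    using isw'(2)[OF that] integral_combine_diff[OF \<phi>(1) that] by (simp add: V_def)
  then have dz: "AE t in lebesgue_on {0..T}. \<exists>u. (z has_vector_derivative u) (at t within {0..T})"
    by (rule AE_has_vector_derivative[OF T \<phi>(1)])
  have "AE t in lebesgue. t \<noteq> (0::real)" by (rule AE_completion[OF AE_lborel_singleton])
  \<comment> \<open>At \<open>t = 0\<close> there are no quotients from the left.\<close>
  then have t0: "AE t in lebesgue_on {0..T}. t \<noteq> 0" by (subst AE_restrict_space_iff) auto
  show ?thesis
    using dz AE_has_vector_derivative_strong_integral[OF F] AE_has_real_derivative_integral[OF \<phi>(1)] t0 AE_space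
  proof eventually_elim
    fix t
    assume "\<exists>u. (z has_vector_derivative u) (at t within {0..T})"
      and dG: "((\<lambda>u. strong_integral (lebesgue_on {0..u}) F) has_vector_derivative F t) (at t within {0..T})"
      and dV: "((\<lambda>u. integral {0..u} \<phi>) has_real_derivative \<phi> t) (at t within {0..T})"
      and "t \<noteq> 0" "t \<in> space (lebesgue_on {0..T})"
    then obtain u where u: "(z has_vector_derivative u) (at t within {0..T})" and t: "0 < t" "t \<le> T" by auto
    have "((\<lambda>s. z s + G s) has_vector_derivative u + F t) (at t within {0..T})"
      using has_vector_derivative_add[OF u dG] by (simp add: G_def)
    then have dx: "(x has_vector_derivative u + F t) (at t within {0..T})" by (simp add: z_def)
    define h where "h n = t / real (n + 2)" for n :: nat
    have h: "0 < h n" "h n \<le> t" for n using t by (auto simp: h_def field_simps)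
    have h0: "h \<longlonglongrightarrow> 0" unfolding h_def by (rule LIMSEQ_ignore_initial_segment[OF lim_const_over_n])
    have lz: "(\<lambda>n. (z t - z (t - h n)) /\<^sub>R h n) \<longlonglongrightarrow> u"
      unfolding h_def by (rule left_difference_quotient_tendsto[OF u t])
    have "(V has_vector_derivative \<phi> t) (at t within {0..T})"
      using dV unfolding V_def has_real_derivative_iff_has_vector_derivative .
    from left_difference_quotient_tendsto[OF this t]
    have lV: "(\<lambda>n. (V t - V (t - h n)) / h n) \<longlonglongrightarrow> \<phi> t" by (simp add: h_def divide_inverse_commute)
    have "(\<lambda>n. h n * ((V t - V (t - h n)) / h n)) \<longlonglongrightarrow> 0 * \<phi> t" by (intro tendsto_mult h0 lV)
    moreover have "h n * ((V t - V (t - h n)) / h n) = V t - V (t - h n)" for n using h(1)[of n] by simp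
    ultimately have V0: "(\<lambda>n. V t - V (t - h n)) \<longlonglongrightarrow> 0" by simp
    have nu: "norm u \<le> \<phi> t"
    proof (rule LIMSEQ_le[OF tendsto_norm[OF lz] lV])
      show "\<exists>N. \<forall>n\<ge>N. norm ((z t - z (t - h n)) /\<^sub>R h n) \<le> (V t - V (t - h n)) / h n"
      proof (intro exI[of _ 0] allI impI)
        fix n
        have "norm (z t - z (t - h n)) / h n \<le> (V t - V (t - h n)) / h n"
          by (intro divide_right_mono isw'(2)) (use h[of n] t in auto)
        then show "norm ((z t - z (t - h n)) /\<^sub>R h n) \<le> (V t - V (t - h n)) / h n"
          using h(1)[of n] by (simp add: divide_inverse_commute)
      qed
    qed
    have "(- u) \<bullet> (y - x t) \<le> \<phi> t / (2 * r) * (norm (y - x t))\<^sup>2" if y: "y \<in> C t" for y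
    proof -
      define c where "c = norm (y - x t)"
      \<comment> \<open>The right side keeps the shape of \<open>slack\<close> divided by
        \<open>h n\<close>, with the increments of \<open>V\<close> set to 0 and their quotient to
        \<open>\<phi> t\<close>.\<close>
      have "(- u) \<bullet> (y - x t) \<le> \<phi> t * ((c + 2 * 0)\<^sup>2 / (2 * r) + 2 * 0)"
      proof (rule tendsto_le[OF trivial_limit_sequentially])
        show "(\<lambda>n. - ((z t - z (t - h n)) /\<^sub>R h n) \<bullet> (y - x t)) \<longlonglongrightarrow> (- u) \<bullet> (y - x t)"
          by (intro tendsto_intros lz)
        show "(\<lambda>n. (V t - V (t - h n)) / h n * ((c + 2 * (V t - V (t - h n)))\<^sup>2 / (2 * r) + 2 * (V t - V (t - h n))))
          \<longlonglongrightarrow> \<phi> t * ((c + 2 * 0)\<^sup>2 / (2 * r) + 2 * 0)"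
          using r by (intro tendsto_mult tendsto_add tendsto_divide tendsto_power tendsto_const lV V0) auto
        show "\<forall>\<^sub>F n in sequentially. - ((z t - z (t - h n)) /\<^sub>R h n) \<bullet> (y - x t)
          \<le> (V t - V (t - h n)) / h n * ((c + 2 * (V t - V (t - h n)))\<^sup>2 / (2 * r) + 2 * (V t - V (t - h n)))"
          using order_tendstoD(2)[OF V0 r]
        proof eventually_elim
          fix n assume "V t - V (t - h n) < r"
          then have "(z (t - h n) - z t) \<bullet> (y - x t) \<le> slack r (V t - V (t - h n)) c"
            unfolding c_def by (intro isw'(3)) (use h[of n] t y in auto)
          then have "inverse (h n) * ((z (t - h n) - z t) \<bullet> (y - x t)) \<le> inverse (h n) * slack r (V t - V (t - h n)) c"
            using h(1)[of n] by (intro mult_left_mono) auto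
          moreover have "inverse (h n) * ((z (t - h n) - z t) \<bullet> (y - x t)) = - ((z t - z (t - h n)) /\<^sub>R h n) \<bullet> (y - x t)"
            by (simp add: inner_diff_left algebra_simps)
          moreover have "inverse (h n) * slack r (V t - V (t - h n)) c
            = (V t - V (t - h n)) / h n * ((c + 2 * (V t - V (t - h n)))\<^sup>2 / (2 * r) + 2 * (V t - V (t - h n)))"
            by (simp only: slack_def divide_inverse[of _ "h n"] mult.assoc mult.left_commute[of "inverse (h n)"])
          ultimately show "- ((z t - z (t - h n)) /\<^sub>R h n) \<bullet> (y - x t)
            \<le> (V t - V (t - h n)) / h n * ((c + 2 * (V t - V (t - h n)))\<^sup>2 / (2 * r) + 2 * (V t - V (t - h n)))"
            by (simp only:)
        qed
      qed
      then show ?thesis by (simp add: c_def)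
    qed
    moreover have "0 \<le> \<phi> t / (2 * r)" using \<phi>(2)[of t] t r by simp
    ultimately have "- u \<in> prox_normal_cone (C t) (x t)"
      using isw'(1)[of t] t unfolding prox_normal_cone_def by auto
    then show "inclusion_at T C F (\<phi> t) x t"
      unfolding inclusion_at_def using dx nu by (intro exI[of _ "u + F t"]) simp
  qed
qed

section \<open>Comparison of solutions and a weighted Gronwall estimate\<close>

lemma has_vector_derivative_norm_power2:
  fixes d :: "real \<Rightarrow> 'a::real_inner"
  assumes "(d has_vector_derivative d') (at t within S)"
  shows "((\<lambda>t. (norm (d t))\<^sup>2) has_vector_derivative 2 * (d t \<bullet> d')) (at t within S)"
proof -
  have "((\<lambda>t. d t \<bullet> d t) has_derivative (\<lambda>h. d t \<bullet> (h *\<^sub>R d') + (h *\<^sub>R d') \<bullet> d t)) (at t within S)"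
    using assms unfolding has_vector_derivative_def by (intro has_derivative_inner)
  moreover have "(\<lambda>h. d t \<bullet> (h *\<^sub>R d') + (h *\<^sub>R d') \<bullet> d t) = (\<lambda>h. h *\<^sub>R (2 * (d t \<bullet> d')))"
    by (simp add: fun_eq_iff inner_commute)
  ultimately show ?thesis unfolding has_vector_derivative_def power2_norm_eq_inner by simp
qed

text \<open>Half the derivative of the squared distance is the inner product of
  \<open>x1 - x2\<close> with \<open>F1 - F2\<close> plus one term for each normal vector. Tested
  against the other curve, which lies in the same set, each of these terms is at most
  \<open>\<nu> t / (2 * r)\<close> times the squared distance.\<close>

lemma (in moving_set) sweeping_comparison:
  assumes \<phi>: "integrable (lebesgue_on {0..T}) \<phi>"
    and lip: "\<And>s t. 0 \<le> s \<Longrightarrow> s \<le> t \<Longrightarrow> t \<le> T \<Longrightarrow> norm (x1 t - x1 s) \<le> integral {s..t} \<phi>"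
      "\<And>s t. 0 \<le> s \<Longrightarrow> s \<le> t \<Longrightarrow> t \<le> T \<Longrightarrow> norm (x2 t - x2 s) \<le> integral {s..t} \<phi>"
    and init: "x1 0 = x2 0"
    and incl1: "AE t in lebesgue_on {0..T}. inclusion_at T C F1 (\<nu> t) x1 t"
    and incl2: "AE t in lebesgue_on {0..T}. inclusion_at T C F2 (\<nu> t) x2 t"
    and \<psi>: "integrable (lebesgue_on {0..T}) \<psi>"
      "AE t in lebesgue_on {0..T}. 2 * norm (F1 t - F2 t) * norm (x1 t - x2 t) + 2 * \<nu> t / r * (norm (x1 t - x2 t))\<^sup>2 \<le> \<psi> t"
    and t: "t \<in> {0..T}"
  shows "(norm (x1 t - x2 t))\<^sup>2 \<le> integral {0..t} \<psi>"
proof -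
  define d where "d t = x1 t - x2 t" for t
  \<comment> \<open>A bound of the distance, through which the squared distance inherits absolute
    continuity with density \<open>4 * B * \<phi>\<close>.\<close>
  define B where "B = 2 * integral {0..T} \<phi>"
  have dl: "norm (d t - d s) \<le> 2 * integral {s..t} \<phi>" if "0 \<le> s" "s \<le> t" "t \<le> T" for s t
  proof -
    have "d t - d s = (x1 t - x1 s) - (x2 t - x2 s)" by (simp add: d_def)
    then have "norm (d t - d s) \<le> norm (x1 t - x1 s) + norm (x2 t - x2 s)" by (metis norm_triangle_ineq4)
    then show ?thesis using lip[OF that] by simp
  qed
  have dB: "norm (d s) \<le> B" if s: "s \<in> {0..T}" for s
  proof -
    have "norm (d s - d 0) \<le> 2 * integral {0..s} \<phi>" by (rule dl) (use s in auto)
    also have "0 \<le> integral {s..T} \<phi>" using lip(1)[of s T] s order_trans[OF norm_ge_zero] by auto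
    then have "integral {0..s} \<phi> \<le> integral {0..T} \<phi>" using integral_combine_diff[OF \<phi>, of s T] s by auto
    finally show ?thesis using init by (simp add: B_def d_def)
  qed
  have "(norm (d t))\<^sup>2 - (norm (d 0))\<^sup>2 \<le> integral {0..t} \<psi>"
  proof (rule le_integral_of_derivative_le[OF T _ _ \<psi>(1) _ t])
    show "integrable (lebesgue_on {0..T}) (\<lambda>t. 4 * B * \<phi> t)" using \<phi> by simp
    show "\<bar>(norm (d t))\<^sup>2 - (norm (d s))\<^sup>2\<bar> \<le> integral {s..t} (\<lambda>t. 4 * B * \<phi> t)" if st: "0 \<le> s" "s \<le> t" "t \<le> T" for s t
    proof -
      have "\<bar>(norm (d t))\<^sup>2 - (norm (d s))\<^sup>2\<bar> = \<bar>norm (d t) - norm (d s)\<bar> * (norm (d t) + norm (d s))"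
        by (simp add: power2_eq_square square_diff_square_factored abs_mult)
      also have "\<dots> \<le> (2 * integral {s..t} \<phi>) * (B + B)"
      proof (rule mult_mono)
        show "\<bar>norm (d t) - norm (d s)\<bar> \<le> 2 * integral {s..t} \<phi>"
          using order_trans[OF norm_triangle_ineq3 dl[OF st]] .
        then show "0 \<le> 2 * integral {s..t} \<phi>" by (rule order_trans[OF abs_ge_zero])
      qed (use dB[of s] dB[of t] st in auto)
      finally show ?thesis by (simp add: algebra_simps)
    qed
    show "AE t in lebesgue_on {0..T}. \<forall>D. ((\<lambda>t. (norm (d t))\<^sup>2) has_vector_derivative D) (at t within {0..T}) \<longrightarrow> D \<le> \<psi> t"
      using incl1 incl2 \<psi>(2) AE_space
    proof eventually_elim
      fix t
      assume "inclusion_at T C F1 (\<nu> t) x1 t"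
        and "inclusion_at T C F2 (\<nu> t) x2 t"
        and \<psi>t: "2 * norm (F1 t - F2 t) * norm (x1 t - x2 t) + 2 * \<nu> t / r * (norm (x1 t - x2 t))\<^sup>2 \<le> \<psi> t"
        and "t \<in> space (lebesgue_on {0..T})"
      then obtain u1 u2 where u1: "(x1 has_vector_derivative u1) (at t within {0..T})" "F1 t - u1 \<in> prox_normal_cone (C t) (x1 t)" "norm (F1 t - u1) \<le> \<nu> t"
        and u2: "(x2 has_vector_derivative u2) (at t within {0..T})" "F2 t - u2 \<in> prox_normal_cone (C t) (x2 t)" "norm (F2 t - u2) \<le> \<nu> t"
        and t: "t \<in> {0..T}" unfolding inclusion_at_def by auto
      have mem: "x1 t \<in> C t" "x2 t \<in> C t"
        using u1(2) u2(2) by (auto simp: prox_normal_cone_def split: if_splits)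
      define n1 where "n1 = F1 t - u1"
      define n2 where "n2 = F2 t - u2"
      have "n1 \<bullet> (x2 t - x1 t) \<le> norm n1 / (2 * r) * (norm (x2 t - x1 t))\<^sup>2"
        unfolding n1_def by (rule prox_normal_cone_inner_le[OF C(2)[OF t] r mem(1) u1(2) mem(2)])
      also have "\<dots> \<le> \<nu> t / (2 * r) * (norm (d t))\<^sup>2"
        using u1(3) r by (auto simp: n1_def d_def norm_minus_commute intro!: mult_right_mono divide_right_mono)
      finally have 1: "n1 \<bullet> (x2 t - x1 t) \<le> \<nu> t / (2 * r) * (norm (d t))\<^sup>2" .
      have "n2 \<bullet> (x1 t - x2 t) \<le> norm n2 / (2 * r) * (norm (x1 t - x2 t))\<^sup>2"
        unfolding n2_def by (rule prox_normal_cone_inner_le[OF C(2)[OF t] r mem(2) u2(2) mem(1)])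
      also have "\<dots> \<le> \<nu> t / (2 * r) * (norm (d t))\<^sup>2"
        using u2(3) r by (auto simp: n2_def d_def intro!: mult_right_mono divide_right_mono)
      finally have 2: "n2 \<bullet> (x1 t - x2 t) \<le> \<nu> t / (2 * r) * (norm (d t))\<^sup>2" .
      have 3: "d t \<bullet> (F1 t - F2 t) \<le> norm (F1 t - F2 t) * norm (d t)"
        using norm_cauchy_schwarz[of "d t" "F1 t - F2 t"] by (simp add: mult.commute)
      have "d t \<bullet> (u1 - u2) = d t \<bullet> (F1 t - F2 t) + n1 \<bullet> (x2 t - x1 t) + n2 \<bullet> (x1 t - x2 t)"
        by (simp add: n1_def n2_def d_def inner_diff_left inner_diff_right inner_commute)
      then have "2 * (d t \<bullet> (u1 - u2)) \<le> 2 * norm (F1 t - F2 t) * norm (d t) + 2 * (\<nu> t / (2 * r) * (norm (d t))\<^sup>2) + 2 * (\<nu> t / (2 * r) * (norm (d t))\<^sup>2)"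
        using 1 2 3 by linarith
      also have "\<dots> \<le> \<psi> t" using \<psi>t r by (simp add: d_def field_simps)
      finally have le: "2 * (d t \<bullet> (u1 - u2)) \<le> \<psi> t" .
      have "(d has_vector_derivative u1 - u2) (at t within {0..T})"
        unfolding d_def by (rule has_vector_derivative_diff[OF u1(1) u2(1)])
      note der = has_vector_derivative_norm_power2[OF this]
      show "\<forall>D. ((\<lambda>t. (norm (d t))\<^sup>2) has_vector_derivative D) (at t within {0..T}) \<longrightarrow> D \<le> \<psi> t"
      proof (intro allI impI)
        fix D assume "((\<lambda>t. (norm (d t))\<^sup>2) has_vector_derivative D) (at t within {0..T})"
        then have "D = 2 * (d t \<bullet> (u1 - u2))"
          using vector_derivative_unique_within_closed_interval[of 0 T t] T t der by simp
        then show "D \<le> \<psi> t" using le by simp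
      qed
    qed
  qed
  then show ?thesis using init by (simp add: d_def)
qed

lemma integrable_continuous_mult:
  fixes e :: "real \<Rightarrow> real"
  assumes l: "integrable (lebesgue_on {0..T}) l" and e: "continuous_on {0..T} e"
  shows "integrable (lebesgue_on {0..T}) (\<lambda>t. l t * e t)"
proof -
  obtain B where B: "\<And>t. t \<in> {0..T} \<Longrightarrow> \<bar>e t\<bar> \<le> B"
    using compact_imp_bounded[OF compact_continuous_image[OF e]] unfolding bounded_iff by (auto simp del: atLeastAtMost_iff)
  show ?thesis
  proof (rule Bochner_Integration.integrable_bound[of _ "\<lambda>t. B * l t"])
    show "(\<lambda>t. l t * e t) \<in> borel_measurable (lebesgue_on {0..T})"
      by (intro borel_measurable_times borel_measurable_integrable[OF l]
          continuous_imp_measurable_on_sets_lebesgue[OF e]) simp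
    have "norm (l t * e t) \<le> norm (B * l t)" if "t \<in> {0..T}" for t
      using mult_left_mono[OF order_trans[OF B[OF that] abs_ge_self], of "\<bar>l t\<bar>"] by (simp add: abs_mult mult.commute)
    then show "AE t in lebesgue_on {0..T}. norm (l t * e t) \<le> norm (B * l t)" by (intro AE_I2) simp
  qed (use l in simp)
qed

text \<open>The integrand is the derivative of \<open>exp (c * A t) / c\<close>, but only almost
  everywhere, since \<open>A\<close> is merely absolutely continuous.\<close>

lemma integral_exp_primitive_le:
  fixes l :: "real \<Rightarrow> real"
  assumes T: "T > 0" and l: "integrable (lebesgue_on {0..T}) l" "\<And>t. t \<in> {0..T} \<Longrightarrow> 0 \<le> l t" and c: "c > 0"
    and t: "t \<in> {0..T}"
  shows "integral {0..t} (\<lambda>s. l s * exp (c * integral {0..s} l)) \<le> (exp (c * integral {0..t} l) - 1) / c"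
proof -
  define A where "A s = integral {0..s} l" for s
  have A: "continuous_on {0..T} A" unfolding A_def by (rule continuous_on_integral[OF l(1)])
  have i: "integrable (lebesgue_on {0..T}) (\<lambda>s. l s * exp (c * A s))"
    by (rule integrable_continuous_mult[OF l(1)]) (intro continuous_intros A)
  have dA: "A t - A s = integral {s..t} l" if "0 \<le> s" "s \<le> t" "t \<le> T" for s t
    unfolding A_def by (rule integral_combine_diff[OF l(1) that])
  have mono: "A s \<le> A t" if "0 \<le> s" "s \<le> t" "t \<le> T" for s t
    using dA[OF that] integral_nonneg_mono[OF l that] by simp
  \<comment> \<open>The minus signs turn the required lower bound for the growth of the exponential
    into the upper bound that \<open>le_integral_of_derivative_le\<close> provides.\<close>
  have "- exp (c * A t) / c - (- exp (c * A 0) / c) \<le> integral {0..t} (\<lambda>s. - (l s * exp (c * A s)))"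
  proof (rule le_integral_of_derivative_le[OF T _ _ _ _ t])
    show "integrable (lebesgue_on {0..T}) (\<lambda>s. exp (c * A T) * l s)" using l by simp
    show "integrable (lebesgue_on {0..T}) (\<lambda>s. - (l s * exp (c * A s)))" using i by simp
    show "\<bar>- exp (c * A t) / c - - exp (c * A s) / c\<bar> \<le> integral {s..t} (\<lambda>s. exp (c * A T) * l s)"
      if st: "0 \<le> s" "s \<le> t" "t \<le> T" for s t
    proof -
      have "1 + (c * A s - c * A t) \<le> exp (c * A s - c * A t)" by (rule exp_ge_add_one_self)
      then have "exp (c * A t) * (1 + (c * A s - c * A t)) \<le> exp (c * A t) * exp (c * A s - c * A t)"
        by (intro mult_left_mono) auto
      also have "\<dots> = exp (c * A s)" by (simp flip: exp_add)
      finally have "exp (c * A t) - exp (c * A s) \<le> exp (c * A t) * (c * (A t - A s))" by (simp add: algebra_simps)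
      also have "\<dots> \<le> exp (c * A T) * (c * (A t - A s))"
        using mono[of t T] mono[OF st] c st by (intro mult_right_mono) auto
      finally have "(exp (c * A t) - exp (c * A s)) / c \<le> exp (c * A T) * (A t - A s)"
        using c by (simp add: field_simps)
      moreover have "0 \<le> (exp (c * A t) - exp (c * A s)) / c" using mono[OF st] c by simp
      ultimately show ?thesis using dA[OF st] by (simp add: diff_divide_distrib)
    qed
    show "AE t in lebesgue_on {0..T}. \<forall>D. ((\<lambda>t. - exp (c * A t) / c) has_vector_derivative D) (at t within {0..T}) \<longrightarrow> D \<le> - (l t * exp (c * A t))"
      using AE_has_real_derivative_integral[OF l(1)] AE_space
    proof eventually_elim
      fix t assume "((\<lambda>u. integral {0..u} l) has_real_derivative l t) (at t within {0..T})"
        and t: "t \<in> space (lebesgue_on {0..T})"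
      then have d: "(A has_real_derivative l t) (at t within {0..T})" by (simp add: A_def[abs_def])
      have "((\<lambda>t. - exp (c * A t) / c) has_real_derivative - (l t * exp (c * A t))) (at t within {0..T})"
      proof -
        have "((\<lambda>t. exp (c * A t)) has_real_derivative exp (c * A t) * (c * l t)) (at t within {0..T})"
          by (rule derivative_eq_intros d refl)+ simp
        from DERIV_cdivide[OF DERIV_minus[OF this], of c] show ?thesis using c by (simp add: mult.commute)
      qed
      then have der: "((\<lambda>t. - exp (c * A t) / c) has_vector_derivative - (l t * exp (c * A t))) (at t within {0..T})"
        unfolding has_real_derivative_iff_has_vector_derivative .
      show "\<forall>D. ((\<lambda>t. - exp (c * A t) / c) has_vector_derivative D) (at t within {0..T}) \<longrightarrow> D \<le> - (l t * exp (c * A t))"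
        using vector_derivative_unique_within_closed_interval[of 0 T t] T t der by (metis box_real(2) order_refl space_lebesgue_on)
    qed
  qed
  moreover have "A 0 = 0" by (simp add: A_def)
  ultimately show ?thesis by (simp add: A_def diff_divide_distrib)
qed

text \<open>If \<open>M\<close> is a bound of \<open>q\<close> for the weight
  \<open>exp (5 * A)\<close>, then by \<open>step\<close> and
  \<open>integral_exp_primitive_le\<close> so is \<open>(P + M) / 5\<close>. For the smallest such
  \<open>M\<close>, the weighted supremum \<open>S\<close>, this reads
  \<open>S \<le> (P + S) / 5\<close>, that is \<open>S \<le> P / 4\<close>. The bound
  \<open>B\<close> makes the supremum finite.\<close>

lemma weighted_gronwall:
  fixes l q :: "real \<Rightarrow> real"
  assumes T: "T > 0" and l: "integrable (lebesgue_on {0..T}) l" "\<And>t. t \<in> {0..T} \<Longrightarrow> 0 \<le> l t"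
    and q: "\<And>t. t \<in> {0..T} \<Longrightarrow> 0 \<le> q t" "\<And>t. t \<in> {0..T} \<Longrightarrow> q t \<le> B" and P: "0 \<le> P"
    and step: "\<And>M t. 0 \<le> M \<Longrightarrow> (\<And>t. t \<in> {0..T} \<Longrightarrow> q t \<le> M * exp (5 * integral {0..t} l)) \<Longrightarrow> t \<in> {0..T} \<Longrightarrow>
      q t \<le> integral {0..t} (\<lambda>s. (P + M) * (l s * exp (5 * integral {0..s} l)))"
    and t: "t \<in> {0..T}"
  shows "q t \<le> P / 4 * exp (5 * integral {0..t} l)"
proof -
  define A where "A s = integral {0..s} l" for s
  have A0: "0 \<le> A t" if "t \<in> {0..T}" for t
    unfolding A_def by (rule integral_nonneg_mono[OF l]) (use that in auto)
  define S where "S = (SUP t\<in>{0..T}. q t * exp (- 5 * A t))"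
  have bdd: "bdd_above ((\<lambda>t. q t * exp (- 5 * A t)) ` {0..T})"
  proof (rule bdd_aboveI2)
    fix t assume t: "t \<in> {0..T}"
    have "q t * exp (- 5 * A t) \<le> q t * 1" using q(1)[OF t] A0[OF t] by (intro mult_left_mono) auto
    then show "q t * exp (- 5 * A t) \<le> B" using q(2)[OF t] by simp
  qed
  have up: "q t * exp (- 5 * A t) \<le> S" if "t \<in> {0..T}" for t
    unfolding S_def by (rule cSUP_upper[OF that bdd])
  have qS: "q t \<le> S * exp (5 * A t)" if "t \<in> {0..T}" for t
    using mult_right_mono[OF up[OF that], of "exp (5 * A t)"] by (simp add: mult.assoc flip: exp_add)
  have S0: "0 \<le> S" using up[of 0] q(1)[of 0] T by (auto intro: order_trans[rotated])
  have "S \<le> (P + S) / 5"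
    unfolding S_def
  proof (rule cSUP_least)
    fix t assume t: "t \<in> {0..T}"
    have "q t \<le> integral {0..t} (\<lambda>s. (P + S) * (l s * exp (5 * integral {0..s} l)))"
      using step[OF S0 _ t] qS by (simp add: A_def)
    also have "\<dots> = (P + S) * integral {0..t} (\<lambda>s. l s * exp (5 * integral {0..s} l))" by simp
    also have "\<dots> \<le> (P + S) * ((exp (5 * A t) - 1) / 5)"
      unfolding A_def using P S0 by (intro mult_left_mono integral_exp_primitive_le[OF T l _ t]) auto
    also have "\<dots> \<le> (P + S) * (exp (5 * A t) / 5)" using P S0 by (intro mult_left_mono) auto
    finally have "q t * exp (- 5 * A t) \<le> (P + S) * (exp (5 * A t) / 5) * exp (- 5 * A t)"
      by (intro mult_right_mono) auto
    also have "\<dots> = (P + S) / 5" by (simp flip: exp_add)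
    finally show "q t * exp (- 5 * A t) \<le> (P + (SUP t\<in>{0..T}. q t * exp (- 5 * A t))) / 5" by (simp add: S_def)
  qed (use T in auto)
  then have "S \<le> P / 4" by simp
  then have "S * exp (5 * A t) \<le> P / 4 * exp (5 * A t)" by (intro mult_right_mono) auto
  from order_trans[OF qS[OF t] this] show ?thesis by (simp only: A_def)
qed

section \<open>Superposition and Fubini's theorem for strongly measurable functions\<close>

text \<open>Freezing \<open>x\<close> on dyadic cells gives finite sums of sections, each measurable
  by assumption; continuity in the state variable gives the limit. The map \<open>p\<close> names
  the time at which \<open>x\<close> is evaluated: the identity for \<open>f\<close>, the second
  coordinate for the integral kernel.\<close>

lemma strongly_measurable_Caratheodory:
  fixes \<Phi> :: "'b \<Rightarrow> 'c::topological_space \<Rightarrow> 'a::real_normed_vector" and p :: "'b \<Rightarrow> real"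
  assumes T: "T > 0" and M: "complete_measure M" "finite_measure M"
    and p: "p \<in> borel_measurable M" "\<And>\<omega>. \<omega> \<in> space M \<Longrightarrow> p \<omega> \<in> {0..T}"
    and \<Phi>: "\<And>c. strongly_measurable M (\<lambda>\<omega>. \<Phi> \<omega> c)"
    and cont: "AE \<omega> in M. continuous_on UNIV (\<Phi> \<omega>)" and x: "continuous_on {0..T} x"
  shows "strongly_measurable M (\<lambda>\<omega>. \<Phi> \<omega> (x (p \<omega>)))"
proof (rule strongly_measurable_LIMSEQ[OF M])
  \<comment> \<open>The index \<open>2 ^ n\<close> is included for the points with
    \<open>p \<omega> = T\<close>.\<close>
  define fn where "fn n \<omega> = (\<Sum>i\<le>2 ^ n. indicat_real {\<omega>\<in>space M. grid T n i \<le> p \<omega> \<and> p \<omega> < grid T n (Suc i)} \<omega> *\<^sub>R \<Phi> \<omega> (x (grid T n i)))" for n \<omega>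
  show "strongly_measurable M (fn n)" for n
    unfolding fn_def
  proof (intro strongly_measurable_sum strongly_measurable_scaleR \<Phi>)
    fix i
    have "{\<omega>\<in>space M. grid T n i \<le> p \<omega> \<and> p \<omega> < grid T n (Suc i)} \<in> sets M"
      using p(1) by measurable
    then show "strongly_measurable M (indicat_real {\<omega>\<in>space M. grid T n i \<le> p \<omega> \<and> p \<omega> < grid T n (Suc i)})"
      by (intro strongly_measurable_simple simple_function_indicator)
  qed
  have fn: "fn n \<omega> = \<Phi> \<omega> (x (grid T n (cell T n (p \<omega>))))" if \<omega>: "\<omega> \<in> space M" for n \<omega>
  proof -
    define k where "k = cell T n (p \<omega>)"
    have p\<omega>: "0 \<le> p \<omega>" "p \<omega> \<le> T" using p(2)[OF \<omega>] by auto
    have ind: "indicat_real {\<omega>\<in>space M. grid T n i \<le> p \<omega> \<and> p \<omega> < grid T n (Suc i)} \<omega> = (if i = k then 1 else 0)" for i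
      using cell_eq_iff[OF T p\<omega>(1), of n i] \<omega> by (auto simp: indicator_def k_def)
    have "fn n \<omega> = (\<Sum>i\<le>2 ^ n. if i = k then \<Phi> \<omega> (x (grid T n i)) else 0)"
      unfolding fn_def ind by (intro sum.cong) auto
    also have "\<dots> = \<Phi> \<omega> (x (grid T n k))" using cell_le[OF T p\<omega>(2), of n] by (simp add: k_def)
    finally show ?thesis by (simp add: k_def)
  qed
  show "AE \<omega> in M. (\<lambda>n. fn n \<omega>) \<longlonglongrightarrow> \<Phi> \<omega> (x (p \<omega>))"
    using cont AE_space
  proof eventually_elim
    fix \<omega> assume c: "continuous_on UNIV (\<Phi> \<omega>)" and \<omega>: "\<omega> \<in> space M"
    have p\<omega>: "p \<omega> \<in> {0..T}" by (rule p(2)[OF \<omega>])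
    have g: "(\<lambda>n. grid T n (cell T n (p \<omega>))) \<longlonglongrightarrow> p \<omega>" using grid_cell_tendsto[OF T] p\<omega> by simp
    have "(\<lambda>n. x (grid T n (cell T n (p \<omega>)))) \<longlonglongrightarrow> x (p \<omega>)"
    proof (rule continuous_on_tendsto_compose[OF x g p\<omega>], intro always_eventually allI)
      show "grid T n (cell T n (p \<omega>)) \<in> {0..T}" for n
        using grid_cell_mem[OF T p\<omega>, of n] p\<omega> by simp
    qed
    then have "(\<lambda>n. \<Phi> \<omega> (x (grid T n (cell T n (p \<omega>))))) \<longlonglongrightarrow> \<Phi> \<omega> (x (p \<omega>))"
      by (rule continuous_on_tendsto_compose[OF c]) auto
    then show "(\<lambda>n. fn n \<omega>) \<longlonglongrightarrow> \<Phi> \<omega> (x (p \<omega>))" by (simp add: fn[OF \<omega>])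
  qed
qed

lemma AE_lebesgue_on_imp_lborel:
  assumes "AE x in lebesgue_on S. P x" "S \<in> sets lebesgue"
  shows "AE x in lborel. x \<in> S \<longrightarrow> P x"
proof -
  have "AE x in lebesgue. x \<in> S \<longrightarrow> P x"
    using assms(1) by (subst (asm) AE_restrict_space_iff) (use assms(2) in auto)
  then show ?thesis by (simp add: AE_completion_iff)
qed

lemma AE_lborel_imp_lebesgue_on:
  assumes "AE x in lborel. x \<in> S \<longrightarrow> P x" "S \<in> sets lebesgue"
  shows "AE x in lebesgue_on S. P x"
  using AE_completion[OF assms(1)] by (subst AE_restrict_space_iff) (use assms(2) in auto)

lemma AE_lborel_pair:
  fixes P :: "real \<times> real \<Rightarrow> bool"
  assumes "AE z in lborel. P z"
  shows "AE t in lborel. AE s in lborel. P (t, s)"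
proof (rule lborel_pair.AE_pair)
  show "AE z in lborel \<Otimes>\<^sub>M lborel. P z" unfolding lborel_prod by (rule assms)
qed

lemma square_sets: "{0..T} \<times> {0..T} \<in> sets (lebesgue :: (real \<times> real) measure)"
proof -
  have "closed ({0..T} \<times> {0..T::real})" by (intro closed_Times) auto
  then show ?thesis by (simp add: borel_closed)
qed

lemma square_finite: "finite_measure (lebesgue_on ({0..T} \<times> {0..T::real}))"
proof (rule finite_measure_lebesgue_on)
  have "compact ({0..T} \<times> {0..T::real})" by (intro compact_Times) auto
  then show "{0..T} \<times> {0..T::real} \<in> lmeasurable" by (rule lmeasurable_compact)
qed

text \<open>Lebesgue measure on the plane is the completion of a product measure. The extension of
  \<open>b\<close> by zero is replaced by an almost everywhere equal Borel function, Fubini's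
  theorem is applied to that function, and completeness carries the result back on almost every
  section.\<close>

lemma square_real_Fubini:
  fixes b :: "real \<times> real \<Rightarrow> real"
  assumes b: "integrable (lebesgue_on ({0..T} \<times> {0..T})) b"
  shows "AE t in lebesgue_on {0..T}. integrable (lebesgue_on {0..T}) (\<lambda>s. b (t, s))"
    and "integrable (lebesgue_on {0..T}) (\<lambda>t. LINT s|lebesgue_on {0..T}. b (t, s))"
proof -
  define b0 where "b0 z = indicat_real ({0..T} \<times> {0..T}) z *\<^sub>R b z" for z
  have i0: "integrable lebesgue b0"
    unfolding b0_def using b square_sets by (subst (asm) integrable_restrict_space) auto
  obtain b' where b': "b' \<in> borel_measurable lborel" "AE z in lborel. b0 z = b' z"
    using completion_ex_borel_measurable_real[of b0 lborel] i0 by auto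
  have "integrable lebesgue b'"
  proof (rule integrable_cong_AE_imp[OF i0])
    show "b' \<in> borel_measurable lebesgue" using b'(1) by (rule measurable_completion)
    show "AE z in lebesgue. b0 z = b' z" by (rule AE_completion[OF b'(2)])
  qed
  then have ib': "integrable lborel b'" using b'(1) by (simp add: integrable_completion)
  then have ip: "integrable (lborel \<Otimes>\<^sub>M lborel) b'" unfolding lborel_prod .
  have eqt: "integrable (lebesgue_on {0..T}) (\<lambda>s. b (t, s)) \<and> (LINT s|lebesgue_on {0..T}. b (t, s)) = (LINT s|lborel. b' (t, s))"
    if t: "t \<in> {0..T}" and ae: "AE s in lborel. b0 (t, s) = b' (t, s)" and int: "integrable lborel (\<lambda>s. b' (t, s))" for t
  proof -
    have m: "(\<lambda>s. b' (t, s)) \<in> borel_measurable lborel" using int by blast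
    have i1: "integrable lebesgue (\<lambda>s. b' (t, s))" using int m by (simp add: integrable_completion)
    have ae': "AE s in lebesgue. b' (t, s) = b0 (t, s)" by (rule AE_completion) (use ae in \<open>auto elim: eventually_mono\<close>)
    have m0: "(\<lambda>s. b0 (t, s)) \<in> borel_measurable lebesgue"
      by (rule borel_measurable_AE_complete[OF completion.complete_measure_axioms _ ae']) (use i1 in blast)
    have i2: "integrable lebesgue (\<lambda>s. b0 (t, s))"
      by (rule integrable_cong_AE_imp[OF i1 m0 ae'])
    have b0t: "b0 (t, s) = indicat_real {0..T} s *\<^sub>R b (t, s)" for s using t by (simp add: b0_def indicator_def)
    have "(LINT s|lebesgue_on {0..T}. b (t, s)) = (LINT s|lebesgue. b0 (t, s))"
      unfolding b0t by (rule integral_restrict_space) simp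
    also have "\<dots> = (LINT s|lebesgue. b' (t, s))"
      by (rule integral_cong_AE) (use m0 i1 ae' in \<open>auto elim: eventually_mono\<close>)
    also have "\<dots> = (LINT s|lborel. b' (t, s))" using m by (simp add: integral_completion)
    finally show ?thesis using i2 unfolding b0t by (subst integrable_restrict_space) auto
  qed
  have "AE t in lborel. t \<in> {0..T} \<longrightarrow>
    integrable (lebesgue_on {0..T}) (\<lambda>s. b (t, s)) \<and> (LINT s|lebesgue_on {0..T}. b (t, s)) = (LINT s|lborel. b' (t, s))"
    using AE_lborel_pair[OF b'(2)] lborel_pair.AE_integrable_fst'[OF ip]
    by eventually_elim (use eqt in blast)
  then have AEt: "AE t in lebesgue_on {0..T}. 
    integrable (lebesgue_on {0..T}) (\<lambda>s. b (t, s)) \<and> (LINT s|lebesgue_on {0..T}. b (t, s)) = (LINT s|lborel. b' (t, s))"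
    by (rule AE_lborel_imp_lebesgue_on) simp
  then show "AE t in lebesgue_on {0..T}. integrable (lebesgue_on {0..T}) (\<lambda>s. b (t, s))"
    by eventually_elim simp
  have "integrable lborel (\<lambda>t. LINT s|lborel. b' (t, s))" by (rule lborel_pair.integrable_fst'[OF ip])
  then have "integrable lebesgue (\<lambda>t. LINT s|lborel. b' (t, s))"
    by (subst integrable_completion) auto
  then have i3: "integrable (lebesgue_on {0..T}) (\<lambda>t. LINT s|lborel. b' (t, s))"
    by (subst integrable_restrict_space) (auto intro!: integrable_mult_indicator simp del: real_scaleR_def)
  have ae4: "AE t in lebesgue_on {0..T}. (LINT s|lborel. b' (t, s)) = (LINT s|lebesgue_on {0..T}. b (t, s))"
    using AEt by eventually_elim simp
  show "integrable (lebesgue_on {0..T}) (\<lambda>t. LINT s|lebesgue_on {0..T}. b (t, s))"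
  proof (rule integrable_cong_AE_imp[OF i3])
    show "(\<lambda>t. LINT s|lebesgue_on {0..T}. b (t, s)) \<in> borel_measurable (lebesgue_on {0..T})"
      by (rule borel_measurable_AE_complete[OF complete_measure_interval _ ae4]) (use i3 in blast)
  qed (rule ae4)
qed

text \<open>Expressing the integral as a finite sum of measures of level sets reduces its dependence
  on a parameter to measures of sections of plane sets.\<close>

lemma strong_integral_simple_interval:
  fixes f :: "real \<Rightarrow> 'a::{real_inner,complete_space}"
  assumes D: "finite D" "\<And>s. f s \<in> D" and f: "\<And>c. f -` {c} \<in> sets borel"
  shows "strongly_integrable (lebesgue_on {0..T}) f"
    "strong_integral (lebesgue_on {0..T}) f = (\<Sum>c\<in>D. measure lborel ({0..T} \<inter> f -` {c}) *\<^sub>R c)"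
proof -
  let ?M = "lebesgue_on {0..T}"
  interpret finite_measure ?M by (rule finite_measure_lebesgue_on) simp
  have lev: "{0..T} \<inter> f -` {c} \<in> sets ?M" for c
    using f[of c] by (subst sets_restrict_space_iff) auto
  have sf: "simple_function ?M f"
    unfolding simple_function_def
  proof (intro conjI ballI)
    show "finite (f ` space ?M)" by (rule finite_subset[OF _ D(1)]) (use D(2) in auto)
    show "f -` {c} \<inter> space ?M \<in> sets ?M" for c using lev[of c] by (simp add: Int_commute)
  qed
  have bnd: "norm (f s) \<le> Max (norm ` D)" for s using D by (intro Max_ge) auto
  show *: "strongly_integrable ?M f"
    by (rule strongly_integrable_bound[OF complete_measure_interval strongly_measurable_simple[OF sf], of "\<lambda>_. Max (norm ` D)"])
      (use bnd in auto)
  show "strong_integral ?M f = (\<Sum>c\<in>D. measure lborel ({0..T} \<inter> f -` {c}) *\<^sub>R c)"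
  proof (rule strong_integral_eqI[OF complete_measure_interval *])
    fix y
    have "f s \<bullet> y = (\<Sum>c\<in>D. indicat_real ({0..T} \<inter> f -` {c}) s * (c \<bullet> y))" if "s \<in> space ?M" for s
    proof -
      have "(\<Sum>c\<in>D. indicat_real ({0..T} \<inter> f -` {c}) s * (c \<bullet> y)) = (\<Sum>c\<in>D. if c = f s then c \<bullet> y else 0)"
        by (rule sum.cong) (use that in \<open>auto simp: indicator_def\<close>)
      also have "\<dots> = f s \<bullet> y" using D by simp
      finally show ?thesis by simp
    qed
    then have "(LINT s|?M. f s \<bullet> y) = (LINT s|?M. (\<Sum>c\<in>D. indicat_real ({0..T} \<inter> f -` {c}) s * (c \<bullet> y)))"
      by (rule Bochner_Integration.integral_cong[OF refl])
    also have "\<dots> = (\<Sum>c\<in>D. LINT s|?M. indicat_real ({0..T} \<inter> f -` {c}) s * (c \<bullet> y))"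
    proof (rule Bochner_Integration.integral_sum)
      show "integrable ?M (\<lambda>s. indicat_real ({0..T} \<inter> f -` {c}) s * (c \<bullet> y))" for c
        using lev[of c] by (intro integrable_mult_left integrable_real_indicator) (auto simp: less_top[symmetric])
    qed
    also have "\<dots> = (\<Sum>c\<in>D. measure lborel ({0..T} \<inter> f -` {c}) * (c \<bullet> y))"
    proof (rule sum.cong[OF refl])
      fix c
      have "measure ?M ({0..T} \<inter> f -` {c}) = measure lborel ({0..T} \<inter> f -` {c})"
        using f[of c] by (subst measure_restrict_space) (auto simp: measure_completion)
      then show "(LINT s|?M. indicat_real ({0..T} \<inter> f -` {c}) s * (c \<bullet> y)) = measure lborel ({0..T} \<inter> f -` {c}) * (c \<bullet> y)"
        using lev[of c] inf.right_idem[of "{0..T}" "f -` {c}"] by (simp add: Int_ac)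
    qed
    finally show "(LINT s|?M. f s \<bullet> y) = (\<Sum>c\<in>D. measure lborel ({0..T} \<inter> f -` {c}) *\<^sub>R c) \<bullet> y"
      by (simp add: inner_sum_left)
  qed
qed

text \<open>For Borel simple approximations the section integrals \<open>J i\<close> are finite sums
  of section measures, hence measurable in \<open>t\<close>. For almost every \<open>t\<close> the
  sections converge almost everywhere, with norms bounded by \<open>4 * b\<close>, so the
  \<open>J i t\<close> converge to the section integral of \<open>q\<close>.\<close>

lemma square_Fubini:
  fixes q :: "real \<times> real \<Rightarrow> 'a::{real_inner,complete_space}"
  assumes q: "strongly_measurable (lebesgue_on ({0..T} \<times> {0..T})) q"
    and b: "integrable (lebesgue_on ({0..T} \<times> {0..T})) b"
    and qb: "\<And>t s. t \<in> {0..T} \<Longrightarrow> s \<in> {0..T} \<Longrightarrow> norm (q (t, s)) \<le> b (t, s)"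
  shows "AE t in lebesgue_on {0..T}. strongly_integrable (lebesgue_on {0..T}) (\<lambda>s. q (t, s))"
    and "strongly_measurable (lebesgue_on {0..T}) (\<lambda>t. strong_integral (lebesgue_on {0..T}) (\<lambda>s. q (t, s)))"
proof -
  let ?Q = "{0..T} \<times> {0..T::real}"
  note C = complete_measure_interval
  interpret finite_measure "lebesgue_on {0..T}" by (rule finite_measure_lebesgue_on) simp
  obtain f where f: "\<And>i. simple_function (lebesgue_on ?Q) (f i)" "AE z in lebesgue_on ?Q. (\<lambda>i. f i z) \<longlonglongrightarrow> q z"
    "\<And>i z. z \<in> space (lebesgue_on ?Q) \<Longrightarrow> norm (f i z) \<le> 4 * norm (q z)"
    using strongly_measurable_dominated_simple[OF complete_measure_lebesgue_on[OF square_sets] q] by blast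
  define f0 where "f0 i z = indicat_real ?Q z *\<^sub>R f i z" for i z
  have "simple_function lebesgue (f0 i)" for i
    unfolding f0_def using f(1)[of i] square_sets by (subst (asm) simple_function_restrict_space) auto
  \<comment> \<open>Borel level sets have measurable sections at every \<open>t\<close>, which
    Lebesgue measurable ones need not have.\<close>
  then have "\<forall>i. \<exists>f'. simple_function lborel f' \<and> (AE z in lborel. f0 i z = f' z)"
    using completion_ex_simple_function by blast
  then obtain f' where f': "\<And>i. simple_function lborel (f' i)" "\<And>i. AE z in lborel. f0 i z = f' i z" by metis
  have ae: "AE z in lborel. z \<in> ?Q \<longrightarrow> (\<lambda>i. f' i z) \<longlonglongrightarrow> q z \<and> (\<forall>i. norm (f' i z) \<le> 4 * b z)"
    using AE_lebesgue_on_imp_lborel[OF f(2) square_sets] AE_all_countable[THEN iffD2, OF allI[OF f'(2)]]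
  proof eventually_elim
    fix z assume l: "z \<in> ?Q \<longrightarrow> (\<lambda>i. f i z) \<longlonglongrightarrow> q z" and e: "\<forall>i. f0 i z = f' i z"
    show "z \<in> ?Q \<longrightarrow> (\<lambda>i. f' i z) \<longlonglongrightarrow> q z \<and> (\<forall>i. norm (f' i z) \<le> 4 * b z)"
    proof
      assume z: "z \<in> ?Q"
      then have eq: "f' i z = f i z" for i using e by (simp add: f0_def flip: e[rule_format])
      have "norm (f i z) \<le> 4 * b z" for i
        using f(3)[of z i] qb[of "fst z" "snd z"] z by (auto intro: order_trans)
      then show "(\<lambda>i. f' i z) \<longlonglongrightarrow> q z \<and> (\<forall>i. norm (f' i z) \<le> 4 * b z)" using l z by (simp add: eq)
    qed
  qed
  define D where "D i = range (f' i)" for i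
  have D: "finite (D i)" "f' i z \<in> D i" for i z
    using simple_functionD(1)[OF f'(1)[of i]] by (auto simp: D_def)
  have lev2: "f' i -` {c} \<in> sets ((borel :: real measure) \<Otimes>\<^sub>M (borel :: real measure))" for i c
    unfolding borel_prod using simple_functionD(2)[OF f'(1)[of i], of "{c}"] by simp
  have lev: "(\<lambda>s. f' i (t, s)) -` {c} \<in> sets borel" for i t c
  proof -
    have "Pair t -` (f' i -` {c}) \<in> sets borel" using lev2 by (rule sets_Pair1)
    then show ?thesis by (simp add: vimage_def)
  qed
  define J where "J i t = strong_integral (lebesgue_on {0..T}) (\<lambda>s. f' i (t, s))" for i t
  have fi: "strongly_integrable (lebesgue_on {0..T}) (\<lambda>s. f' i (t, s))" for i t
    by (rule strong_integral_simple_interval(1)[OF D(1) D(2) lev])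
  have Jeq: "J i t = (\<Sum>c\<in>D i. measure lborel ({0..T} \<inter> (\<lambda>s. f' i (t, s)) -` {c}) *\<^sub>R c)" for i t
    unfolding J_def by (rule strong_integral_simple_interval(2)[OF D(1) D(2) lev])
  have Jm: "strongly_measurable (lebesgue_on {0..T}) (J i)" for i
  proof -
    have "strongly_measurable (lebesgue_on {0..T}) (\<lambda>t. \<Sum>c\<in>D i. measure lborel ({0..T} \<inter> (\<lambda>s. f' i (t, s)) -` {c}) *\<^sub>R c)"
  proof (intro strongly_measurable_sum strongly_measurable_scaleR strongly_measurable_const borel_measurable_imp_strongly_measurable)
    fix c
    have "(UNIV \<times> {0..T}) \<inter> f' i -` {c} \<in> sets (borel \<Otimes>\<^sub>M lborel)"
    proof -
      have "UNIV \<times> {0..T} \<in> sets (borel \<Otimes>\<^sub>M (borel :: real measure))" by (rule pair_measureI) auto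
      from sets.Int[OF this lev2] show ?thesis by simp
    qed
    then have "(\<lambda>t. emeasure lborel (Pair t -` ((UNIV \<times> {0..T}) \<inter> f' i -` {c}))) \<in> borel_measurable borel"
      by (rule lborel.measurable_emeasure_Pair)
    then have "(\<lambda>t. measure lborel (Pair t -` ((UNIV \<times> {0..T}) \<inter> f' i -` {c}))) \<in> borel_measurable borel"
      unfolding measure_def by measurable
    moreover have "Pair t -` ((UNIV \<times> {0..T}) \<inter> f' i -` {c}) = {0..T} \<inter> (\<lambda>s. f' i (t, s)) -` {c}" for t by auto
    ultimately have "(\<lambda>t. measure lborel ({0..T} \<inter> (\<lambda>s. f' i (t, s)) -` {c})) \<in> borel_measurable lborel" by simp
    then show "(\<lambda>t. measure lborel ({0..T} \<inter> (\<lambda>s. f' i (t, s)) -` {c})) \<in> borel_measurable (lebesgue_on {0..T})"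
      by (intro measurable_restrict_space1 measurable_completion)
  qed
    then show ?thesis by (simp add: Jeq[abs_def])
  qed
  have AEt: "AE t in lebesgue_on {0..T}. AE s in lebesgue_on {0..T}. (\<lambda>i. f' i (t, s)) \<longlonglongrightarrow> q (t, s) \<and> (\<forall>i. norm (f' i (t, s)) \<le> 4 * b (t, s))"
  proof (rule AE_lborel_imp_lebesgue_on)
    show "AE t in lborel. t \<in> {0..T} \<longrightarrow> (AE s in lebesgue_on {0..T}. (\<lambda>i. f' i (t, s)) \<longlonglongrightarrow> q (t, s) \<and> (\<forall>i. norm (f' i (t, s)) \<le> 4 * b (t, s)))"
      using AE_lborel_pair[OF ae]
    proof eventually_elim
      fix t assume a: "AE s in lborel. (t, s) \<in> ?Q \<longrightarrow> (\<lambda>i. f' i (t, s)) \<longlonglongrightarrow> q (t, s) \<and> (\<forall>i. norm (f' i (t, s)) \<le> 4 * b (t, s))"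
      show "t \<in> {0..T} \<longrightarrow> (AE s in lebesgue_on {0..T}. (\<lambda>i. f' i (t, s)) \<longlonglongrightarrow> q (t, s) \<and> (\<forall>i. norm (f' i (t, s)) \<le> 4 * b (t, s)))"
      proof (intro impI AE_lborel_imp_lebesgue_on)
        assume "t \<in> {0..T}"
        then show "AE s in lborel. s \<in> {0..T} \<longrightarrow> (\<lambda>i. f' i (t, s)) \<longlonglongrightarrow> q (t, s) \<and> (\<forall>i. norm (f' i (t, s)) \<le> 4 * b (t, s))"
          using a by (auto elim: eventually_mono)
      qed simp
    qed
  qed simp
  have main: "AE t in lebesgue_on {0..T}. strongly_integrable (lebesgue_on {0..T}) (\<lambda>s. q (t, s)) \<and>
    (\<lambda>i. J i t) \<longlonglongrightarrow> strong_integral (lebesgue_on {0..T}) (\<lambda>s. q (t, s))"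
    using AEt square_real_Fubini(1)[OF b] AE_space
  proof eventually_elim
    fix t
    assume a: "AE s in lebesgue_on {0..T}. (\<lambda>i. f' i (t, s)) \<longlonglongrightarrow> q (t, s) \<and> (\<forall>i. norm (f' i (t, s)) \<le> 4 * b (t, s))"
      and ib: "integrable (lebesgue_on {0..T}) (\<lambda>s. b (t, s))" and "t \<in> space (lebesgue_on {0..T})"
    then have t: "t \<in> {0..T}" by simp
    have lim: "AE s in lebesgue_on {0..T}. (\<lambda>i. f' i (t, s)) \<longlonglongrightarrow> q (t, s)" using a by eventually_elim simp
    have smf: "strongly_measurable (lebesgue_on {0..T}) (\<lambda>s. f' i (t, s))" for i
      using fi strongly_integrable_iff[OF C] by blast
    have smq: "strongly_measurable (lebesgue_on {0..T}) (\<lambda>s. q (t, s))"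
      by (rule strongly_measurable_LIMSEQ[OF C finite_measure_axioms smf lim])
    have qi: "strongly_integrable (lebesgue_on {0..T}) (\<lambda>s. q (t, s))"
      by (rule strongly_integrable_bound[OF C smq ib]) (use qb t in \<open>auto intro!: AE_I2\<close>)
    have "(\<lambda>i. LINT s|lebesgue_on {0..T}. norm (f' i (t, s) - q (t, s))) \<longlonglongrightarrow> (LINT s|lebesgue_on {0..T}. 0)"
    proof (rule integral_dominated_convergence[where w="\<lambda>s. 5 * b (t, s)"])
      show "(\<lambda>s. norm (f' i (t, s) - q (t, s))) \<in> borel_measurable (lebesgue_on {0..T})" for i
        by (intro strongly_measurable_norm[OF C] strongly_measurable_diff smf smq)
      show "AE s in lebesgue_on {0..T}. (\<lambda>i. norm (f' i (t, s) - q (t, s))) \<longlonglongrightarrow> 0"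
        using lim by eventually_elim (rule tendsto_norm_zero, simp add: LIM_zero_iff)
      show "AE s in lebesgue_on {0..T}. norm (norm (f' i (t, s) - q (t, s))) \<le> 5 * b (t, s)" for i
        using a AE_space
      proof eventually_elim
        fix s assume "(\<lambda>i. f' i (t, s)) \<longlonglongrightarrow> q (t, s) \<and> (\<forall>i. norm (f' i (t, s)) \<le> 4 * b (t, s))"
          and "s \<in> space (lebesgue_on {0..T})"
        then have "norm (f' i (t, s)) \<le> 4 * b (t, s)" "norm (q (t, s)) \<le> b (t, s)" using qb[OF t] by auto
        then show "norm (norm (f' i (t, s) - q (t, s))) \<le> 5 * b (t, s)"
          using norm_triangle_ineq4[of "f' i (t, s)" "q (t, s)"] by simp
      qed
    qed (use ib in auto)
    then have l0: "(\<lambda>i. LINT s|lebesgue_on {0..T}. norm (f' i (t, s) - q (t, s))) \<longlonglongrightarrow> 0" by simp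
    have "(\<lambda>i. J i t - strong_integral (lebesgue_on {0..T}) (\<lambda>s. q (t, s))) \<longlonglongrightarrow> 0"
    proof (rule Lim_null_comparison[OF _ l0], intro always_eventually allI)
      fix i
      show "norm (J i t - strong_integral (lebesgue_on {0..T}) (\<lambda>s. q (t, s))) \<le> (LINT s|lebesgue_on {0..T}. norm (f' i (t, s) - q (t, s)))"
        using norm_strong_integral_le[OF C strong_integral_diff(1)[OF C fi qi]] strong_integral_diff(2)[OF C fi qi]
        by (simp add: J_def)
    qed
    then show "strongly_integrable (lebesgue_on {0..T}) (\<lambda>s. q (t, s)) \<and>
      (\<lambda>i. J i t) \<longlonglongrightarrow> strong_integral (lebesgue_on {0..T}) (\<lambda>s. q (t, s))"
      using qi by (simp add: LIM_zero_iff)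
  qed
  show "AE t in lebesgue_on {0..T}. strongly_integrable (lebesgue_on {0..T}) (\<lambda>s. q (t, s))"
    using main by eventually_elim simp
  show "strongly_measurable (lebesgue_on {0..T}) (\<lambda>t. strong_integral (lebesgue_on {0..T}) (\<lambda>s. q (t, s)))"
    by (rule strongly_measurable_LIMSEQ[OF C finite_measure_axioms Jm]) (use main in \<open>auto elim: eventually_mono\<close>)
qed

section \<open>Volterra forcing\<close>

lemma continuous_on_locally_Lipschitz:
  fixes F :: "'a::real_normed_vector \<Rightarrow> 'b::real_normed_vector"
  assumes F: "\<And>R. R > 0 \<Longrightarrow> \<exists>L. \<forall>x\<in>cball 0 R. \<forall>y\<in>cball 0 R. norm (F x - F y) \<le> L * norm (x - y)"
  shows "continuous_on UNIV F"
proof -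
  have "isCont F x" for x
  proof -
    define R where "R = norm x + 1"
    have R: "R > 0" by (simp add: R_def add_nonneg_pos)
    obtain L where L: "\<And>y z. y \<in> cball 0 R \<Longrightarrow> z \<in> cball 0 R \<Longrightarrow> norm (F y - F z) \<le> L * norm (y - z)"
      using F[OF R] by blast
    have "(max L 0)-lipschitz_on (cball 0 R) F"
    proof (rule lipschitz_onI)
      fix y z :: 'a assume "y \<in> cball 0 R" "z \<in> cball 0 R"
      then have "norm (F y - F z) \<le> L * norm (y - z)" by (rule L)
      also have "\<dots> \<le> max L 0 * norm (y - z)" by (intro mult_right_mono) auto
      finally show "dist (F y) (F z) \<le> max L 0 * dist y z" by (simp add: dist_norm)
    qed simp
    then have "continuous_on (cball 0 R) F" by (rule lipschitz_on_continuous_on)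
    moreover have "x \<in> interior (cball 0 R)"
      by (rule interiorI[of "ball 0 R"]) (auto simp: R_def)
    ultimately show ?thesis by (rule continuous_on_interior)
  qed
  then show ?thesis by (simp add: continuous_at_imp_continuous_on)
qed

lemma continuous_on_if_dominated:
  fixes y :: "real \<Rightarrow> 'a::real_normed_vector"
  assumes \<phi>: "integrable (lebesgue_on {0..T}) \<phi>"
    and y: "\<And>s t. 0 \<le> s \<Longrightarrow> s \<le> t \<Longrightarrow> t \<le> T \<Longrightarrow> norm (y t - y s) \<le> integral {s..t} \<phi>"
  shows "continuous_on {0..T} y"
  unfolding continuous_on_iff
proof (intro ballI allI impI)
  fix t e :: real assume t: "t \<in> {0..T}" and "e > 0"
  then obtain d where d: "d > 0" "\<And>s. s \<in> {0..T} \<Longrightarrow> dist s t < d \<Longrightarrow> dist (integral {0..s} \<phi>) (integral {0..t} \<phi>) < e"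
    using continuous_on_integral[OF \<phi>] unfolding continuous_on_iff by meson
  have "dist (y s) (y t) < e" if s: "s \<in> {0..T}" "dist s t < d" for s
  proof -
    have "dist (y s) (y t) \<le> dist (integral {0..s} \<phi>) (integral {0..t} \<phi>)"
    proof (cases "s \<le> t")
      case True
      then show ?thesis
        using y[of s t] integral_combine_diff[OF \<phi>, of s t] s t by (simp add: dist_norm norm_minus_commute dist_real_def)
    next
      case False
      then show ?thesis
        using y[of t s] integral_combine_diff[OF \<phi>, of t s] s t by (simp add: dist_norm dist_real_def)
    qed
    then show ?thesis using d(2)[OF s] by simp
  qed
  then show "\<exists>d>0. \<forall>x'\<in>{0..T}. dist x' t < d \<longrightarrow> dist (y x') (y t) < e" using d(1) by blast
qed

lemma strongly_integrable_cong_AE: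
  fixes f g :: "'b \<Rightarrow> 'a::{real_inner,complete_space}"
  assumes M: "complete_measure M" and f: "strongly_integrable M f" and ae: "AE x in M. f x = g x"
  shows "strongly_integrable M g" "strong_integral M g = strong_integral M f"
proof -
  have f': "strongly_measurable M f" "integrable M (\<lambda>x. norm (f x))"
    using f strongly_integrable_iff[OF M] by auto
  have smg: "strongly_measurable M g" by (rule strongly_measurable_AE[OF f'(1) ae])
  show g: "strongly_integrable M g"
    by (rule strongly_integrable_bound[OF M smg f'(2)]) (use ae in \<open>eventually_elim, simp\<close>)
  show "strong_integral M g = strong_integral M f"
  proof (rule strong_integral_eqI[OF M g])
    fix y
    have "(LINT x|M. g x \<bullet> y) = (LINT x|M. f x \<bullet> y)"
      by (rule integral_cong_AE)
        (use strong_integral_inner(1)[OF M g] strong_integral_inner(1)[OF M f] ae in \<open>auto elim: eventually_mono\<close>)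
    then show "(LINT x|M. g x \<bullet> y) = strong_integral M f \<bullet> y" using strong_integral_inner(2)[OF M f] by simp
  qed
qed

text \<open>\<open>y1\<close> and \<open>y2\<close> are inputs of the Picard map, \<open>x1\<close>
  and \<open>x2\<close> the outputs: a weighted bound \<open>P\<close> for the inputs becomes
  \<open>P / 4\<close>. The additional distance of the outputs in the hypothesis on \<open>P\<close>
  covers the case of two solutions, where inputs and outputs coincide and
  \<open>P = 0\<close>.\<close>

lemma (in moving_set) volterra_contraction:
  assumes \<phi>: "integrable (lebesgue_on {0..T}) \<phi>"
    and lip: "\<And>s t. 0 \<le> s \<Longrightarrow> s \<le> t \<Longrightarrow> t \<le> T \<Longrightarrow> norm (x1 t - x1 s) \<le> integral {s..t} \<phi>"
      "\<And>s t. 0 \<le> s \<Longrightarrow> s \<le> t \<Longrightarrow> t \<le> T \<Longrightarrow> norm (x2 t - x2 s) \<le> integral {s..t} \<phi>"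
    and init: "x1 0 = x2 0"
    and incl1: "AE t in lebesgue_on {0..T}. inclusion_at T C F1 (\<nu> t) x1 t"
    and incl2: "AE t in lebesgue_on {0..T}. inclusion_at T C F2 (\<nu> t) x2 t"
    and \<nu>: "integrable (lebesgue_on {0..T}) \<nu>" "\<And>t. t \<in> {0..T} \<Longrightarrow> 0 \<le> \<nu> t"
    and l1: "integrable (lebesgue_on {0..T}) l1" "\<And>t. t \<in> {0..T} \<Longrightarrow> 0 \<le> l1 t"
    and F: "AE t in lebesgue_on {0..T}. \<forall>\<delta>\<ge>0. (\<forall>s\<in>{0..t}. norm (y1 s - y2 s) \<le> \<delta>) \<longrightarrow> norm (F1 t - F2 t) \<le> l1 t * \<delta>"
    and P: "0 \<le> P" "\<And>t. t \<in> {0..T} \<Longrightarrow>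
      (norm (y1 t - y2 t))\<^sup>2 \<le> P * exp (5 * integral {0..t} (\<lambda>s. 2 * l1 s + 2 * \<nu> s / r)) + (norm (x1 t - x2 t))\<^sup>2"
    and t: "t \<in> {0..T}"
  shows "(norm (x1 t - x2 t))\<^sup>2 \<le> P / 4 * exp (5 * integral {0..t} (\<lambda>s. 2 * l1 s + 2 * \<nu> s / r))"
proof -
  \<comment> \<open>The first summand absorbs the Lipschitz dependence of the forcing on the input,
    the second the hypomonotonicity of the normal cones.\<close>
  define l where "l s = 2 * l1 s + 2 * \<nu> s / r" for s
  have l: "integrable (lebesgue_on {0..T}) l" "\<And>t. t \<in> {0..T} \<Longrightarrow> 0 \<le> l t"
    using l1 \<nu> r by (auto simp: l_def[abs_def])
  define d where "d s = norm (x1 s - x2 s)" for s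
  have "continuous_on {0..T} (\<lambda>s. (d s)\<^sup>2)"
    unfolding d_def by (intro continuous_intros continuous_on_if_dominated[OF \<phi>] lip)
  then have "bounded ((\<lambda>s. (d s)\<^sup>2) ` {0..T})"
    by (intro compact_imp_bounded compact_continuous_image) auto
  then obtain B where B: "\<And>s. s \<in> {0..T} \<Longrightarrow> (d s)\<^sup>2 \<le> B"
    unfolding bounded_iff by (auto simp del: atLeastAtMost_iff)
  have lint: "integral {0..s} l \<le> integral {0..t} l" if "0 \<le> s" "s \<le> t" "t \<le> T" for s t
    using integral_combine_diff[OF l(1) that] integral_nonneg_mono[OF l that] by simp
  have "(d t)\<^sup>2 \<le> P / 4 * exp (5 * integral {0..t} l)"
  proof (rule weighted_gronwall[OF T l _ B P(1) _ t])
    fix M t assume M: "0 \<le> M" and dM: "\<And>t. t \<in> {0..T} \<Longrightarrow> (d t)\<^sup>2 \<le> M * exp (5 * integral {0..t} l)"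
      and t: "t \<in> {0..T}"
    define e where "e t = exp (5 * integral {0..t} l)" for t
    show "(d t)\<^sup>2 \<le> integral {0..t} (\<lambda>s. (P + M) * (l s * exp (5 * integral {0..s} l)))"
      unfolding d_def
    proof (rule sweeping_comparison[OF \<phi> lip init incl1 incl2 _ _ t])
      show "integrable (lebesgue_on {0..T}) (\<lambda>s. (P + M) * (l s * exp (5 * integral {0..s} l)))"
        by (intro integrable_mult_right integrable_continuous_mult[OF l(1)] continuous_intros continuous_on_integral[OF l(1)])
      show "AE t in lebesgue_on {0..T}. 2 * norm (F1 t - F2 t) * norm (x1 t - x2 t) + 2 * \<nu> t / r * (norm (x1 t - x2 t))\<^sup>2
        \<le> (P + M) * (l t * exp (5 * integral {0..t} l))"
        using F AE_space
      proof eventually_elim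
        fix t assume Ft: "\<forall>\<delta>\<ge>0. (\<forall>s\<in>{0..t}. norm (y1 s - y2 s) \<le> \<delta>) \<longrightarrow> norm (F1 t - F2 t) \<le> l1 t * \<delta>"
          and "t \<in> space (lebesgue_on {0..T})"
        then have t: "t \<in> {0..T}" by simp
        \<comment> \<open>The forcing at time \<open>t\<close> sees the whole past. Since the weight
          \<open>e\<close> is increasing, its value at \<open>t\<close> bounds the distance of the
          inputs at all earlier times.\<close>
        define \<delta> where "\<delta> = sqrt ((P + M) * e t)"
        have PM: "0 \<le> (P + M) * e t" using P M by (simp add: e_def)
        have \<delta>2: "\<delta>\<^sup>2 = (P + M) * e t" using PM by (simp add: \<delta>_def)
        have \<delta>0: "0 \<le> \<delta>" using PM by (simp add: \<delta>_def)
        have "norm (y1 s - y2 s) \<le> \<delta>" if s: "s \<in> {0..t}" for s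
        proof (rule power2_le_imp_le[OF _ \<delta>0])
          have s': "s \<in> {0..T}" using s t by auto
          have "(norm (y1 s - y2 s))\<^sup>2 \<le> P * e s + M * e s"
            using P(2)[OF s'] dM[OF s'] by (simp add: e_def d_def l_def[abs_def])
          also have "\<dots> \<le> (P + M) * e t"
            using lint[of s t] s t P M by (auto simp: e_def simp flip: distrib_right intro!: mult_left_mono)
          finally show "(norm (y1 s - y2 s))\<^sup>2 \<le> \<delta>\<^sup>2" by (simp add: \<delta>2)
        qed
        then have "norm (F1 t - F2 t) \<le> l1 t * \<delta>" using Ft \<delta>0 by blast
        then have "2 * norm (F1 t - F2 t) * d t \<le> 2 * (l1 t * \<delta>) * d t"
          by (intro mult_right_mono) (auto simp: d_def)
        also have "\<dots> = l1 t * (2 * \<delta> * d t)" by simp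
        also have "\<dots> \<le> l1 t * (\<delta>\<^sup>2 + (d t)\<^sup>2)"
          using sum_squares_bound[of \<delta> "d t"] l1(2)[OF t] by (intro mult_left_mono) auto
        also have "\<dots> \<le> l1 t * (2 * ((P + M) * e t))"
        proof (rule mult_left_mono[OF _ l1(2)[OF t]])
          have "(d t)\<^sup>2 \<le> M * e t" using dM[OF t] by (simp add: e_def)
          also have "\<dots> \<le> (P + M) * e t" using P by (intro mult_right_mono) (auto simp: e_def)
          finally show "\<delta>\<^sup>2 + (d t)\<^sup>2 \<le> 2 * ((P + M) * e t)" unfolding \<delta>2 by linarith
        qed
        finally have 1: "2 * norm (F1 t - F2 t) * d t \<le> 2 * l1 t * ((P + M) * e t)" by simp
        have "(d t)\<^sup>2 \<le> (P + M) * e t"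
        proof -
          have "(d t)\<^sup>2 \<le> M * e t" using dM[OF t] by (simp add: e_def)
          also have "\<dots> \<le> (P + M) * e t" using P by (intro mult_right_mono) (auto simp: e_def)
          finally show ?thesis .
        qed
        then have 2: "2 * \<nu> t / r * (d t)\<^sup>2 \<le> 2 * \<nu> t / r * ((P + M) * e t)"
          by (rule mult_left_mono) (use \<nu>(2)[OF t] r in simp)
        have "2 * norm (F1 t - F2 t) * d t + 2 * \<nu> t / r * (d t)\<^sup>2 \<le> l t * ((P + M) * e t)"
          using add_mono[OF 1 2] by (simp only: l_def distrib_right)
        then show "2 * norm (F1 t - F2 t) * norm (x1 t - x2 t) + 2 * \<nu> t / r * (norm (x1 t - x2 t))\<^sup>2
          \<le> (P + M) * (l t * exp (5 * integral {0..t} l))"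
          by (simp add: d_def e_def mult.left_commute)
      qed
    qed
  qed (auto simp: d_def)
  then show ?thesis by (simp add: d_def l_def[abs_def])
qed

locale volterra_sweeping = moving_set T r \<rho> C w
  for T r :: real and \<rho> :: ereal and C :: "real \<Rightarrow> 'a::{real_inner,complete_space} set" and w :: "real \<Rightarrow> real" +
  fixes f :: "real \<Rightarrow> 'a \<Rightarrow> 'a" and \<alpha> \<beta> :: "real \<Rightarrow> real" and g :: "real \<Rightarrow> real \<Rightarrow> 'a \<Rightarrow> 'a"
    and \<sigma> :: "real \<times> real \<Rightarrow> real" and D :: "(real \<times> real) set"
  assumes D: "D = {(t, s). t \<in> {0..T} \<and> s \<in> {0..T} \<and> s \<le> t}"
    and f_meas: "\<And>x. strongly_measurable (lebesgue_on {0..T}) (\<lambda>t. f t x)"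
    and \<alpha>: "integrable (lebesgue_on {0..T}) \<alpha>" "\<And>t. t \<in> {0..T} \<Longrightarrow> \<alpha> t \<ge> 0"
    and \<beta>: "integrable (lebesgue_on {0..T}) \<beta>" "\<And>t. t \<in> {0..T} \<Longrightarrow> \<beta> t \<ge> 0"
    and f_growth: "\<And>t x. t \<in> {0..T} \<Longrightarrow> norm (f t x) \<le> \<alpha> t * norm x + \<beta> t"
    and f_lip: "\<And>r. r > 0 \<Longrightarrow> \<exists>\<kappa>\<ge>0. \<forall>t\<in>{0..T}. \<forall>x\<in>cball 0 r. \<forall>y\<in>cball 0 r.
          norm (f t x - f t y) \<le> \<kappa> * norm (x - y)"
    and g_meas: "\<And>x. strongly_measurable (lebesgue_on ({0..T} \<times> {0..T})) (\<lambda>(t, s). g t s x)"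
    and g_lip: "\<And>r. r > 0 \<Longrightarrow> \<exists>\<mu>. integrable (lebesgue_on {0..T}) \<mu> \<and>
          (\<forall>t\<in>{0..T}. \<mu> t \<ge> 0) \<and>
          (\<forall>(t, s)\<in>D. \<forall>x\<in>cball 0 r. \<forall>y\<in>cball 0 r.
            norm (g t s x - g t s y) \<le> \<mu> t * norm (x - y))"
    and \<sigma>: "integrable (lebesgue_on D) \<sigma>" "\<And>t s. (t, s) \<in> D \<Longrightarrow> \<sigma> (t, s) \<ge> 0"
    and g_growth: "\<And>t s x. (t, s) \<in> D \<Longrightarrow> norm (g t s x) \<le> \<sigma> (t, s) * (1 + norm x)"
begin

definition memory :: "(real \<Rightarrow> 'a) \<Rightarrow> real \<Rightarrow> 'a" where
  "memory x t = strong_integral (lebesgue_on {0..t}) (\<lambda>s. g t s (x s))"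

definition forcing :: "(real \<Rightarrow> 'a) \<Rightarrow> real \<Rightarrow> 'a" where
  "forcing x t = f t (x t) + memory x t"

text \<open>Extension by zero from the triangle to the square, where Fubini's theorem is stated;
  \<open>kernel\<close> below extends the integrand in the same way.\<close>

definition \<sigma>0 :: "real \<times> real \<Rightarrow> real" where "\<sigma>0 z = indicat_real D z *\<^sub>R \<sigma> z"

text \<open>The linear growth rate of the memory term, integrable in time by Fubini's
  theorem.\<close>

definition \<gamma> :: "real \<Rightarrow> real" where "\<gamma> t = (LINT s|lebesgue_on {0..T}. \<sigma>0 (t, s))"

definition kernel :: "(real \<Rightarrow> 'a) \<Rightarrow> real \<times> real \<Rightarrow> 'a" where
  "kernel x z = indicat_real D z *\<^sub>R g (fst z) (snd z) (x (snd z))"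

lemma D_sub: "D \<subseteq> {0..T} \<times> {0..T}"
  by (auto simp: D)

lemma D_sets: "D \<in> sets lebesgue"
proof -
  have "D = ({0..T} \<times> {0..T}) \<inter> {z. snd z \<le> fst z}" by (auto simp: D)
  moreover have "closed (({0..T} \<times> {0..T::real}) \<inter> {z. snd z \<le> fst z})"
    by (intro closed_Int closed_Times closed_Collect_le continuous_intros)
  ultimately show ?thesis by (simp add: borel_closed)
qed

lemma \<sigma>0_integrable: "integrable (lebesgue_on ({0..T} \<times> {0..T})) \<sigma>0"
proof -
  have "integrable lebesgue \<sigma>0"
    unfolding \<sigma>0_def using \<sigma>(1) D_sets by (subst (asm) integrable_restrict_space) auto
  then have "integrable lebesgue (\<lambda>z. indicat_real ({0..T} \<times> {0..T}) z *\<^sub>R \<sigma>0 z)"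
    by (rule integrable_mult_indicator[OF square_sets])
  then show ?thesis using square_sets by (subst integrable_restrict_space) auto
qed

lemma \<sigma>0_nonneg: "0 \<le> \<sigma>0 z"
  using \<sigma>(2)[of "fst z" "snd z"] by (auto simp: \<sigma>0_def indicator_def)

lemma \<gamma>: "integrable (lebesgue_on {0..T}) \<gamma>" "0 \<le> \<gamma> t"
proof -
  show "integrable (lebesgue_on {0..T}) \<gamma>"
    using square_real_Fubini(2)[OF \<sigma>0_integrable] by (simp add: \<gamma>_def[abs_def])
  show "0 \<le> \<gamma> t" unfolding \<gamma>_def by (rule Bochner_Integration.integral_nonneg) (rule \<sigma>0_nonneg)
qed

lemma kernel_bound: "norm (kernel x (t, s)) \<le> \<sigma>0 (t, s) * (1 + norm (x s))"
  using g_growth[of t s "x s"] by (auto simp: kernel_def \<sigma>0_def indicator_def)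

lemma g_continuous: "(t, s) \<in> D \<Longrightarrow> continuous_on UNIV (g t s)"
proof (rule continuous_on_locally_Lipschitz)
  fix R :: real assume ts: "(t, s) \<in> D" and "R > 0"
  then obtain \<mu> where "\<forall>(t, s)\<in>D. \<forall>x\<in>cball 0 R. \<forall>y\<in>cball 0 R. norm (g t s x - g t s y) \<le> \<mu> t * norm (x - y)"
    using g_lip by meson
  then show "\<exists>L. \<forall>x\<in>cball 0 R. \<forall>y\<in>cball 0 R. norm (g t s x - g t s y) \<le> L * norm (x - y)"
    using ts by (intro exI[of _ "\<mu> t"]) fastforce
qed

lemma f_continuous: "t \<in> {0..T} \<Longrightarrow> continuous_on UNIV (f t)"
proof (rule continuous_on_locally_Lipschitz)
  fix R :: real assume "t \<in> {0..T}" and "R > 0"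
  then show "\<exists>L. \<forall>x\<in>cball 0 R. \<forall>y\<in>cball 0 R. norm (f t x - f t y) \<le> L * norm (x - y)"
    using f_lip[of R] by blast
qed

lemma kernel_measurable:
  assumes x: "continuous_on {0..T} x"
  shows "strongly_measurable (lebesgue_on ({0..T} \<times> {0..T})) (kernel x)"
proof -
  let ?M = "lebesgue_on ({0..T} \<times> {0..T::real})"
  have "strongly_measurable ?M (\<lambda>z. indicat_real D z *\<^sub>R g (fst z) (snd z) (x (snd z)))"
  proof (rule strongly_measurable_Caratheodory[OF T complete_measure_lebesgue_on[OF square_sets] square_finite _ _ _ _ x,
        where \<Phi>="\<lambda>z c. indicat_real D z *\<^sub>R g (fst z) (snd z) c"])
    show "snd \<in> borel_measurable ?M"
      by (intro measurable_restrict_space1 measurable_completion) (simp add: borel_measurable_continuous_onI continuous_on_snd continuous_on_id)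
    show "strongly_measurable ?M (\<lambda>z. indicat_real D z *\<^sub>R g (fst z) (snd z) c)" for c
    proof (rule strongly_measurable_scaleR)
      have "D \<in> sets ?M" using D_sets D_sub square_sets by (subst sets_restrict_space_iff) auto
      then show "strongly_measurable ?M (indicat_real D)"
        by (intro strongly_measurable_simple simple_function_indicator)
      show "strongly_measurable ?M (\<lambda>z. g (fst z) (snd z) c)"
        using g_meas[of c] by (simp add: case_prod_unfold)
    qed
    show "AE z in ?M. continuous_on UNIV (\<lambda>c. indicat_real D z *\<^sub>R g (fst z) (snd z) c)"
    proof (rule AE_I2)
      fix z
      show "continuous_on UNIV (\<lambda>c. indicat_real D z *\<^sub>R g (fst z) (snd z) c)"
        using g_continuous[of "fst z" "snd z"] by (cases "z \<in> D") auto
    qed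
  qed auto
  then show ?thesis by (simp add: kernel_def[abs_def])
qed

text \<open>Fubini's theorem on the square gives integrability and measurability, and the integral
  of the extended kernel over \<open>{0..T}\<close> is the one over \<open>{0..t}\<close>. The bound
  \<open>b\<close> is quantified inside the almost everywhere statement: the exceptional set does
  not depend on it, so \<open>b\<close> may later vary with \<open>t\<close>.\<close>

lemma memory_AE:
  assumes x: "continuous_on {0..T} x"
  shows "AE t in lebesgue_on {0..T}. strongly_integrable (lebesgue_on {0..t}) (\<lambda>s. g t s (x s)) \<and>
      memory x t = strong_integral (lebesgue_on {0..T}) (\<lambda>s. kernel x (t, s)) \<and>
      (\<forall>b. (\<forall>s\<in>{0..t}. norm (x s) \<le> b) \<longrightarrow> norm (memory x t) \<le> \<gamma> t * (1 + b))"
    and "strongly_measurable (lebesgue_on {0..T}) (memory x)"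
proof -
  note C = complete_measure_interval
  obtain R where R: "\<And>s. s \<in> {0..T} \<Longrightarrow> norm (x s) \<le> R"
    using compact_imp_bounded[OF compact_continuous_image[OF x]] unfolding bounded_iff by (auto simp del: atLeastAtMost_iff)
  have kb: "norm (kernel x (t, s)) \<le> \<sigma>0 (t, s) * (1 + R)" if "t \<in> {0..T}" "s \<in> {0..T}" for t s
    by (rule order_trans[OF kernel_bound]) (use R[OF that(2)] \<sigma>0_nonneg in \<open>auto intro!: mult_left_mono\<close>)
  have ib: "integrable (lebesgue_on ({0..T} \<times> {0..T})) (\<lambda>z. \<sigma>0 z * (1 + R))"
    using \<sigma>0_integrable by simp
  have F: "AE t in lebesgue_on {0..T}. strongly_integrable (lebesgue_on {0..T}) (\<lambda>s. kernel x (t, s))"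
    "strongly_measurable (lebesgue_on {0..T}) (\<lambda>t. strong_integral (lebesgue_on {0..T}) (\<lambda>s. kernel x (t, s)))"
    by (rule square_Fubini[OF kernel_measurable[OF x] ib], rule kb, assumption+)+
  show AE: "AE t in lebesgue_on {0..T}. strongly_integrable (lebesgue_on {0..t}) (\<lambda>s. g t s (x s)) \<and>
      memory x t = strong_integral (lebesgue_on {0..T}) (\<lambda>s. kernel x (t, s)) \<and>
      (\<forall>b. (\<forall>s\<in>{0..t}. norm (x s) \<le> b) \<longrightarrow> norm (memory x t) \<le> \<gamma> t * (1 + b))"
    using F(1) square_real_Fubini(1)[OF \<sigma>0_integrable] AE_space
  proof eventually_elim
    fix t assume k: "strongly_integrable (lebesgue_on {0..T}) (\<lambda>s. kernel x (t, s))"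
      and s0: "integrable (lebesgue_on {0..T}) (\<lambda>s. \<sigma>0 (t, s))" and "t \<in> space (lebesgue_on {0..T})"
    then have t: "0 \<le> t" "t \<le> T" by auto
    have k': "strongly_integrable (lebesgue_on {0..t}) (\<lambda>s. kernel x (t, s))"
      by (rule strongly_integrable_subinterval[OF k]) (use t in auto)
    have "AE s in lebesgue_on {0..t}. kernel x (t, s) = g t s (x s)"
    proof (rule AE_I2)
      fix s assume "s \<in> space (lebesgue_on {0..t})"
      then have "(t, s) \<in> D" unfolding D using t by auto
      then show "kernel x (t, s) = g t s (x s)" by (simp add: kernel_def)
    qed
    note g = strongly_integrable_cong_AE[OF C k' this]
    have "norm (strong_integral (lebesgue_on {0..T}) (\<lambda>s. kernel x (t, s)) - strong_integral (lebesgue_on {0..t}) (\<lambda>s. kernel x (t, s)))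
      \<le> integral {t..T} (\<lambda>s. norm (kernel x (t, s)))"
      by (rule norm_strong_integral_diff_le[OF k t]) simp
    \<comment> \<open>The diagonal point \<open>s = t\<close> belongs to \<open>D\<close>, so the
      kernel vanishes only off this single point.\<close>
    also have "\<dots> = integral {t..T} (\<lambda>s. 0)"
    proof (rule integral_spike[of "{t}"])
      fix s assume "s \<in> {t..T} - {t}"
      then have "(t, s) \<notin> D" unfolding D by auto
      then show "0 = norm (kernel x (t, s))" by (simp add: kernel_def)
    qed simp
    finally have eq: "memory x t = strong_integral (lebesgue_on {0..T}) (\<lambda>s. kernel x (t, s))"
      using g(2) by (simp add: memory_def)
    have "norm (memory x t) \<le> \<gamma> t * (1 + b)" if b: "\<forall>s\<in>{0..t}. norm (x s) \<le> b" for b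
    proof -
      have "norm (memory x t) \<le> (LINT s|lebesgue_on {0..T}. norm (kernel x (t, s)))"
        unfolding eq by (rule norm_strong_integral_le[OF C k])
      also have "\<dots> \<le> (LINT s|lebesgue_on {0..T}. \<sigma>0 (t, s) * (1 + b))"
      proof (rule integral_mono)
        fix s
        show "norm (kernel x (t, s)) \<le> \<sigma>0 (t, s) * (1 + b)"
        proof (cases "(t, s) \<in> D")
          case True
          then have "norm (x s) \<le> b" using b by (auto simp: D)
          then have "\<sigma>0 (t, s) * (1 + norm (x s)) \<le> \<sigma>0 (t, s) * (1 + b)" by (intro mult_left_mono \<sigma>0_nonneg) simp
          then show ?thesis using kernel_bound[of x t s] by simp
        qed (simp add: kernel_def \<sigma>0_def)
      qed (use s0 strongly_integrable_norm[OF C k] in auto)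
      finally show ?thesis by (simp add: \<gamma>_def)
    qed
    then show "strongly_integrable (lebesgue_on {0..t}) (\<lambda>s. g t s (x s)) \<and>
      memory x t = strong_integral (lebesgue_on {0..T}) (\<lambda>s. kernel x (t, s)) \<and>
      (\<forall>b. (\<forall>s\<in>{0..t}. norm (x s) \<le> b) \<longrightarrow> norm (memory x t) \<le> \<gamma> t * (1 + b))"
      using g(1) eq by blast
  qed
  show "strongly_measurable (lebesgue_on {0..T}) (memory x)"
    by (rule strongly_measurable_AE[OF F(2)]) (use AE in \<open>auto elim: eventually_mono\<close>)
qed

lemma memory_integrable:
  assumes "continuous_on {0..T} x"
  shows "AE t in lebesgue_on {0..T}. strongly_integrable (lebesgue_on {0..t}) (\<lambda>s. g t s (x s))"
  using memory_AE(1)[OF assms] by eventually_elim blast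

lemma memory_bound:
  assumes "continuous_on {0..T} x"
  shows "AE t in lebesgue_on {0..T}. \<forall>b. (\<forall>s\<in>{0..t}. norm (x s) \<le> b) \<longrightarrow> norm (memory x t) \<le> \<gamma> t * (1 + b)"
  using memory_AE(1)[OF assms] by eventually_elim blast

lemma forcing_measurable:
  assumes x: "continuous_on {0..T} x"
  shows "strongly_measurable (lebesgue_on {0..T}) (forcing x)"
proof -
  have "finite_measure (lebesgue_on {0..T})" by (rule finite_measure_lebesgue_on) simp
  then have "strongly_measurable (lebesgue_on {0..T}) (\<lambda>t. f t (x ((\<lambda>t. t) t)))"
    using f_continuous f_meas
    by (intro strongly_measurable_Caratheodory[OF T complete_measure_interval _ _ _ _ _ x, where \<Phi>=f])
      (auto intro!: AE_I2 measurable_restrict_space1 measurable_completion)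
  then show ?thesis
    unfolding forcing_def[abs_def] by (intro strongly_measurable_add memory_AE(2)[OF x]) simp
qed

lemma forcing_bound:
  assumes x: "continuous_on {0..T} x"
  shows "AE t in lebesgue_on {0..T}. \<forall>b. (\<forall>s\<in>{0..t}. norm (x s) \<le> b) \<longrightarrow> norm (forcing x t) \<le> (\<alpha> t + \<gamma> t) * (1 + b) + \<beta> t"
  using memory_bound[OF x] AE_space
proof eventually_elim
  fix t assume m: "\<forall>b. (\<forall>s\<in>{0..t}. norm (x s) \<le> b) \<longrightarrow> norm (memory x t) \<le> \<gamma> t * (1 + b)"
    and "t \<in> space (lebesgue_on {0..T})"
  then have t: "t \<in> {0..T}" by simp
  show "\<forall>b. (\<forall>s\<in>{0..t}. norm (x s) \<le> b) \<longrightarrow> norm (forcing x t) \<le> (\<alpha> t + \<gamma> t) * (1 + b) + \<beta> t"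
  proof (intro allI impI)
    fix b assume b: "\<forall>s\<in>{0..t}. norm (x s) \<le> b"
    have "norm (forcing x t) \<le> norm (f t (x t)) + norm (memory x t)" unfolding forcing_def by (rule norm_triangle_ineq)
    also have "\<dots> \<le> (\<alpha> t * norm (x t) + \<beta> t) + \<gamma> t * (1 + b)" using m b f_growth[OF t] by (intro add_mono) auto
    also have "\<alpha> t * norm (x t) \<le> \<alpha> t * (1 + b)"
      using b t \<alpha>(2)[OF t] by (intro mult_left_mono) (auto simp: add_increasing)
    finally show "norm (forcing x t) \<le> (\<alpha> t + \<gamma> t) * (1 + b) + \<beta> t" by (simp add: algebra_simps)
  qed
qed

text \<open>The memory term contributes the constant \<open>\<mu> t\<close> of \<open>g\<close>
  times the length of the past, at most \<open>T\<close>. The quantifier over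
  \<open>\<delta>\<close> stands inside the almost everywhere statement because
  \<open>\<delta>\<close> is chosen depending on \<open>t\<close> in the contraction
  estimate.\<close>

lemma forcing_lipschitz:
  assumes R: "R > 0"
  obtains l where "integrable (lebesgue_on {0..T}) l" "\<And>t. t \<in> {0..T} \<Longrightarrow> 0 \<le> l t"
    "\<And>x y. continuous_on {0..T} x \<Longrightarrow> continuous_on {0..T} y \<Longrightarrow>
      (\<And>t. t \<in> {0..T} \<Longrightarrow> norm (x t) \<le> R) \<Longrightarrow> (\<And>t. t \<in> {0..T} \<Longrightarrow> norm (y t) \<le> R) \<Longrightarrow>
      AE t in lebesgue_on {0..T}. \<forall>\<delta>\<ge>0. (\<forall>s\<in>{0..t}. norm (x s - y s) \<le> \<delta>) \<longrightarrow> norm (forcing x t - forcing y t) \<le> l t * \<delta>"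
proof -
  note C = complete_measure_interval
  interpret finite_measure "lebesgue_on {0..T}" by (rule finite_measure_lebesgue_on) simp
  obtain \<kappa> where \<kappa>: "\<kappa> \<ge> 0" "\<And>t x y. t \<in> {0..T} \<Longrightarrow> x \<in> cball 0 R \<Longrightarrow> y \<in> cball 0 R \<Longrightarrow> norm (f t x - f t y) \<le> \<kappa> * norm (x - y)"
    using f_lip[OF R] by blast
  obtain \<mu> where \<mu>: "integrable (lebesgue_on {0..T}) \<mu>" "\<And>t. t \<in> {0..T} \<Longrightarrow> \<mu> t \<ge> 0"
    "\<And>t s x y. (t, s) \<in> D \<Longrightarrow> x \<in> cball 0 R \<Longrightarrow> y \<in> cball 0 R \<Longrightarrow> norm (g t s x - g t s y) \<le> \<mu> t * norm (x - y)"
    using g_lip[OF R] by fast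
  show ?thesis
  proof (rule that[of "\<lambda>t. \<kappa> + T * \<mu> t"])
    show "integrable (lebesgue_on {0..T}) (\<lambda>t. \<kappa> + T * \<mu> t)" using \<mu>(1) by simp
    show "0 \<le> \<kappa> + T * \<mu> t" if "t \<in> {0..T}" for t using \<kappa>(1) \<mu>(2)[OF that] T by simp
    fix x y :: "real \<Rightarrow> 'a" assume x: "continuous_on {0..T} x" and y: "continuous_on {0..T} y"
      and xR: "\<And>t. t \<in> {0..T} \<Longrightarrow> norm (x t) \<le> R" and yR: "\<And>t. t \<in> {0..T} \<Longrightarrow> norm (y t) \<le> R"
    show "AE t in lebesgue_on {0..T}. \<forall>\<delta>\<ge>0. (\<forall>s\<in>{0..t}. norm (x s - y s) \<le> \<delta>) \<longrightarrow> norm (forcing x t - forcing y t) \<le> (\<kappa> + T * \<mu> t) * \<delta>"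
      using memory_integrable[OF x] memory_integrable[OF y] AE_space
    proof eventually_elim
      fix t
      assume gx: "strongly_integrable (lebesgue_on {0..t}) (\<lambda>s. g t s (x s))"
        and gy: "strongly_integrable (lebesgue_on {0..t}) (\<lambda>s. g t s (y s))"
        and "t \<in> space (lebesgue_on {0..T})"
      then have t: "t \<in> {0..T}" by simp
      show "\<forall>\<delta>\<ge>0. (\<forall>s\<in>{0..t}. norm (x s - y s) \<le> \<delta>) \<longrightarrow> norm (forcing x t - forcing y t) \<le> (\<kappa> + T * \<mu> t) * \<delta>"
      proof (intro allI impI)
        fix \<delta> :: real assume \<delta>: "0 \<le> \<delta>" "\<forall>s\<in>{0..t}. norm (x s - y s) \<le> \<delta>"
        note d = strong_integral_diff[OF C gx gy]
        have "norm (memory x t - memory y t) \<le> (LINT s|lebesgue_on {0..t}. norm (g t s (x s) - g t s (y s)))"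
          using norm_strong_integral_le[OF C d(1)] d(2) by (simp add: memory_def)
        also have "\<dots> \<le> (LINT s|lebesgue_on {0..t}. \<mu> t * \<delta>)"
        proof (rule integral_mono)
          interpret Mt: finite_measure "lebesgue_on {0..t}" by (rule finite_measure_lebesgue_on) simp
          show "integrable (lebesgue_on {0..t}) (\<lambda>s. \<mu> t * \<delta>)" by simp
          fix s assume "s \<in> space (lebesgue_on {0..t})"
          then have s: "s \<in> {0..t}" "s \<in> {0..T}" "(t, s) \<in> D" using t by (auto simp: D)
          have "norm (g t s (x s) - g t s (y s)) \<le> \<mu> t * norm (x s - y s)"
            by (rule \<mu>(3)[OF s(3)]) (use xR yR s in auto)
          also have "\<dots> \<le> \<mu> t * \<delta>" using \<delta> s \<mu>(2)[OF t] by (intro mult_left_mono) auto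
          finally show "norm (g t s (x s) - g t s (y s)) \<le> \<mu> t * \<delta>" .
        qed (rule strongly_integrable_norm[OF C d(1)])
        also have "\<dots> = t * (\<mu> t * \<delta>)" using t by (simp add: measure_restrict_space)
        also have "\<dots> \<le> T * (\<mu> t * \<delta>)" using t \<mu>(2)[OF t] \<delta> by (intro mult_right_mono) auto
        finally have 1: "norm (memory x t - memory y t) \<le> T * \<mu> t * \<delta>" by simp
        have "norm (f t (x t) - f t (y t)) \<le> \<kappa> * norm (x t - y t)"
          by (rule \<kappa>(2)[OF t]) (use xR yR t in auto)
        also have "\<dots> \<le> \<kappa> * \<delta>" using \<delta> t \<kappa>(1) by (intro mult_left_mono) auto
        finally have 2: "norm (f t (x t) - f t (y t)) \<le> \<kappa> * \<delta>" .
        have "forcing x t - forcing y t = (f t (x t) - f t (y t)) + (memory x t - memory y t)"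
          by (simp add: forcing_def)
        then have "norm (forcing x t - forcing y t) \<le> norm (f t (x t) - f t (y t)) + norm (memory x t - memory y t)"
          by (simp only: norm_triangle_ineq)
        then show "norm (forcing x t - forcing y t) \<le> (\<kappa> + T * \<mu> t) * \<delta>" using 1 2 by (simp add: distrib_right)
      qed
    qed
  qed
qed

lemma forcing_integrable:
  assumes x: "continuous_on {0..T} x" and m: "integrable (lebesgue_on {0..T}) m"
    "AE t in lebesgue_on {0..T}. norm (forcing x t) \<le> m t"
  shows "strongly_integrable (lebesgue_on {0..T}) (forcing x)"
  by (rule strongly_integrable_bound[OF complete_measure_interval forcing_measurable[OF x] m])

end

section \<open>Existence by Picard iteration, and uniqueness\<close>

context volterra_sweeping
begin

text \<open>The iteration runs in the class \<open>adm\<close> of continuous curves below the a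
  priori bound \<open>E\<close>. All iterates satisfy the integrated formulation with the same
  \<open>V\<close>; the derivative is formed only for the limit.\<close>

lemma sweeping_solution_exists:
  assumes x0: "x0 \<in> C 0"
  shows "\<exists>x. sweeping_solution T C f g x0 x"
proof -
  note CM = complete_measure_interval
  \<comment> \<open>The forcing bound enters twice, once through the motion of the translated sets
    and once through the primitive of the forcing. This is the origin of the factor 2 here and in
    \<open>c\<close>.\<close>
  define a where "a t = 2 * (\<alpha> t + \<gamma> t)" for t
  have a: "integrable (lebesgue_on {0..T}) a" "\<And>t. t \<in> {0..T} \<Longrightarrow> 0 \<le> a t"
    using \<alpha> \<gamma> by (auto simp: a_def[abs_def])
  define c where "c t = w t + 2 * \<beta> t" for t
  have c: "integrable (lebesgue_on {0..T}) c" "\<And>t. t \<in> {0..T} \<Longrightarrow> 0 \<le> c t"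
    using w \<beta> by (auto simp: c_def[abs_def])
  define K where "K = 1 + norm x0 + integral {0..T} c"
  have cT: "integral {0..t} c \<le> integral {0..T} c" if "t \<in> {0..T}" for t
    using integral_combine_diff[OF c(1), of t T] integral_nonneg_mono[OF c, of t T] that by simp
  have K: "1 + norm x0 \<le> K" using integral_nonneg_mono[OF c, of 0 T] T by (simp add: K_def)
  then have K0: "1 \<le> K" using norm_ge_zero[of x0] by linarith
  \<comment> \<open>\<open>E\<close> solves the linear equation with derivative \<open>a * E\<close>
    and initial value \<open>K\<close>, so the bound \<open>1 + norm (x t) \<le> E t\<close>
    reproduces itself under the Picard map. The factor 1 in the exponent is the constant
    \<open>c\<close> of \<open>integral_exp_primitive_le\<close>.\<close>
  define E where "E t = K * exp (1 * integral {0..t} a)" for t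
  have aint: "integral {0..s} a \<le> integral {0..t} a" if "0 \<le> s" "s \<le> t" "t \<le> T" for s t
    using integral_combine_diff[OF a(1) that] integral_nonneg_mono[OF a that] by simp
  have Emono: "E s \<le> E t" if "0 \<le> s" "s \<le> t" "t \<le> T" for s t
    unfolding E_def using aint[OF that] K0 by (intro mult_left_mono) auto
  have EK: "K \<le> E t" if "t \<in> {0..T}" for t
    using Emono[of 0 t] that by (simp add: E_def)
  define m where "m t = (\<alpha> t + \<gamma> t) * E t + \<beta> t" for t
  have aE: "integrable (lebesgue_on {0..T}) (\<lambda>s. a s * exp (1 * integral {0..s} a))"
    by (intro integrable_continuous_mult[OF a(1)] continuous_intros continuous_on_integral[OF a(1)])
  have m_eq: "m t = K / 2 * (a t * exp (1 * integral {0..t} a)) + \<beta> t" for t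
    by (simp add: m_def a_def E_def)
  have m: "integrable (lebesgue_on {0..T}) m" "\<And>t. t \<in> {0..T} \<Longrightarrow> 0 \<le> m t"
  proof -
    show "integrable (lebesgue_on {0..T}) m"
      unfolding m_eq[abs_def] by (intro Bochner_Integration.integrable_add integrable_mult_right aE \<beta>(1))
    show "0 \<le> m t" if "t \<in> {0..T}" for t
      unfolding m_eq using a(2)[OF that] \<beta>(2)[OF that] K0 by simp
  qed
  define \<phi> where "\<phi> t = w t + m t" for t
  have \<phi>: "integrable (lebesgue_on {0..T}) \<phi>" "\<And>t. t \<in> {0..T} \<Longrightarrow> 0 \<le> \<phi> t"
    using w m by (auto simp: \<phi>_def[abs_def])
  have m\<phi>: "m t \<le> \<phi> t" if "t \<in> {0..T}" for t using w(2)[OF that] by (simp add: \<phi>_def)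
  define V where "V t = integral {0..t} \<phi>" for t
  define adm where "adm x \<longleftrightarrow> continuous_on {0..T} x \<and> (\<forall>t\<in>{0..T}. 1 + norm (x t) \<le> E t)" for x :: "real \<Rightarrow> 'a"
  have Fm: "AE t in lebesgue_on {0..T}. norm (forcing x t) \<le> m t" if "adm x" for x
  proof -
    have x: "continuous_on {0..T} x" "\<And>t. t \<in> {0..T} \<Longrightarrow> 1 + norm (x t) \<le> E t" using that by (auto simp: adm_def)
    show ?thesis using forcing_bound[OF x(1)] AE_space
    proof eventually_elim
      fix t assume b: "\<forall>b. (\<forall>s\<in>{0..t}. norm (x s) \<le> b) \<longrightarrow> norm (forcing x t) \<le> (\<alpha> t + \<gamma> t) * (1 + b) + \<beta> t"
        and "t \<in> space (lebesgue_on {0..T})"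
      then have t: "t \<in> {0..T}" by simp
      have "norm (x s) \<le> E t - 1" if "s \<in> {0..t}" for s
        using x(2)[of s] Emono[of s t] that t by simp
      then have "norm (forcing x t) \<le> (\<alpha> t + \<gamma> t) * (1 + (E t - 1)) + \<beta> t" using b by blast
      then show "norm (forcing x t) \<le> m t" by (simp add: m_def)
    qed
  qed
  have Fi: "strongly_integrable (lebesgue_on {0..T}) (forcing x)" if "adm x" for x
    using that by (intro forcing_integrable[OF _ m(1) Fm]) (auto simp: adm_def)
  define G where "G x t = strong_integral (lebesgue_on {0..t}) (forcing x)" for x t
  have F\<phi>: "AE t in lebesgue_on {0..T}. norm (forcing x t) \<le> \<phi> t" if "adm x" for x
    using Fm[OF that] AE_space by eventually_elim (use m\<phi> in \<open>auto intro: order_trans\<close>)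
  have lip: "norm (y t - y s) \<le> integral {s..t} (\<lambda>s. 2 * \<phi> s)"
    if "adm x" "integrated_sweeping T r C V (G x) y" "0 \<le> s" "s \<le> t" "t \<le> T" for x y s t
    using integrated_sweeping_lipschitz[OF _ \<phi>(1) Fi[OF that(1)] F\<phi>[OF that(1)] that(3-5)] that(2)
    unfolding V_def[abs_def] G_def[abs_def] by blast
  have \<phi>2: "integrable (lebesgue_on {0..T}) (\<lambda>s. 2 * \<phi> s)" using \<phi> by simp
  have step: "\<exists>y. y 0 = x0 \<and> adm y \<and> integrated_sweeping T r C V (G x) y" if x: "adm x" for x
  proof -
    obtain y where y: "y 0 = x0" "integrated_sweeping T r C V (G x) y"
      using integrated_sweeping_exists[OF Fi[OF x] m Fm[OF x] x0]
      unfolding V_def[abs_def] G_def[abs_def] \<phi>_def[abs_def] by blast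
    have "1 + norm (y t) \<le> E t" if t: "t \<in> {0..T}" for t
    proof -
      have "norm (y t - y 0 - (G x t - G x 0)) \<le> V t - V 0"
        using y(2) t unfolding integrated_sweeping_def by auto
      then have 1: "norm (y t - x0 - G x t) \<le> integral {0..t} \<phi>"
        by (simp add: y(1) G_def V_def)
      have 2: "norm (G x t) \<le> integral {0..t} m"
        using norm_primitive_diff_le[OF Fi[OF x] m(1) Fm[OF x], of 0 t] t by (simp add: G_def)
      have "norm (y t) \<le> norm x0 + norm (y t - x0 - G x t) + norm (G x t)"
      proof -
        have "y t = x0 + (y t - x0 - G x t) + G x t" by simp
        then show ?thesis by (metis norm_triangle_ineq add_right_mono order_trans)
      qed
      also have "\<dots> \<le> norm x0 + integral {0..t} \<phi> + integral {0..t} m" using 1 2 by simp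
      also have "integral {0..t} \<phi> + integral {0..t} m = integral {0..t} (\<lambda>s. \<phi> s + m s)"
        using t by (intro integral_add_on[OF \<phi>(1) m(1), symmetric]) auto
      then have "norm x0 + integral {0..t} \<phi> + integral {0..t} m = norm x0 + integral {0..t} (\<lambda>s. \<phi> s + m s)" by simp
      \<comment> \<open>The sum is \<open>w + 2 * m\<close>; its part linear in \<open>E\<close> is
        \<open>a * E\<close>, whose integral is at most \<open>E t - K\<close>.\<close>
      also have "(\<lambda>s. \<phi> s + m s) = (\<lambda>s. c s + K * (a s * exp (1 * integral {0..s} a)))"
        by (simp add: fun_eq_iff \<phi>_def c_def m_eq)
      also have "integral {0..t} (\<lambda>s. c s + K * (a s * exp (1 * integral {0..s} a)))
        = integral {0..t} c + integral {0..t} (\<lambda>s. K * (a s * exp (1 * integral {0..s} a)))"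
        using t by (intro integral_add_on[OF c(1) integrable_mult_right[OF aE]]) auto
      also have "integral {0..t} (\<lambda>s. K * (a s * exp (1 * integral {0..s} a)))
        = K * integral {0..t} (\<lambda>s. a s * exp (1 * integral {0..s} a))"
        by (rule integral_mult_right)
      also have "\<dots> \<le> K * ((exp (1 * integral {0..t} a) - 1) / 1)"
        using integral_exp_primitive_le[OF T a _ t, of 1] K0 by (intro mult_left_mono) auto
      finally have "norm (y t) \<le> norm x0 + (integral {0..T} c + (E t - K))"
        using cT[OF t] by (simp add: E_def algebra_simps)
      then show ?thesis by (simp add: K_def)
    qed
    moreover have "continuous_on {0..T} y"
      by (rule continuous_on_if_dominated[OF \<phi>2]) (rule lip[OF x y(2)])
    ultimately show ?thesis using y by (auto simp: adm_def)
  qed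
  define S where "S x = (SOME y. y 0 = x0 \<and> adm y \<and> integrated_sweeping T r C V (G x) y)" for x
  have S: "S x 0 = x0" "adm (S x)" "integrated_sweeping T r C V (G x) (S x)" if "adm x" for x
    using someI_ex[OF step[OF that]] by (auto simp: S_def)
  define X where "X n = (S ^^ n) (\<lambda>_. x0)" for n
  have XS: "X (Suc n) = S (X n)" for n by (simp add: X_def)
  have Xa: "adm (X n)" for n
  proof (induction n)
    case 0
    have "1 + norm x0 \<le> E t" if "t \<in> {0..T}" for t using K EK[OF that] by linarith
    then show ?case by (simp add: X_def adm_def)
  qed (simp add: XS S)
  have X0: "X n 0 = x0" for n by (cases n) (simp_all add: X_def S Xa[unfolded X_def])
  have Xis: "integrated_sweeping T r C V (G (X n)) (X (Suc n))" for n
    unfolding XS by (rule S(3)[OF Xa])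
  \<comment> \<open>All iterates stay in this ball, on which a single Lipschitz function
    \<open>l1\<close> serves for \<open>f\<close> and \<open>g\<close>.\<close>
  define R where "R = E T"
  have R: "1 \<le> R" using EK[of T] K0 T by (simp add: R_def)
  have admR: "norm (x t) \<le> R" if "adm x" "t \<in> {0..T}" for x t
  proof -
    have "1 + norm (x t) \<le> E t" using that by (simp add: adm_def)
    also have "E t \<le> R" unfolding R_def by (rule Emono) (use that in auto)
    finally show ?thesis by simp
  qed
  have R0: "R > 0" using R by simp
  obtain l1 where l1: "integrable (lebesgue_on {0..T}) l1" "\<And>t. t \<in> {0..T} \<Longrightarrow> 0 \<le> l1 t"
    and l1F: "\<And>x y. continuous_on {0..T} x \<Longrightarrow> continuous_on {0..T} y \<Longrightarrow>
      (\<And>t. t \<in> {0..T} \<Longrightarrow> norm (x t) \<le> R) \<Longrightarrow> (\<And>t. t \<in> {0..T} \<Longrightarrow> norm (y t) \<le> R) \<Longrightarrow>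
      AE t in lebesgue_on {0..T}. \<forall>\<delta>\<ge>0. (\<forall>s\<in>{0..t}. norm (x s - y s) \<le> \<delta>) \<longrightarrow> norm (forcing x t - forcing y t) \<le> l1 t * \<delta>"
    using forcing_lipschitz[OF R0] by blast
  have l1A: "AE t in lebesgue_on {0..T}. \<forall>\<delta>\<ge>0. (\<forall>s\<in>{0..t}. norm (x s - y s) \<le> \<delta>) \<longrightarrow> norm (forcing x t - forcing y t) \<le> l1 t * \<delta>"
    if "adm x" "adm y" for x y
    by (rule l1F) (use that admR in \<open>auto simp: adm_def\<close>)
  define l where "l s = 2 * l1 s + 2 * \<phi> s / r" for s
  have l: "integrable (lebesgue_on {0..T}) l" "\<And>t. t \<in> {0..T} \<Longrightarrow> 0 \<le> l t"
    using l1 \<phi> r by (auto simp: l_def[abs_def])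
  define A where "A t = integral {0..t} l" for t
  have A0: "0 \<le> A t" "A t \<le> A T" if "t \<in> {0..T}" for t
    using integral_combine_diff[OF l(1), of t T] integral_nonneg_mono[OF l, of t T] integral_nonneg_mono[OF l, of 0 t] that
    by (auto simp: A_def)
  have incl: "AE t in lebesgue_on {0..T}. inclusion_at T C (forcing x) (\<phi> t) y t"
    if "adm x" "integrated_sweeping T r C V (G x) y" for x y
    using integrated_sweeping_imp_inclusion[OF T r(1) _ \<phi> Fi[OF that(1)]] that(2)
    unfolding V_def[abs_def] G_def[abs_def] by blast
  have contr: "(norm (X (Suc n) t - X n t))\<^sup>2 \<le> 4 * R\<^sup>2 / 4 ^ n * exp (5 * A t)" if t: "t \<in> {0..T}" for n t
    using t
  proof (induction n arbitrary: t)
    case 0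
    have "norm (X (Suc 0) t - X 0 t) \<le> 2 * R"
      using norm_triangle_ineq4[of "X (Suc 0) t" "X 0 t"] admR[OF Xa 0, of "Suc 0"] admR[OF Xa 0, of 0] by linarith
    then have "(norm (X (Suc 0) t - X 0 t))\<^sup>2 \<le> (2 * R)\<^sup>2" by (intro power_mono) auto
    also have "\<dots> \<le> (2 * R)\<^sup>2 * exp (5 * A t)" using A0[OF 0] mult_left_mono[of 1 "exp (5 * A t)" "(2 * R)\<^sup>2"] by simp
    finally show ?case by (simp add: power_mult_distrib)
  next
    case (Suc n)
    \<comment> \<open>The inputs are \<open>X n\<close> and \<open>X (Suc n)\<close>, the outputs
      the next two iterates. The normal vectors of all iterates are bounded by the same
      \<open>\<phi>\<close>.\<close>
    have "(norm (X (Suc n) t - X (Suc (Suc n)) t))\<^sup>2 \<le> (4 * R\<^sup>2 / 4 ^ n) / 4 * exp (5 * integral {0..t} (\<lambda>s. 2 * l1 s + 2 * \<phi> s / r))"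
    proof (rule volterra_contraction[OF \<phi>2 lip[OF Xa Xis] lip[OF Xa Xis] _ incl[OF Xa Xis] incl[OF Xa Xis] \<phi> l1 l1A[OF Xa Xa] _ _ Suc.prems])
      fix t assume t: "t \<in> {0..T}"
      have "(norm (X n t - X (Suc n) t))\<^sup>2 \<le> 4 * R\<^sup>2 / 4 ^ n * exp (5 * A t)"
        using Suc.IH[OF t] by (simp add: norm_minus_commute)
      then show "(norm (X n t - X (Suc n) t))\<^sup>2 \<le> 4 * R\<^sup>2 / 4 ^ n * exp (5 * integral {0..t} (\<lambda>s. 2 * l1 s + 2 * \<phi> s / r))
          + (norm (X (Suc n) t - X (Suc (Suc n)) t))\<^sup>2"
        by (simp add: A_def l_def[abs_def] add_increasing2)
    qed (auto simp: X0)
    then show ?case by (simp add: A_def l_def[abs_def] norm_minus_commute)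
  qed
  \<comment> \<open>The square root of the constant in \<open>contr\<close>, with the weight at its
    maximum; the rate \<open>1 / 4 ^ n\<close> for squares becomes \<open>(1/2) ^ n\<close>.\<close>
  define B where "B = 2 * R * exp (5 * A T / 2)"
  have B0: "B \<ge> 0" using R by (simp add: B_def)
  have Xd: "norm (X (Suc n) t - X n t) \<le> B * (1/2) ^ n" if t: "t \<in> {0..T}" for n t
  proof (rule power2_le_imp_le)
    have "(exp (5 * A T / 2))\<^sup>2 = exp (5 * A T)" by (simp add: power2_eq_square flip: exp_add)
    moreover have "((1/2::real) ^ n)\<^sup>2 = 1 / 4 ^ n" by (simp add: power_divide power2_eq_square flip: power_mult_distrib)
    ultimately have B2: "(B * (1/2) ^ n)\<^sup>2 = 4 * R\<^sup>2 / 4 ^ n * exp (5 * A T)" by (simp add: B_def power_mult_distrib)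
    have "4 * R\<^sup>2 / 4 ^ n * exp (5 * A t) \<le> 4 * R\<^sup>2 / 4 ^ n * exp (5 * A T)"
      using A0[OF t] by (intro mult_left_mono) auto
    then show "(norm (X (Suc n) t - X n t))\<^sup>2 \<le> (B * (1/2) ^ n)\<^sup>2" unfolding B2 using contr[OF t, of n] by linarith
  qed (use B0 in simp)
  define x where "x t = lim (\<lambda>n. X n t)" for t
  have Xlim: "(\<lambda>n. X n t) \<longlonglongrightarrow> x t" if t: "t \<in> {0..T}" for t
  proof -
    have "Cauchy (\<lambda>n. X n t)"
      by (rule Cauchy_if_summable_dist[of _ "\<lambda>n. B * (1/2) ^ n"])
        (use Xd[OF t] in \<open>auto simp: dist_norm intro!: summable_mult summable_geometric\<close>)
    then show ?thesis unfolding x_def using Cauchy_convergent convergent_LIMSEQ_iff by blast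
  qed
  have Xx: "norm (X n t - x t) \<le> 2 * B * (1/2) ^ n" if t: "t \<in> {0..T}" for n t
  proof -
    have "norm (X n t - X (n + k) t) \<le> 2 * B * (1/2) ^ n - 2 * B * (1/2) ^ (n + k)" for k
    proof (induction k)
      case (Suc k)
      have "norm (X n t - X (n + Suc k) t) \<le> norm (X n t - X (n + k) t) + norm (X (Suc (n + k)) t - X (n + k) t)"
        using norm_triangle_ineq4[of "X n t - X (n + k) t" "X (Suc (n + k)) t - X (n + k) t"] by simp
      then show ?case using Suc Xd[OF t, of "n + k"] by simp
    qed simp
    moreover have "0 \<le> 2 * B * (1/2) ^ (n + k)" for k using B0 by simp
    ultimately have "norm (X n t - X (n + k) t) \<le> 2 * B * (1/2) ^ n" for k
      by (meson diff_left_mono order_trans le_diff_eq add_increasing2 order_refl diff_le_eq)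
    then show ?thesis
      by (intro LIMSEQ_le_const2[OF tendsto_norm[OF tendsto_diff[OF tendsto_const LIMSEQ_ignore_initial_segment[OF Xlim[OF t], of n]]]])
        (auto simp: add.commute)
  qed
  have x0': "x 0 = x0" using LIMSEQ_unique[OF Xlim[of 0]] T by (simp add: X0)
  have xlip: "norm (x t - x s) \<le> integral {s..t} (\<lambda>s. 2 * \<phi> s)" if st: "0 \<le> s" "s \<le> t" "t \<le> T" for s t
  proof (rule LIMSEQ_le_const2)
    show "(\<lambda>n. norm (X (Suc n) t - X (Suc n) s)) \<longlonglongrightarrow> norm (x t - x s)"
      by (intro tendsto_intros LIMSEQ_Suc Xlim) (use st in auto)
  qed (use lip[OF Xa Xis st] in auto)
  have xa: "adm x"
    unfolding adm_def
  proof (intro conjI ballI)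
    show "continuous_on {0..T} x" by (rule continuous_on_if_dominated[OF \<phi>2 xlip])
    fix t assume t: "t \<in> {0..T}"
    show "1 + norm (x t) \<le> E t"
      by (rule LIMSEQ_le_const2[OF tendsto_add[OF tendsto_const tendsto_norm[OF Xlim[OF t]]]])
        (use Xa t in \<open>auto simp: adm_def\<close>)
  qed
  \<comment> \<open>The iterates converge uniformly at a geometric rate, so the forcings differ by
    at most \<open>l1\<close> times a null sequence, and so do their primitives after
    integration.\<close>
  have Glim: "(\<lambda>n. G (X n) t) \<longlonglongrightarrow> G x t" if t: "t \<in> {0..T}" for t
  proof -
    have bd: "norm (G (X n) t - G x t) \<le> integral {0..t} l1 * (2 * B * (1/2) ^ n)" for n
    proof -
      have i: "strongly_integrable (lebesgue_on {0..T}) (\<lambda>s. forcing (X n) s - forcing x s)"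
        by (rule strong_integral_diff(1)[OF CM Fi[OF Xa] Fi[OF xa]])
      have sub: "{0..t} \<subseteq> {0..T}" using t by auto
      have "G (X n) t - G x t = strong_integral (lebesgue_on {0..t}) (\<lambda>s. forcing (X n) s - forcing x s)"
        unfolding G_def
        by (rule strong_integral_diff(2)[symmetric, OF CM strongly_integrable_subinterval[OF Fi[OF Xa] sub] strongly_integrable_subinterval[OF Fi[OF xa] sub]])
      also have "norm \<dots> \<le> integral {0..t} (\<lambda>s. l1 s * (2 * B * (1/2) ^ n))"
      proof -
        have "AE s in lebesgue_on {0..T}. norm (forcing (X n) s - forcing x s) \<le> l1 s * (2 * B * (1/2) ^ n)"
          using l1A[OF Xa[of n] xa] AE_space
        proof eventually_elim
          fix s assume L: "\<forall>\<delta>\<ge>0. (\<forall>u\<in>{0..s}. norm (X n u - x u) \<le> \<delta>) \<longrightarrow> norm (forcing (X n) s - forcing x s) \<le> l1 s * \<delta>"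
            and s: "s \<in> space (lebesgue_on {0..T})"
          have "\<forall>u\<in>{0..s}. norm (X n u - x u) \<le> 2 * B * (1/2) ^ n" using Xx s by auto
          then show "norm (forcing (X n) s - forcing x s) \<le> l1 s * (2 * B * (1/2) ^ n)" using L B0 by simp
        qed
        from norm_primitive_diff_le[OF i integrable_mult_left[OF l1(1)] this, of 0 t] show ?thesis using t by simp
      qed
      also have "\<dots> = integral {0..t} l1 * (2 * B * (1/2) ^ n)" by simp
      finally show ?thesis .
    qed
    have "(\<lambda>n. integral {0..t} l1 * (2 * B * (1/2) ^ n)) \<longlonglongrightarrow> integral {0..t} l1 * (2 * B * 0)"
      by (intro tendsto_intros LIMSEQ_realpow_zero) auto
    then have "(\<lambda>n. G (X n) t - G x t) \<longlonglongrightarrow> 0"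
      by (intro Lim_null_comparison[OF always_eventually[OF allI[OF bd]]]) simp
    then show ?thesis by (simp add: LIM_zero_iff)
  qed
  have xis: "integrated_sweeping T r C V (G x) x"
    by (rule integrated_sweeping_LIMSEQ[OF Xis r(1) Glim LIMSEQ_Suc[OF Xlim] closed_C])
  have "absolutely_continuous_upto T x"
    unfolding absolutely_continuous_upto_def
    using strong_integral_representation[OF T \<phi>2 xlip] by blast
  moreover have "AE t in lebesgue_on {0..T}.
      \<exists>w. (x has_vector_derivative w) (at t within {0..T}) \<and>
        strongly_integrable (lebesgue_on {0..t}) (\<lambda>s. g t s (x s)) \<and>
        w \<in> {- n + f t (x t) + strong_integral (lebesgue_on {0..t}) (\<lambda>s. g t s (x s)) | n.
               n \<in> prox_normal_cone (C t) (x t)}"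
    using incl[OF xa xis] memory_integrable[OF conjunct1[OF xa[unfolded adm_def]]]
  proof eventually_elim
    fix t
    assume "inclusion_at T C (forcing x) (\<phi> t) x t"
      and mem: "strongly_integrable (lebesgue_on {0..t}) (\<lambda>s. g t s (x s))"
    then obtain u where u: "(x has_vector_derivative u) (at t within {0..T})" "forcing x t - u \<in> prox_normal_cone (C t) (x t)"
      unfolding inclusion_at_def by blast
    have "u = - (forcing x t - u) + f t (x t) + strong_integral (lebesgue_on {0..t}) (\<lambda>s. g t s (x s))"
      by (simp add: forcing_def memory_def)
    then show "\<exists>w. (x has_vector_derivative w) (at t within {0..T}) \<and>
        strongly_integrable (lebesgue_on {0..t}) (\<lambda>s. g t s (x s)) \<and>
        w \<in> {- n + f t (x t) + strong_integral (lebesgue_on {0..t}) (\<lambda>s. g t s (x s)) | n.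
               n \<in> prox_normal_cone (C t) (x t)}"
      using u mem by blast
  qed
  ultimately show ?thesis unfolding sweeping_solution_def using x0' by blast
qed

text \<open>The normal vector of a solution is its forcing minus its derivative, hence has an
  integrable bound. Two solutions with the same initial value then fall under
  \<open>volterra_contraction\<close> with \<open>P = 0\<close>, both as inputs and as
  outputs.\<close>

lemma sweeping_solution_unique:
  assumes x: "sweeping_solution T C f g x0 x" and y: "sweeping_solution T C f g x0 y" and t: "t \<in> {0..T}"
  shows "x t = y t"
proof -
  note CM = complete_measure_interval
  \<comment> \<open>The inclusion is recorded for every bound \<open>b\<close> of the curve, so that
    a radius common to both solutions can be inserted afterwards.\<close>
  have props: "\<exists>h. integrable (lebesgue_on {0..T}) h \<and> (\<forall>t. 0 \<le> h t) \<and>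
      (\<forall>s t. 0 \<le> s \<longrightarrow> s \<le> t \<longrightarrow> t \<le> T \<longrightarrow> norm (z t - z s) \<le> integral {s..t} h) \<and> continuous_on {0..T} z \<and>
      (\<exists>b. \<forall>t\<in>{0..T}. norm (z t) \<le> b) \<and>
      (\<forall>b. (\<forall>t\<in>{0..T}. norm (z t) \<le> b) \<longrightarrow> (AE t in lebesgue_on {0..T}. inclusion_at T C (forcing z) ((\<alpha> t + \<gamma> t) * (1 + b) + \<beta> t + h t) z t))"
    if z: "sweeping_solution T C f g x0 z" for z
  proof -
    obtain c h where h: "strongly_integrable (lebesgue_on {0..T}) h"
      "\<And>t. t \<in> {0..T} \<Longrightarrow> z t = c + strong_integral (lebesgue_on {0..t}) h"
      using z unfolding sweeping_solution_def absolutely_continuous_upto_def by blast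
    have ih: "integrable (lebesgue_on {0..T}) (\<lambda>t. norm (h t))" by (rule strongly_integrable_norm[OF CM h(1)])
    have lip: "norm (z t - z s) \<le> integral {s..t} (\<lambda>t. norm (h t))" if "0 \<le> s" "s \<le> t" "t \<le> T" for s t
      using norm_strong_integral_diff_le[OF h(1) that] h(2)[of s] h(2)[of t] that by simp
    have cont: "continuous_on {0..T} z" by (rule continuous_on_if_dominated[OF ih lip])
    have bdd: "\<exists>b. \<forall>t\<in>{0..T}. norm (z t) \<le> b"
      using compact_imp_bounded[OF compact_continuous_image[OF cont]] unfolding bounded_iff by (auto simp del: atLeastAtMost_iff)
    have AEs: "AE t in lebesgue_on {0..T}.
      \<exists>w. (z has_vector_derivative w) (at t within {0..T}) \<and>
        strongly_integrable (lebesgue_on {0..t}) (\<lambda>s. g t s (z s)) \<and>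
        w \<in> {- n + f t (z t) + strong_integral (lebesgue_on {0..t}) (\<lambda>s. g t s (z s)) | n.
               n \<in> prox_normal_cone (C t) (z t)}"
      using z unfolding sweeping_solution_def by blast
    have "AE t in lebesgue_on {0..T}. inclusion_at T C (forcing z) ((\<alpha> t + \<gamma> t) * (1 + b) + \<beta> t + norm (h t)) z t"
      if b: "\<forall>t\<in>{0..T}. norm (z t) \<le> b" for b
      using AEs AE_has_vector_derivative_strong_integral[OF h(1)] forcing_bound[OF cont] AE_space
    proof eventually_elim
      fix t
      assume "\<exists>w. (z has_vector_derivative w) (at t within {0..T}) \<and>
        strongly_integrable (lebesgue_on {0..t}) (\<lambda>s. g t s (z s)) \<and>
        w \<in> {- n + f t (z t) + strong_integral (lebesgue_on {0..t}) (\<lambda>s. g t s (z s)) | n.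
               n \<in> prox_normal_cone (C t) (z t)}"
        and dh: "((\<lambda>u. strong_integral (lebesgue_on {0..u}) h) has_vector_derivative h t) (at t within {0..T})"
        and fb: "\<forall>b. (\<forall>s\<in>{0..t}. norm (z s) \<le> b) \<longrightarrow> norm (forcing z t) \<le> (\<alpha> t + \<gamma> t) * (1 + b) + \<beta> t"
        and "t \<in> space (lebesgue_on {0..T})"
      then obtain u n where u: "(z has_vector_derivative u) (at t within {0..T})"
        and n: "n \<in> prox_normal_cone (C t) (z t)" and "u = - n + f t (z t) + memory z t" and t: "t \<in> {0..T}"
        unfolding memory_def by auto
      then have n': "forcing z t - u = n" by (simp add: forcing_def)
      have "((\<lambda>u. c + strong_integral (lebesgue_on {0..u}) h) has_vector_derivative 0 + h t) (at t within {0..T})"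
        by (intro has_vector_derivative_add has_vector_derivative_const dh)
      then have "(z has_vector_derivative 0 + h t) (at t within {0..T})"
        by (rule has_vector_derivative_transform[rotated 2]) (use t in simp, rule h(2))
      \<comment> \<open>The derivative in the inclusion agrees almost everywhere with the density of
        the representation, which is integrable.\<close>
      then have uh: "u = h t"
        using vector_derivative_unique_within_closed_interval[of 0 T t] T t u by simp
      have "norm (forcing z t) \<le> (\<alpha> t + \<gamma> t) * (1 + b) + \<beta> t" using fb b t by auto
      then have "norm (forcing z t - u) \<le> (\<alpha> t + \<gamma> t) * (1 + b) + \<beta> t + norm (h t)"
        using norm_triangle_ineq4[of "forcing z t" u] uh by simp
      then show "inclusion_at T C (forcing z) ((\<alpha> t + \<gamma> t) * (1 + b) + \<beta> t + norm (h t)) z t"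
        unfolding inclusion_at_def using u n n' by auto
    qed
    then show ?thesis using ih lip cont bdd by (intro exI[of _ "\<lambda>t. norm (h t)"]) auto
  qed
  obtain hx bx where hx: "integrable (lebesgue_on {0..T}) hx" "\<And>t. 0 \<le> hx t"
    "\<And>s t. 0 \<le> s \<Longrightarrow> s \<le> t \<Longrightarrow> t \<le> T \<Longrightarrow> norm (x t - x s) \<le> integral {s..t} hx" "continuous_on {0..T} x"
    "\<And>t. t \<in> {0..T} \<Longrightarrow> norm (x t) \<le> bx"
    "\<And>b. (\<forall>t\<in>{0..T}. norm (x t) \<le> b) \<Longrightarrow> (AE t in lebesgue_on {0..T}. inclusion_at T C (forcing x) ((\<alpha> t + \<gamma> t) * (1 + b) + \<beta> t + hx t) x t)"
    using props[OF x] by blast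
  obtain hy b' where hy: "integrable (lebesgue_on {0..T}) hy" "\<And>t. 0 \<le> hy t"
    "\<And>s t. 0 \<le> s \<Longrightarrow> s \<le> t \<Longrightarrow> t \<le> T \<Longrightarrow> norm (y t - y s) \<le> integral {s..t} hy" "continuous_on {0..T} y"
    "\<And>t. t \<in> {0..T} \<Longrightarrow> norm (y t) \<le> b'"
    "\<And>b. (\<forall>t\<in>{0..T}. norm (y t) \<le> b) \<Longrightarrow> (AE t in lebesgue_on {0..T}. inclusion_at T C (forcing y) ((\<alpha> t + \<gamma> t) * (1 + b) + \<beta> t + hy t) y t)"
    using props[OF y] by blast
  define R where "R = max 1 (max bx b')"
  have R: "R > 0" "\<And>t. t \<in> {0..T} \<Longrightarrow> norm (x t) \<le> R" "\<And>t. t \<in> {0..T} \<Longrightarrow> norm (y t) \<le> R"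
    using hx(5) hy(5) by (auto simp: R_def le_max_iff_disj)
  obtain l1 where l1: "integrable (lebesgue_on {0..T}) l1" "\<And>t. t \<in> {0..T} \<Longrightarrow> 0 \<le> l1 t"
    and l1F: "\<And>x y. continuous_on {0..T} x \<Longrightarrow> continuous_on {0..T} y \<Longrightarrow>
      (\<And>t. t \<in> {0..T} \<Longrightarrow> norm (x t) \<le> R) \<Longrightarrow> (\<And>t. t \<in> {0..T} \<Longrightarrow> norm (y t) \<le> R) \<Longrightarrow>
      AE t in lebesgue_on {0..T}. \<forall>\<delta>\<ge>0. (\<forall>s\<in>{0..t}. norm (x s - y s) \<le> \<delta>) \<longrightarrow> norm (forcing x t - forcing y t) \<le> l1 t * \<delta>"
    using forcing_lipschitz[OF R(1)] by blast
  define \<phi> where "\<phi> t = hx t + hy t" for t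
  have \<phi>: "integrable (lebesgue_on {0..T}) \<phi>" using hx hy by (simp add: \<phi>_def[abs_def])
  \<comment> \<open>A bound of the normal vectors of both solutions: growth of the forcing on the
    ball of radius \<open>R\<close>, plus the two speeds.\<close>
  define \<nu> where "\<nu> t = (\<alpha> t + \<gamma> t) * (1 + R) + \<beta> t + \<phi> t" for t
  have \<nu>: "integrable (lebesgue_on {0..T}) \<nu>" "\<And>t. t \<in> {0..T} \<Longrightarrow> 0 \<le> \<nu> t"
  proof -
    show "integrable (lebesgue_on {0..T}) \<nu>" using \<alpha>(1) \<beta>(1) \<gamma>(1) \<phi> by (simp add: \<nu>_def[abs_def])
    show "0 \<le> \<nu> t" if "t \<in> {0..T}" for t
      using \<alpha>(2)[OF that] \<beta>(2)[OF that] \<gamma>(2)[of t] hx(2)[of t] hy(2)[of t] R(1) by (simp add: \<nu>_def \<phi>_def)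
  qed
  have mono: "integral {s..t} hx \<le> integral {s..t} \<phi>" "integral {s..t} hy \<le> integral {s..t} \<phi>"
    if "0 \<le> s" "s \<le> t" "t \<le> T" for s t
    using that hx(2) hy(2) by (auto intro!: integral_mono_AE_on[OF hx(1) \<phi>] integral_mono_AE_on[OF hy(1) \<phi>] AE_I2 simp: \<phi>_def)
  have "(norm (x t - y t))\<^sup>2 \<le> 0 / 4 * exp (5 * integral {0..t} (\<lambda>s. 2 * l1 s + 2 * \<nu> s / r))"
  proof (rule volterra_contraction[OF \<phi> _ _ _ _ _ \<nu> l1 l1F[OF hx(4) hy(4) R(2,3)] _ _ t])
    show "norm (x t - x s) \<le> integral {s..t} \<phi>" if "0 \<le> s" "s \<le> t" "t \<le> T" for s t
      using hx(3)[OF that] mono(1)[OF that] by linarith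
    show "norm (y t - y s) \<le> integral {s..t} \<phi>" if "0 \<le> s" "s \<le> t" "t \<le> T" for s t
      using hy(3)[OF that] mono(2)[OF that] by linarith
    show "x 0 = y 0" using x y by (simp add: sweeping_solution_def)
    have "AE t in lebesgue_on {0..T}. inclusion_at T C (forcing x) ((\<alpha> t + \<gamma> t) * (1 + R) + \<beta> t + hx t) x t"
      using R(2) by (intro hx(6)) blast
    then show "AE t in lebesgue_on {0..T}. inclusion_at T C (forcing x) (\<nu> t) x t"
      by eventually_elim (erule inclusion_at_mono, use hy(2) in \<open>simp add: \<nu>_def \<phi>_def\<close>)
    have "AE t in lebesgue_on {0..T}. inclusion_at T C (forcing y) ((\<alpha> t + \<gamma> t) * (1 + R) + \<beta> t + hy t) y t"
      using R(3) by (intro hy(6)) blast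
    then show "AE t in lebesgue_on {0..T}. inclusion_at T C (forcing y) (\<nu> t) y t"
      by eventually_elim (erule inclusion_at_mono, use hx(2) in \<open>simp add: \<nu>_def \<phi>_def\<close>)
  qed auto
  then show ?thesis by simp
qed

end

theorem theorem6p1:
  fixes T :: real and \<rho> :: ereal
    and C :: "real \<Rightarrow> 'a::{real_inner,complete_space} set"
    and v :: "real \<Rightarrow> real"
    and f :: "real \<Rightarrow> 'a \<Rightarrow> 'a"
    and \<alpha> \<beta> :: "real \<Rightarrow> real"
    and g :: "real \<Rightarrow> real \<Rightarrow> 'a \<Rightarrow> 'a"
    and \<sigma> :: "real \<times> real \<Rightarrow> real"
    and D :: "(real \<times> real) set"
    and x\<^sub>0 :: 'a
  assumes T: "T > 0"
    and D: "D = {(t, s). t \<in> {0..T} \<and> s \<in> {0..T} \<and> s \<le> t}"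
    and \<rho>: "\<rho> > 0"
    and C_values: "\<And>t. t \<in> {0..T} \<Longrightarrow>
          C t \<noteq> {} \<and> closed (C t) \<and> uniformly_prox_regular \<rho> (C t)"
    and v: "absolutely_continuous_upto T v"
    and C_v: "\<And>t s. t \<in> {0..T} \<Longrightarrow> s \<in> {0..T} \<Longrightarrow> Haus (C t) (C s) \<le> ennreal \<bar>v t - v s\<bar>"
    and f_meas: "\<And>x. strongly_measurable (lebesgue_on {0..T}) (\<lambda>t. f t x)"
    and \<alpha>: "integrable (lebesgue_on {0..T}) \<alpha>" "\<And>t. t \<in> {0..T} \<Longrightarrow> \<alpha> t \<ge> 0"
    and \<beta>: "integrable (lebesgue_on {0..T}) \<beta>" "\<And>t. t \<in> {0..T} \<Longrightarrow> \<beta> t \<ge> 0"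
    and f_growth: "\<And>t x. t \<in> {0..T} \<Longrightarrow> norm (f t x) \<le> \<alpha> t * norm x + \<beta> t"
    and f_lip: "\<And>r. r > 0 \<Longrightarrow> \<exists>\<kappa>\<ge>0. \<forall>t\<in>{0..T}. \<forall>x\<in>cball 0 r. \<forall>y\<in>cball 0 r.
          norm (f t x - f t y) \<le> \<kappa> * norm (x - y)"
    and g_meas: "\<And>x. strongly_measurable (lebesgue_on ({0..T} \<times> {0..T})) (\<lambda>(t, s). g t s x)"
    and g_lip: "\<And>r. r > 0 \<Longrightarrow> \<exists>\<mu>. integrable (lebesgue_on {0..T}) \<mu> \<and>
          (\<forall>t\<in>{0..T}. \<mu> t \<ge> 0) \<and>
          (\<forall>(t, s)\<in>D. \<forall>x\<in>cball 0 r. \<forall>y\<in>cball 0 r.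
            norm (g t s x - g t s y) \<le> \<mu> t * norm (x - y))"
    and \<sigma>: "integrable (lebesgue_on D) \<sigma>" "\<And>t s. (t, s) \<in> D \<Longrightarrow> \<sigma> (t, s) \<ge> 0"
    and g_growth: "\<And>t s x. (t, s) \<in> D \<Longrightarrow> norm (g t s x) \<le> \<sigma> (t, s) * (1 + norm x)"
    and x\<^sub>0: "x\<^sub>0 \<in> C 0"
  shows "(\<exists>x. sweeping_solution T C f g x\<^sub>0 x) \<and>
    (\<forall>x y. sweeping_solution T C f g x\<^sub>0 x \<longrightarrow> sweeping_solution T C f g x\<^sub>0 y \<longrightarrow>
      (\<forall>t\<in>{0..T}. x t = y t))"
proof -
  note CM = complete_measure_interval
  \<comment> \<open>A finite radius is fixed since \<open>\<rho>\<close> may be infinite, whereas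
    the estimates divide by \<open>r\<close>.\<close>
  obtain r where r: "0 < r" "ereal r \<le> \<rho>"
    using \<rho> ereal_dense2[of 0 \<rho>] by (metis ereal_less(2) less_imp_le)
  obtain c h where h: "strongly_integrable (lebesgue_on {0..T}) h"
    "\<And>t. t \<in> {0..T} \<Longrightarrow> v t = c + strong_integral (lebesgue_on {0..t}) h"
    using v unfolding absolutely_continuous_upto_def by blast
  \<comment> \<open>The modulus of the density of \<open>v\<close> becomes the speed of the moving
    set; unlike \<open>v\<close>, its primitive is monotone.\<close>
  have dv: "\<bar>v t - v s\<bar> \<le> integral {s..t} (\<lambda>t. \<bar>h t\<bar>)" if "0 \<le> s" "s \<le> t" "t \<le> T" for s t
    using norm_strong_integral_diff_le[OF h(1) that] h(2)[of s] h(2)[of t] that by simp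
  interpret volterra_sweeping T r \<rho> C "\<lambda>t. \<bar>h t\<bar>" f \<alpha> \<beta> g \<sigma> D
  proof
    show "integrable (lebesgue_on {0..T}) (\<lambda>t. \<bar>h t\<bar>)"
      using strongly_integrable_norm[OF CM h(1)] by simp
    show "infdist x (C t) \<le> integral {s..t} (\<lambda>t. \<bar>h t\<bar>)" if "0 \<le> s" "s \<le> t" "t \<le> T" "x \<in> C s" for s t x
      using infdist_le_Haus[OF C_v[of s t] _ that(4)] dv[of s t] that by (simp add: abs_minus_commute)
    show "infdist x (C s) \<le> integral {s..t} (\<lambda>t. \<bar>h t\<bar>)" if "0 \<le> s" "s \<le> t" "t \<le> T" "x \<in> C t" for s t x
      using infdist_le_Haus[OF C_v[of t s] _ that(4)] dv[of s t] that by simp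
  qed (use T r D C_values f_meas \<alpha> \<beta> f_growth f_lip g_meas g_lip \<sigma> g_growth in auto)
  show ?thesis using sweeping_solution_exists[OF x\<^sub>0] sweeping_solution_unique by blast
qed

end
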